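(* Let $k,l\ge1$. For all heights $a,b,c,e,f,g$ with $a-b,\ f-e\in\{-k,-k+2,\dots,k\}$ and $b-c,\ g-f\in\{-l,-l+2,\dots,l\}$, and generic $u,v$, $$\sum_{d}W^{(k,l)}\left(\left.\begin{array}{cc} a & b \\ d & c \end{array}\right|u-v\right)L^{(k)}\left(\left.\begin{array}{cc} d & c \\ f & e \end{array}\right|u\right)L^{(l)}\left(\left.\begin{array}{cc} a & d \\ g & f \end{array}\right|v\right)$$ $$=\sum_{d}L^{(k)}\left(\left.\begin{array}{cc} a & b \\ g & d \end{array}\right|u\right)L^{(l)}\left(\left.\begin{array}{cc} b & c \\ d & e \end{array}\right|v\right)W^{(k,l)}\left(\left.\begin{array}{cc} g & d \\ f & e \end{array}\right|u-v\right),$$ where $d$ runs over the integers for which all admissibility conditions are satisfied (on the left: $a-d\in\{-l,-l+2,\dots,l\}$, $d-c\in\{-k,-k+2,\dots,k\}$; on the right: $g-d\in\{-k,-k+2,\dots,k\}$, $d-e\in\{-l,-l+2,\dots,l\}$).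
   Context: Theta functions. Fix $\tau\in\mathbb{C}$ with $\mathrm{Im}\,\tau>0$ and a parameter $r$; put $\tilde p=e^{2\pi i\tau}$, $x=e^{-\pi i/(r\tau)}$ (powers $x^s=e^{-\pi i s/(r\tau)}$), $p=x^{2r}=e^{-2\pi i/\tau}$, with $|x|<1$. Let $\vartheta_1(u|\tau)=2\tilde p^{1/8}(\tilde p;\tilde p)_\infty\sin\pi u\prod_{n\ge1}(1-2\tilde p^n\cos 2\pi u+\tilde p^{2n})$, $\vartheta_0(u|\tau)=-ie^{\pi i(u+\tau/4)}\vartheta_1(u+\frac{\tau}{2}|\tau)$, $\vartheta_3(u|\tau)=e^{\pi i(u+\tau/4)}\vartheta_1(u+\frac{\tau+1}{2}|\tau)$. Set $[u]=C\,\vartheta_1(\frac{u}{r}|\tau)$ with $C=x^{-r/4}e^{-\pi i/4}\tau^{1/2}$. Face weights. Heights are integers. With $z=x^{2u}$ and $(w;s,t)_\infty=\prod_{i,j\ge0}(1-ws^it^j)$ let $$R_0(u)=z^{-\frac{r-1}{2r}}\frac{(px^2z;x^4,p)_\infty(x^2z;x^4,p)_\infty(p/z;x^4,p)_\infty(x^4/z;x^4,p)_\infty}{(px^2/z;x^4,p)_\infty(x^2/z;x^4,p)_\infty(pz;x^4,p)_\infty(x^4z;x^4,p)_\infty},\qquad z^{-\frac{r-1}{2r}}:=x^{-\frac{u(r-1)}{r}}.$$ The weights $W\left(\left.\begin{array}{cc} a & b \\ d & c \end{array}\right|u\right)$ are zero unless adjacent heights ($a,b$; $b,c$; $a,d$;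 $d,c$) differ by $\pm1$, and the nonzero ones are $$W\left(\left.\begin{array}{cc} a & a\pm1 \\ a\pm1 & a\pm2 \end{array}\right|u\right)=R_0(u),\quad W\left(\left.\begin{array}{cc} a & a\pm1 \\ a\pm1 & a \end{array}\right|u\right)=R_0(u)\frac{[a\mp u][1]}{[a][1+u]},\quad W\left(\left.\begin{array}{cc} a & a\pm1 \\ a\mp1 & a \end{array}\right|u\right)=R_0(u)\frac{[a\pm1][u]}{[a][1+u]}.$$ Fused face weights. Define $$W^{(k,1)}\left(\left.\begin{array}{cc} a & b \\ d & c \end{array}\right|u\right)=\sum_{d_1,\dots,d_{k-1}}\prod_{i=1}^{k}W\left(\left.\begin{array}{cc} a_{i-1} & a_i \\ d_{i-1} & d_i \end{array}\right|u+k-i\right),\quad a_0=a,\ a_k=b,\ d_0=d,\ d_k=c,$$ which is independent of the choice of $a_1,\dots,a_{k-1}$ with $|a_{i-1}-a_i|=1$; and $$W^{(k,l)}\left(\left.\begin{array}{cc} a & b \\ d & c \end{array}\right|u\right)=\sum_{a_1,\dots,a_{l-1}}\prod_{i=1}^{l}W^{(k,1)}\left(\left.\begin{array}{cc} a_{i-1} & b_{i-1} \\ a_i & b_i \end{array}\right|u-l+i\right),\quad a_0=a,\ a_l=d,\ b_0=b,\ b_l=c,$$ which is independent of the choice of $b_1,\dots,b_{l-1}$ with $|b_{i-1}-b_i|=1$. In $W^{(k,l)}$ horizontally adjacent heights differ by elements of $\{-k,-k+2,\dots,k\}$ and vertically adjacent ones by elements of $\{-l,-l+2,\dots,l\}$.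 Intertwining vectors. For heights with $|a-b|=1$ let $\psi_+(u)^a_b=\vartheta_0\big(\frac{(a-b)u+a}{2r}\big|\frac{\tau}{2}\big)$, $\psi_-(u)^a_b=\vartheta_3\big(\frac{(a-b)u+a}{2r}\big|\frac{\tau}{2}\big)$, and, for $\varepsilon=\pm$ (identified with $\pm1$), $\psi^*_\varepsilon(u)^a_b=-\varepsilon\,\frac{a-b}{2[b][u]}\,C^2\,\psi_{-\varepsilon}(u-1)^a_b$. For $a-b\in\{-k,-k+2,\dots,k\}$ and $\mu\in\{-k,-k+2,\dots,k\}$, $$\psi^{(k)}_\mu(u)^a_b=\sum_{\varepsilon_1+\cdots+\varepsilon_k=\mu}\psi_{\varepsilon_1}(u+k-1)^a_{c_1}\psi_{\varepsilon_2}(u+k-2)^{c_1}_{c_2}\cdots\psi_{\varepsilon_k}(u)^{c_{k-1}}_b,$$ which is independent of the choice of $c_1,\dots,c_{k-1}$ with $|a-c_1|=|c_1-c_2|=\cdots=|c_{k-1}-b|=1$; and $$\psi^{*(k)}_\mu(u)^b_a=\sum_{c_1,\dots,c_{k-1}}\psi^*_{\varepsilon_1}(u+k-1)^{c_1}_a\psi^*_{\varepsilon_2}(u+k-2)^{c_2}_{c_1}\cdots\psi^*_{\varepsilon_k}(u)^b_{c_{k-1}},$$ summed over all $c_1,\dots,c_{k-1}$ with consecutive heights in $a,c_1,\dots,c_{k-1},b$ differing by $\pm1$, which is independent of the choice of $\varepsilon_1,\dots,\varepsilon_k\in\{\pm1\}$ with $\varepsilon_1+\cdots+\varepsilon_k=\mu$.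 $L$-matrix (the elliptic $6j$-symbol). For $a-b,\ c-d\in\{-k,-k+2,\dots,k\}$ (no condition relating $a$ to $c$), $$L^{(k)}\left(\left.\begin{array}{cc} a & b \\ c & d \end{array}\right|u\right)=\sum_{\mu\in\{-k,-k+2,\dots,k\}}\psi^{*(k)}_\mu(u)^d_c\,\psi^{(k)}_\mu(u)^a_b.$$ Genericity: $r,\tau,u,v$ and the heights are such that no denominator in the quantities involved vanishes. *)

theory Defs
  imports "HOL-Analysis.Analysis"
begin

section \<open>Theta functions\<close>

definition qpoch :: "complex \<Rightarrow> complex \<Rightarrow> complex" where
  "qpoch w s = (\<Prod>n. 1 - w * s ^ n)"

definition qpoch2 :: "complex \<Rightarrow> complex \<Rightarrow> complex \<Rightarrow> complex" where
  "qpoch2 w s t = (\<Prod>i. \<Prod>j. 1 - w * s ^ i * t ^ j)"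

text \<open>The fractional power of the nome in \<open>theta1\<close> is the branch
  \<open>exp (2 \<pi> i \<tau>) ^ (1/8) = exp (\<pi> i \<tau> / 4)\<close>.\<close>

definition theta1 :: "complex \<Rightarrow> complex \<Rightarrow> complex" where
  "theta1 u \<tau> =
     (let q = exp (2 * of_real pi * \<i> * \<tau>) in
        2 * exp (of_real pi * \<i> * \<tau> / 4) * qpoch q q * sin (of_real pi * u) *
        (\<Prod>n. 1 - 2 * q ^ Suc n * cos (2 * of_real pi * u) + q ^ (2 * Suc n)))"

definition theta0 :: "complex \<Rightarrow> complex \<Rightarrow> complex" where
  "theta0 u \<tau> = - \<i> * exp (of_real pi * \<i> * (u + \<tau> / 4)) * theta1 (u + \<tau> / 2) \<tau>"

definition theta3 :: "complex \<Rightarrow> complex \<Rightarrow> complex" where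
  "theta3 u \<tau> = exp (of_real pi * \<i> * (u + \<tau> / 4)) * theta1 (u + (\<tau> + 1) / 2) \<tau>"

text \<open>\<open>xpow r \<tau> s\<close> is \<open>x\<^sup>s\<close> for \<open>x = exp (- \<pi> i / (r \<tau>))\<close>; the nome \<open>p = x\<^sup>2\<^sup>r\<close> is \<open>nome \<tau>\<close>.\<close>

definition xpow :: "complex \<Rightarrow> complex \<Rightarrow> complex \<Rightarrow> complex" where
  "xpow r \<tau> s = exp (- of_real pi * \<i> * s / (r * \<tau>))"

definition nome :: "complex \<Rightarrow> complex" where
  "nome \<tau> = exp (- 2 * of_real pi * \<i> / \<tau>)"

definition Cconst :: "complex \<Rightarrow> complex \<Rightarrow> complex" where
  "Cconst r \<tau> = xpow r \<tau> (- r / 4) * exp (- of_real pi * \<i> / 4) * csqrt \<tau>"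

definition bracket :: "complex \<Rightarrow> complex \<Rightarrow> complex \<Rightarrow> complex" where
  "bracket r \<tau> u = Cconst r \<tau> * theta1 (u / r) \<tau>"


section \<open>Heights\<close>

definition steps :: "nat \<Rightarrow> int set" where
  "steps k = {2 * int j - int k | j. j \<le> k}"

definition height_paths :: "nat \<Rightarrow> int \<Rightarrow> int \<Rightarrow> int list set" where
  "height_paths k a b =
     {hs. length hs = k + 1 \<and> hs ! 0 = a \<and> hs ! k = b \<and>
          (\<forall>i\<in>{1..k}. \<bar>hs ! (i - 1) - hs ! i\<bar> = 1)}"

definition sign_lists :: "nat \<Rightarrow> int \<Rightarrow> int list set" where
  "sign_lists k \<mu> = {es. length es = k \<and> set es \<subseteq> {1, -1} \<and> sum_list es = \<mu>}"

text \<open>The fused objects below do not depend on certain auxiliary paths or sign sequences. Their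
  definitions use an unspecified admissible one.\<close>

definition some_path :: "nat \<Rightarrow> int \<Rightarrow> int \<Rightarrow> int list" where
  "some_path k a b = (SOME hs. hs \<in> height_paths k a b)"

definition some_signs :: "nat \<Rightarrow> int \<Rightarrow> int list" where
  "some_signs k \<mu> = (SOME es. es \<in> sign_lists k \<mu>)"


section \<open>Face weights\<close>

definition R0_denom :: "complex \<Rightarrow> complex \<Rightarrow> complex \<Rightarrow> complex" where
  "R0_denom r \<tau> u =
     (let x = xpow r \<tau> 1; p = nome \<tau>; z = xpow r \<tau> (2 * u) in
        qpoch2 (p * x^2 / z) (x^4) p * qpoch2 (x^2 / z) (x^4) p *
        qpoch2 (p * z) (x^4) p * qpoch2 (x^4 * z) (x^4) p)"

definition R0 :: "complex \<Rightarrow> complex \<Rightarrow> complex \<Rightarrow> complex" where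
  "R0 r \<tau> u =
     (let x = xpow r \<tau> 1; p = nome \<tau>; z = xpow r \<tau> (2 * u) in
        xpow r \<tau> (- u * (r - 1) / r) *
        (qpoch2 (p * x^2 * z) (x^4) p * qpoch2 (x^2 * z) (x^4) p *
         qpoch2 (p / z) (x^4) p * qpoch2 (x^4 / z) (x^4) p) / R0_denom r \<tau> u)"

text \<open>Matrices of heights are read row by row: the arguments \<open>a b d c\<close> stand for the square with
  top row \<open>a, b\<close> and bottom row \<open>d, c\<close>. If the four pairs of neighbours differ by \<open>\<plusminus>1\<close> and \<open>c \<noteq> a\<close>,
  then \<open>b = d = a \<plusminus> 1\<close> and \<open>c = a \<plusminus> 2\<close>.\<close>

definition face_adjacent :: "int \<Rightarrow> int \<Rightarrow> int \<Rightarrow> int \<Rightarrow> bool" where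
  "face_adjacent a b d c \<longleftrightarrow>
     \<bar>a - b\<bar> = 1 \<and> \<bar>b - c\<bar> = 1 \<and> \<bar>a - d\<bar> = 1 \<and> \<bar>d - c\<bar> = 1"

definition face_weight ::
    "complex \<Rightarrow> complex \<Rightarrow> int \<Rightarrow> int \<Rightarrow> int \<Rightarrow> int \<Rightarrow> complex \<Rightarrow> complex" where
  "face_weight r \<tau> a b d c u =
     (if \<not> face_adjacent a b d c then 0
      else if c \<noteq> a then R0 r \<tau> u
      else if d = b then
        R0 r \<tau> u * (bracket r \<tau> (of_int a - of_int (b - a) * u) * bracket r \<tau> 1 /
                   (bracket r \<tau> (of_int a) * bracket r \<tau> (1 + u)))
      else
        R0 r \<tau> u * (bracket r \<tau> (of_int b) * bracket r \<tau> u /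
                   (bracket r \<tau> (of_int a) * bracket r \<tau> (1 + u))))"

definition face_weight_k1 ::
    "complex \<Rightarrow> complex \<Rightarrow> nat \<Rightarrow> int \<Rightarrow> int \<Rightarrow> int \<Rightarrow> int \<Rightarrow> complex \<Rightarrow> complex" where
  "face_weight_k1 r \<tau> k a b d c u =
     (if height_paths k a b = {} then 0
      else let as = some_path k a b in
        \<Sum>ds\<in>height_paths k d c. \<Prod>i=1..k.
          face_weight r \<tau> (as ! (i - 1)) (as ! i) (ds ! (i - 1)) (ds ! i)
            (u + of_nat k - of_nat i))"

definition face_weight_kl ::
    "complex \<Rightarrow> complex \<Rightarrow> nat \<Rightarrow> nat \<Rightarrow> int \<Rightarrow> int \<Rightarrow> int \<Rightarrow> int \<Rightarrow> complex \<Rightarrow> complex" where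
  "face_weight_kl r \<tau> k l a b d c u =
     (if height_paths l b c = {} then 0
      else let bs = some_path l b c in
        \<Sum>as\<in>height_paths l a d. \<Prod>i=1..l.
          face_weight_k1 r \<tau> k (as ! (i - 1)) (bs ! (i - 1)) (as ! i) (bs ! i)
            (u - of_nat l + of_nat i))"


section \<open>Intertwining vectors and the L-matrix\<close>

text \<open>Signs \<open>\<epsilon> = \<plusminus>\<close> are the integers \<open>1\<close> and \<open>- 1\<close>. In \<open>psi\<close> and \<open>psi_k\<close>, and likewise in
  \<open>psi_star\<close> and \<open>psi_star_k\<close>, the first height argument is the upper index and the second one
  the lower index.\<close>

definition psi :: "complex \<Rightarrow> complex \<Rightarrow> int \<Rightarrow> complex \<Rightarrow> int \<Rightarrow> int \<Rightarrow> complex" where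
  "psi r \<tau> \<epsilon> u a b =
     (if \<epsilon> = 1 then theta0 ((of_int (a - b) * u + of_int a) / (2 * r)) (\<tau> / 2)
      else theta3 ((of_int (a - b) * u + of_int a) / (2 * r)) (\<tau> / 2))"

definition psi_star :: "complex \<Rightarrow> complex \<Rightarrow> int \<Rightarrow> complex \<Rightarrow> int \<Rightarrow> int \<Rightarrow> complex" where
  "psi_star r \<tau> \<epsilon> u a b =
     - of_int \<epsilon> * (of_int (a - b) / (2 * bracket r \<tau> (of_int b) * bracket r \<tau> u)) *
     (Cconst r \<tau>)^2 * psi r \<tau> (- \<epsilon>) (u - 1) a b"

definition psi_k ::
    "complex \<Rightarrow> complex \<Rightarrow> nat \<Rightarrow> int \<Rightarrow> complex \<Rightarrow> int \<Rightarrow> int \<Rightarrow> complex" where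
  "psi_k r \<tau> k \<mu> u a b =
     (let cs = some_path k a b in
        \<Sum>es\<in>sign_lists k \<mu>. \<Prod>i=1..k.
          psi r \<tau> (es ! (i - 1)) (u + of_nat k - of_nat i) (cs ! (i - 1)) (cs ! i))"

definition psi_star_k ::
    "complex \<Rightarrow> complex \<Rightarrow> nat \<Rightarrow> int \<Rightarrow> complex \<Rightarrow> int \<Rightarrow> int \<Rightarrow> complex" where
  "psi_star_k r \<tau> k \<mu> u b a =
     (let es = some_signs k \<mu> in
        \<Sum>cs\<in>height_paths k a b. \<Prod>i=1..k.
          psi_star r \<tau> (es ! (i - 1)) (u + of_nat k - of_nat i) (cs ! i) (cs ! (i - 1)))"

definition L_matrix ::
    "complex \<Rightarrow> complex \<Rightarrow> nat \<Rightarrow> int \<Rightarrow> int \<Rightarrow> int \<Rightarrow> int \<Rightarrow> complex \<Rightarrow> complex" where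
  "L_matrix r \<tau> k a b c d u =
     (\<Sum>\<mu>\<in>steps k. psi_star_k r \<tau> k \<mu> u d c * psi_k r \<tau> k \<mu> u a b)"


section \<open>Genericity\<close>

text \<open>Division by zero yields zero in HOL, so the requirement that no denominator vanishes is
  spelled out. The following predicates follow the definitions of the weights and of the L-matrix.
  They range over all choices of the auxiliary paths, and over those summands that do not vanish
  because of an adjacency condition. A face weight with \<open>c = a \<plusminus> 2\<close> has no denominator besides
  that of \<open>R0\<close>.\<close>

definition face_generic ::
    "complex \<Rightarrow> complex \<Rightarrow> int \<Rightarrow> int \<Rightarrow> int \<Rightarrow> int \<Rightarrow> complex \<Rightarrow> bool" where
  "face_generic r \<tau> a b d c u \<longleftrightarrow>
     (face_adjacent a b d c \<longrightarrow>
        R0_denom r \<tau> u \<noteq> 0 \<and>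
        (c = a \<longrightarrow> bracket r \<tau> (of_int a) \<noteq> 0 \<and> bracket r \<tau> (1 + u) \<noteq> 0))"

definition face_k1_generic ::
    "complex \<Rightarrow> complex \<Rightarrow> nat \<Rightarrow> int \<Rightarrow> int \<Rightarrow> int \<Rightarrow> int \<Rightarrow> complex \<Rightarrow> bool" where
  "face_k1_generic r \<tau> k a b d c u \<longleftrightarrow>
     (\<forall>as\<in>height_paths k a b. \<forall>ds\<in>height_paths k d c.
        (\<forall>i\<le>k. \<bar>as ! i - ds ! i\<bar> = 1) \<longrightarrow>
        (\<forall>i\<in>{1..k}. face_generic r \<tau> (as ! (i - 1)) (as ! i) (ds ! (i - 1)) (ds ! i)
            (u + of_nat k - of_nat i)))"

definition face_kl_generic ::
    "complex \<Rightarrow> complex \<Rightarrow> nat \<Rightarrow> nat \<Rightarrow> int \<Rightarrow> int \<Rightarrow> int \<Rightarrow> int \<Rightarrow> complex \<Rightarrow> bool" where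
  "face_kl_generic r \<tau> k l a b d c u \<longleftrightarrow>
     (\<forall>as\<in>height_paths l a d. \<forall>bs\<in>height_paths l b c.
        (\<forall>i\<le>l. as ! i - bs ! i \<in> steps k) \<longrightarrow>
        (\<forall>i\<in>{1..l}. face_k1_generic r \<tau> k (as ! (i - 1)) (bs ! (i - 1)) (as ! i) (bs ! i)
            (u - of_nat l + of_nat i)))"

text \<open>The only denominators of \<open>L_matrix r \<tau> k a b c d u\<close> are those of its factors
  \<open>psi_star_k r \<tau> k \<mu> u d c\<close>, so \<open>a\<close> and \<open>b\<close> are not needed.\<close>

definition L_generic ::
    "complex \<Rightarrow> complex \<Rightarrow> nat \<Rightarrow> int \<Rightarrow> int \<Rightarrow> complex \<Rightarrow> bool" where
  "L_generic r \<tau> k c d u \<longleftrightarrow>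
     (\<forall>cs\<in>height_paths k c d. \<forall>i\<in>{1..k}.
        bracket r \<tau> (of_int (cs ! (i - 1))) \<noteq> 0 \<and>
        bracket r \<tau> (u + of_nat k - of_nat i) \<noteq> 0)"

end

theory Submission
  imports Defs "HOL-Complex_Analysis.Conformal_Mappings"
begin

text \<open>The theorem is the exchange relation for a single face, transported through fusion.

\<^bold>\<open>One face.\<close> By the parity of \<open>theta0\<close> and \<open>theta3\<close>, the functions
\<open>x \<mapsto> theta0 (x / 2r | \<tau> / 2)\<close> and \<open>x \<mapsto> theta3 (x / 2r | \<tau> / 2)\<close> are the coordinates of an even map \<open>v\<close> into a
two-dimensional space, and the addition formula (\<open>theta_addition_formula\<close>) says that \<open>det (v x, v y)\<close> is a
constant times \<open>[(x + y) / 2] [(x - y) / 2]\<close>. The intertwining vectors and their duals are values of \<open>v\<close>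
up to scalars, and \<open>L\<close> for \<open>k = 1\<close> is a scalar times such a determinant. With \<open>w = u - v\<close> the tensors
\<open>T x = v x \<otimes> v (x + 1 + w)\<close> and \<open>T' x = v (x + 1) \<otimes> v (x + w)\<close> satisfy
\<open>\<langle>T z, T' x\<rangle> = \<langle>T' z, T x\<rangle>\<close> for the product of the two determinants, because both sides factor into the same
four brackets. The eight-vertex R-matrix would be the linear map \<open>T x \<mapsto> T' x\<close>; the proof does not
construct it. It suffices that a product of two intertwining vectors, and also a product of two dual
vectors, is a linear combination of tensors \<open>T x\<close> whose image under the face weights is the same
combination of tensors \<open>T' x\<close> (\<open>ivec_exchanged\<close>, \<open>dual_vec_exchanged\<close>); this follows from the Pluecker relation
between three vectors of a plane. Pairing the two facts gives \<open>local_exchange\<close>.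

\<^bold>\<open>Fusion.\<close> The fused quantities are all built in one way: faces are put side by side along a fixed path
of heights and the path on the other side is summed over. Such a sum depends only on the endpoints of the
fixed path as soon as a single corner of it can be flipped (\<open>chain_independent\<close>). The flips of the face
weights amount to the three-term identity for brackets, those of \<open>L\<close> and of the dual vectors to the
addition formula. Freedom in the choice of the path lets one peel off a column or a row of faces, apply the
relation for a single face to it, and put it back; hence the relation passes to the fused weights by
induction on \<open>k\<close> and then on \<open>l\<close> (\<open>exchange_fuse_horizontal\<close>, \<open>exchange_fuse_vertical\<close>). The factors \<open>R0\<close>
contribute the same product to both sides.

\<^bold>\<open>Genericity.\<close> The flips need \<open>[a] \<noteq> 0\<close> at heights outside the two sums. Therefore all heights \<open>a\<close> are moved
to \<open>a + t\<close>, and \<open>u\<close> to \<open>u + 2t\<close>. Only countably many \<open>t\<close> make one of the relevant brackets vanish, and the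
genericity hypotheses make both sides continuous at \<open>t = 0\<close>, so the identity persists there.\<close>

section \<open>The theta function as an infinite product\<close>

lemma qpoch_convergent:
  assumes "norm q < 1"
  shows "convergent_prod (\<lambda>n. 1 - w * q ^ n :: complex)"
proof -
  have "summable (\<lambda>n. norm w * norm q ^ n)"
    using assms by (intro summable_mult summable_geometric) simp
  then have "summable (\<lambda>n. norm ((1 - w * q ^ n) - 1))"
    by (simp add: norm_mult norm_power)
  then show ?thesis
    by (intro abs_convergent_prod_imp_convergent_prod summable_imp_abs_convergent_prod)
qed

lemma qpoch_has_prod:
  "norm q < 1 \<Longrightarrow> (\<lambda>n. 1 - w * q ^ n) has_prod qpoch w q"
  unfolding qpoch_def by (intro convergent_prod_has_prod qpoch_convergent)

lemma qpoch_rec: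
  assumes "norm q < 1"
  shows "qpoch w q = (1 - w) * qpoch (w * q) q"
proof -
  have "(\<lambda>n. 1 - w * q ^ Suc n) has_prod qpoch (w * q) q"
    using qpoch_has_prod[OF assms, of "w * q"] by (simp add: mult.assoc)
  then have "(\<lambda>n. 1 - w * q ^ n) has_prod (qpoch (w * q) q * (1 - w * q ^ 0))"
    by (rule has_prod_Suc_imp)
  with qpoch_has_prod[OF assms, of w] show ?thesis
    by (metis has_prod_unique2 mult.commute mult.right_neutral power_0)
qed

lemma qpoch_eq_0_iff:
  assumes "norm q < 1"
  shows "qpoch w q = 0 \<longleftrightarrow> (\<exists>n. w * q ^ n = 1)"
  using has_prod_eq_0_iff[OF qpoch_has_prod[OF assms, of w]] by (auto simp: image_iff)

lemma qpoch_nome_nonzero: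
  assumes "norm q < 1" "q \<noteq> 0"
  shows "qpoch q q \<noteq> 0"
proof -
  have "q * q ^ n \<noteq> 1" for n
  proof
    assume "q * q ^ n = 1"
    then have "norm q ^ Suc n = 1" by (metis norm_one norm_power power_Suc)
    moreover have "norm q ^ Suc n < 1" using assms by (intro power_Suc_less_one) auto
    ultimately show False by simp
  qed
  then show ?thesis
    by (simp add: qpoch_eq_0_iff[OF assms(1)])
qed

lemma holomorphic_qpoch:
  assumes "norm q < 1"
  shows "(\<lambda>w. qpoch w q) holomorphic_on UNIV"
proof (rule holomorphic_uniform_sequence[where f = "\<lambda>N w. \<Prod>n<N. 1 - w * q ^ n"])
  fix w0 :: complex
  define R where "R = norm w0 + 1"
  have "uniformly_convergent_on (cball w0 1) (\<lambda>N w. \<Prod>n<N. 1 - w * q ^ n)"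
  proof (rule uniformly_convergent_on_prod')
    show "uniformly_convergent_on (cball w0 1) (\<lambda>N w. \<Sum>n<N. norm ((1 - w * q ^ n) - 1))"
    proof (rule Weierstrass_m_test')
      show "norm (norm ((1 - w * q ^ n) - 1)) \<le> R * norm q ^ n" if "w \<in> cball w0 1" for n w
      proof -
        have "norm w \<le> R"
          using that norm_triangle_sub[of w w0] by (simp add: R_def dist_norm norm_minus_commute)
        then show ?thesis
          by (simp add: norm_mult norm_power mult_right_mono)
      qed
      show "summable (\<lambda>n. R * norm q ^ n)"
        using assms by (intro summable_mult summable_geometric) simp
    qed
  qed (auto intro!: continuous_intros)
  then have lim: "uniform_limit (cball w0 1) (\<lambda>N w. \<Prod>n<N. 1 - w * q ^ n)
      (\<lambda>w. lim (\<lambda>N. \<Prod>n<N. 1 - w * q ^ n)) sequentially"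
    using uniformly_convergent_uniform_limit_iff by blast
  have "lim (\<lambda>N. \<Prod>n<N. 1 - w * q ^ n) = qpoch w q" for w
  proof -
    have "(\<lambda>N. \<Prod>n\<le>N. 1 - w * q ^ n) \<longlonglongrightarrow> qpoch w q"
      using convergent_prod_LIMSEQ[OF qpoch_convergent[OF assms]] by (simp add: qpoch_def)
    then show ?thesis
      by (intro limI) (simp add: LIMSEQ_lessThan_iff_atMost)
  qed
  with lim have "uniform_limit (cball w0 1) (\<lambda>N w. \<Prod>n<N. 1 - w * q ^ n)
      (\<lambda>w. qpoch w q) sequentially"
    by simp
  then show "\<exists>d>0. cball w0 d \<subseteq> UNIV \<and>
      uniform_limit (cball w0 d) (\<lambda>N w. \<Prod>n<N. 1 - w * q ^ n) (\<lambda>w. qpoch w q) sequentially"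
    by (intro exI[of _ 1]) auto
qed (auto intro!: holomorphic_intros)

lemma norm_theta_nome:
  assumes "Im \<tau> > 0"
  shows "norm (exp (2 * of_real pi * \<i> * \<tau>)) < 1"
  using assms by simp

text \<open>Each quadratic factor of the product for \<open>theta1\<close> splits into two linear factors in \<open>exp (2 \<pi> i u)\<close>, and the
sine supplies the missing first factor. In this form the shift by \<open>\<tau>\<close> merely moves one factor between
the two products, and the zeros can be read off.\<close>

lemma theta1_qpoch:
  assumes "Im \<tau> > 0"
  defines "q \<equiv> exp (2 * of_real pi * \<i> * \<tau>)"
  shows "theta1 u \<tau> = \<i> * exp (of_real pi * \<i> * \<tau> / 4) * qpoch q q * exp (- of_real pi * \<i> * u) *
           qpoch (exp (2 * of_real pi * \<i> * u)) q * qpoch (q * exp (- 2 * of_real pi * \<i> * u)) q"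
proof -
  define z where "z = exp (2 * of_real pi * \<i> * u)"
  define z' where "z' = exp (- 2 * of_real pi * \<i> * u)"
  have q: "norm q < 1"
    unfolding q_def using assms(1) by (rule norm_theta_nome)
  have zz': "z * z' = 1"
    by (simp add: z_def z'_def flip: exp_add)
  have cos: "2 * cos (2 * of_real pi * u) = z + z'"
    by (simp add: z_def z'_def cos_exp_eq algebra_simps)
  have "(\<lambda>n. (1 - z * q * q ^ n) * (1 - q * z' * q ^ n)) has_prod (qpoch (z * q) q * qpoch (q * z') q)"
    by (intro has_prod_mult qpoch_has_prod q)
  moreover have "(1 - z * q * q ^ n) * (1 - q * z' * q ^ n)
      = 1 - 2 * q ^ Suc n * cos (2 * of_real pi * u) + q ^ (2 * Suc n)" for n
  proof -
    have "(1 - z * q * q ^ n) * (1 - q * z' * q ^ n)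
        = 1 - q ^ Suc n * (z + z') + q ^ (2 * Suc n) * (z * z')"
      by (simp add: algebra_simps power_add power_mult power2_eq_square)
    then show ?thesis by (simp add: zz' flip: cos)
  qed
  ultimately have "(\<lambda>n. 1 - 2 * q ^ Suc n * cos (2 * of_real pi * u) + q ^ (2 * Suc n))
      has_prod (qpoch (z * q) q * qpoch (q * z') q)"
    by (simp only:)
  then have P: "(\<Prod>n. 1 - 2 * q ^ Suc n * cos (2 * of_real pi * u) + q ^ (2 * Suc n))
      = qpoch (z * q) q * qpoch (q * z') q"
    by (rule has_prod_unique[symmetric])
  have "2 * sin (of_real pi * u) = \<i> * (exp (- of_real pi * \<i> * u) - exp (of_real pi * \<i> * u))"
    by (simp add: sin_exp_eq field_simps)
  then have "2 * sin (of_real pi * u) = \<i> * exp (- of_real pi * \<i> * u) * (1 - z)"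
    by (simp add: z_def algebra_simps flip: exp_add)
  moreover have "theta1 u \<tau> = exp (of_real pi * \<i> * \<tau> / 4) * qpoch q q *
      (2 * sin (of_real pi * u)) * (qpoch (z * q) q * qpoch (q * z') q)"
    by (simp only: theta1_def Let_def q_def[symmetric] P) (simp add: mult_ac)
  ultimately have "theta1 u \<tau> = \<i> * exp (of_real pi * \<i> * \<tau> / 4) * qpoch q q *
      exp (- of_real pi * \<i> * u) * ((1 - z) * qpoch (z * q) q) * qpoch (q * z') q"
    by (simp only: mult_ac)
  then show ?thesis
    by (simp only: z_def[symmetric] z'_def[symmetric] qpoch_rec[OF q, of z])
qed

lemma holomorphic_theta1:
  assumes "Im \<tau> > 0"
  shows "(\<lambda>u. theta1 u \<tau>) holomorphic_on UNIV"
proof -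
  have h: "(\<lambda>u. qpoch (f u) (exp (2 * of_real pi * \<i> * \<tau>))) holomorphic_on UNIV"
    if "f holomorphic_on UNIV" for f
    using holomorphic_on_compose[OF that holomorphic_on_subset[OF
          holomorphic_qpoch[OF norm_theta_nome[OF assms]]]]
    by (simp add: o_def)
  show ?thesis
    unfolding theta1_qpoch[OF assms] by (intro holomorphic_intros h) auto
qed

lemma theta1_eq_0_iff:
  assumes "Im \<tau> > 0"
  shows "theta1 u \<tau> = 0 \<longleftrightarrow> (\<exists>m n :: int. u = of_int m + of_int n * \<tau>)"
proof -
  define q where "q = exp (2 * of_real pi * \<i> * \<tau>)"
  have q: "norm q < 1"
    unfolding q_def using assms by (rule norm_theta_nome)
  have nz: "qpoch q q \<noteq> 0"
    using qpoch_nome_nonzero[OF q] by (simp add: q_def)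
  have exp_1: "exp (2 * of_real pi * \<i> * x) = 1 \<longleftrightarrow> (\<exists>m :: int. x = of_int m)" for x
  proof -
    have "exp (2 * of_real pi * \<i> * x) = exp 0 \<longleftrightarrow>
        (\<exists>m :: int. 2 * of_real pi * \<i> * x = 0 + (of_int (2 * m) * pi) * \<i>)"
      by (rule exp_eq)
    also have "\<dots> \<longleftrightarrow> (\<exists>m :: int. x = of_int m)"
      by (intro ex_cong1) (simp add: field_simps)
    finally show ?thesis by simp
  qed
  have 1: "exp (2 * of_real pi * \<i> * u) * q ^ n = exp (2 * of_real pi * \<i> * (u + of_nat n * \<tau>))" for n
    by (simp add: q_def algebra_simps flip: exp_add exp_of_nat_mult)
  have 2: "q * exp (- 2 * of_real pi * \<i> * u) * q ^ n
      = exp (2 * of_real pi * \<i> * (of_nat (Suc n) * \<tau> - u))" for n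
    by (simp add: q_def algebra_simps flip: exp_add exp_of_nat_mult)
  have "theta1 u \<tau> = 0 \<longleftrightarrow> (\<exists>n :: nat. \<exists>m :: int. u + of_nat n * \<tau> = of_int m) \<or>
      (\<exists>n :: nat. \<exists>m :: int. of_nat (Suc n) * \<tau> - u = of_int m)"
    unfolding theta1_qpoch[OF assms] q_def[symmetric] mult_eq_0_iff qpoch_eq_0_iff[OF q, of "_ * _"]
      qpoch_eq_0_iff[OF q, of "exp _"] 1 2 exp_1
    using nz by auto
  also have "\<dots> \<longleftrightarrow> (\<exists>m n :: int. u = of_int m + of_int n * \<tau>)"
  proof safe
    fix n :: nat and m :: int assume "u + of_nat n * \<tau> = of_int m"
    then have "u = of_int m + of_int (- int n) * \<tau>" by (simp add: algebra_simps)
    then show "\<exists>m n :: int. u = of_int m + of_int n * \<tau>" by blast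
  next
    fix n :: nat and m :: int assume "of_nat (Suc n) * \<tau> - u = of_int m"
    then have "u = of_int (- m) + of_int (int (Suc n)) * \<tau>" by (simp add: algebra_simps)
    then show "\<exists>m n :: int. u = of_int m + of_int n * \<tau>" by blast
  next
    fix m n :: int
    assume no: "\<nexists>k :: nat. \<exists>m' :: int. of_nat (Suc k) * \<tau> - (of_int m + of_int n * \<tau>) = of_int m'"
    have "\<not> n > 0"
    proof
      assume "n > 0"
      then have "of_nat (Suc (nat (n - 1))) * \<tau> - (of_int m + of_int n * \<tau>) = of_int (- m)"
        by (simp add: algebra_simps)
      with no show False by blast
    qed
    then have "of_int m + of_int n * \<tau> + of_nat (nat (- n)) * \<tau> = of_int m" by simp
    then show "\<exists>k :: nat. \<exists>m' :: int. of_int m + of_int n * \<tau> + of_nat k * \<tau> = of_int m'" by blast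
  qed
  finally show ?thesis .
qed

lemma deriv_theta1_0_nonzero:
  assumes "Im \<tau> > 0"
  shows "deriv (\<lambda>u. theta1 u \<tau>) 0 \<noteq> 0"
proof -
  define q where "q = exp (2 * of_real pi * \<i> * \<tau>)"
  have q: "norm q < 1"
    unfolding q_def using assms by (rule norm_theta_nome)
  define K where "K = (\<lambda>u. \<i> * exp (of_real pi * \<i> * \<tau> / 4) * qpoch q q * exp (- of_real pi * \<i> * u) *
      qpoch (exp (2 * of_real pi * \<i> * u) * q) q * qpoch (q * exp (- 2 * of_real pi * \<i> * u)) q)"
  have h: "(\<lambda>u. qpoch (f u) q) holomorphic_on UNIV" if "f holomorphic_on UNIV" for f
    using holomorphic_on_compose_gen[OF that holomorphic_qpoch[OF q]] by (simp add: o_def)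
  have holK: "K holomorphic_on UNIV"
    unfolding K_def by (intro holomorphic_intros h)
  have eq: "theta1 u \<tau> = (1 - exp (2 * of_real pi * \<i> * u)) * K u" for u
    unfolding theta1_qpoch[OF assms] q_def[symmetric]
    by (subst (2) qpoch_rec[OF q]) (simp add: K_def mult_ac)
  have "(K has_field_derivative deriv K 0) (at 0)"
    using holK by (meson UNIV_I holomorphic_derivI open_UNIV)
  then have "((\<lambda>u. theta1 u \<tau>) has_field_derivative (- (2 * of_real pi * \<i>) * K 0)) (at 0)"
    unfolding eq by (auto intro!: derivative_eq_intros)
  moreover have "K 0 \<noteq> 0"
    using qpoch_nome_nonzero[OF q] by (simp add: K_def q_def)
  ultimately show ?thesis
    by (simp add: DERIV_imp_deriv)
qed

section \<open>Quasi-periodicity and parity\<close>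

lemma theta1_minus: "theta1 (- u) \<tau> = - theta1 u \<tau>"
  by (simp add: theta1_def Let_def)

lemma theta1_plus_1: "theta1 (u + 1) \<tau> = - theta1 u \<tau>"
proof -
  have "cos (2 * of_real pi * u + of_real (2 * pi)) = cos (2 * of_real pi * u)"
    unfolding cos_add cos_of_real sin_of_real by simp
  then have "cos (2 * of_real pi * (u + 1)) = cos (2 * of_real pi * u)"
    by (simp add: distrib_left)
  moreover have "sin (of_real pi * (u + 1)) = - sin (of_real pi * u)"
    by (simp add: distrib_left sin_add flip: sin_of_real cos_of_real)
  ultimately show ?thesis by (simp add: theta1_def Let_def)
qed

lemma theta1_plus_tau:
  assumes "Im \<tau> > 0"
  shows "theta1 (u + \<tau>) \<tau> = - exp (- of_real pi * \<i> * (\<tau> + 2 * u)) * theta1 u \<tau>"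
proof -
  define q where "q = exp (2 * of_real pi * \<i> * \<tau>)"
  define z where "z = exp (2 * of_real pi * \<i> * u)"
  define z' where "z' = exp (- 2 * of_real pi * \<i> * u)"
  have q: "norm q < 1"
    unfolding q_def using assms by (rule norm_theta_nome)
  have zz': "z * z' = 1"
    by (simp add: z_def z'_def flip: exp_add)
  have e1: "exp (2 * of_real pi * \<i> * (u + \<tau>)) = z * q"
    by (simp add: z_def q_def algebra_simps flip: exp_add)
  have e2: "q * exp (- 2 * of_real pi * \<i> * (u + \<tau>)) = z'"
    by (simp add: z'_def q_def algebra_simps flip: exp_add)
  have e3: "exp (- of_real pi * \<i> * (u + \<tau>)) = exp (- of_real pi * \<i> * (\<tau> + 2 * u)) * z * exp (- of_real pi * \<i> * u)"
    by (simp add: z_def algebra_simps flip: exp_add)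
  have "z * qpoch (z * q) q * qpoch z' q = z * (1 - z') * qpoch (z * q) q * qpoch (q * z') q"
    using qpoch_rec[OF q, of z'] by (simp add: mult_ac)
  also have "z * (1 - z') = - (1 - z)"
    using zz' by (simp add: algebra_simps)
  also have "- (1 - z) * qpoch (z * q) q = - qpoch z q"
    using qpoch_rec[OF q, of z] by (simp add: algebra_simps)
  finally have "z * qpoch (z * q) q * qpoch z' q = - qpoch z q * qpoch (q * z') q" .
  then have "\<i> * exp (of_real pi * \<i> * \<tau> / 4) * qpoch q q * exp (- of_real pi * \<i> * (\<tau> + 2 * u)) *
      exp (- of_real pi * \<i> * u) * (z * qpoch (z * q) q * qpoch z' q) =
      \<i> * exp (of_real pi * \<i> * \<tau> / 4) * qpoch q q * exp (- of_real pi * \<i> * (\<tau> + 2 * u)) *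
      exp (- of_real pi * \<i> * u) * (- qpoch z q * qpoch (q * z') q)"
    by (rule arg_cong)
  then show ?thesis
    unfolding theta1_qpoch[OF assms] q_def[symmetric] e1 e2 e3 z_def[symmetric] z'_def[symmetric]
    by (simp only: mult_ac mult_minus_left mult_minus_right)
qed


lemma theta0_plus_half: "theta0 (u + 1 / 2) \<tau> = theta3 u \<tau>"
proof -
  have "exp (of_real pi * \<i> * (u + 1 / 2 + \<tau> / 4)) = \<i> * exp (of_real pi * \<i> * (u + \<tau> / 4))"
  proof -
    have "exp (of_real pi * \<i> * (u + 1 / 2 + \<tau> / 4))
        = exp (of_real pi / 2 * \<i>) * exp (of_real pi * \<i> * (u + \<tau> / 4))"
      by (simp add: algebra_simps flip: exp_add)
    also have "exp (of_real pi / 2 * \<i>) = \<i>"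
      using cis_pi_half by (simp add: cis_conv_exp mult.commute)
    finally show ?thesis .
  qed
  moreover have "u + 1 / 2 + \<tau> / 2 = u + (\<tau> + 1) / 2"
    by (simp add: field_simps)
  ultimately show ?thesis
    by (simp only: theta0_def theta3_def) simp
qed

lemma theta0_plus_1: "theta0 (u + 1) \<tau> = theta0 u \<tau>"
proof -
  have "exp (of_real pi * \<i> * (u + 1 + \<tau> / 4)) = exp (of_real pi * \<i>) * exp (of_real pi * \<i> * (u + \<tau> / 4))"
    unfolding exp_add[symmetric] by (rule arg_cong[of _ _ exp]) (simp add: algebra_simps)
  moreover have "theta1 (u + 1 + \<tau> / 2) \<tau> = - theta1 (u + \<tau> / 2) \<tau>"
    using theta1_plus_1[of "u + \<tau> / 2"] by (simp add: add_ac)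
  ultimately show ?thesis by (simp add: theta0_def)
qed

lemma theta3_plus_half: "theta3 (u + 1 / 2) \<tau> = theta0 u \<tau>"
  using theta0_plus_half[of "u + 1 / 2" \<tau>] theta0_plus_1[of u \<tau>] by (simp add: add.assoc)

context
  fixes \<tau> :: complex
  assumes tau: "Im \<tau> > 0"
begin

lemma theta0_minus: "theta0 (- u) \<tau> = theta0 u \<tau>"
proof -
  have "theta1 (- u + \<tau> / 2) \<tau> = - theta1 (u - \<tau> / 2) \<tau>"
    using theta1_minus[of "u - \<tau> / 2" \<tau>] by simp
  moreover have "theta1 (u + \<tau> / 2) \<tau> = - exp (- 2 * of_real pi * \<i> * u) * theta1 (u - \<tau> / 2) \<tau>"
    using theta1_plus_tau[OF tau, of "u - \<tau> / 2"] by (simp add: algebra_simps)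
  moreover have "exp (of_real pi * \<i> * (- u + \<tau> / 4))
      = exp (of_real pi * \<i> * (u + \<tau> / 4)) * exp (- 2 * of_real pi * \<i> * u)"
    by (simp add: algebra_simps flip: exp_add)
  ultimately show ?thesis by (simp add: theta0_def)
qed

lemma theta3_minus: "theta3 (- u) \<tau> = theta3 u \<tau>"
proof -
  have "theta3 (- u) \<tau> = theta0 (- (u - 1 / 2)) \<tau>"
    by (simp flip: theta0_plus_half)
  also have "\<dots> = theta0 (u - 1 / 2 + 1) \<tau>"
    by (simp only: theta0_minus theta0_plus_1)
  also have "u - 1 / 2 + 1 = u + 1 / 2"
    by simp
  finally show ?thesis by (simp only: theta0_plus_half)
qed

lemma theta0_plus_tau: "theta0 (u + \<tau>) \<tau> = - exp (- of_real pi * \<i> * (\<tau> + 2 * u)) * theta0 u \<tau>"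
proof -
  have "theta1 (u + \<tau> + \<tau> / 2) \<tau> = - exp (- of_real pi * \<i> * (2 * \<tau> + 2 * u)) * theta1 (u + \<tau> / 2) \<tau>"
    using theta1_plus_tau[OF tau, of "u + \<tau> / 2"] by (simp add: algebra_simps)
  moreover have "exp (of_real pi * \<i> * (u + \<tau> + \<tau> / 4)) * exp (- of_real pi * \<i> * (2 * \<tau> + 2 * u))
      = exp (of_real pi * \<i> * (u + \<tau> / 4)) * exp (- of_real pi * \<i> * (\<tau> + 2 * u))"
    by (simp add: algebra_simps flip: exp_add)
  ultimately show ?thesis by (simp add: theta0_def mult_ac)
qed

lemma theta3_plus_tau: "theta3 (u + \<tau>) \<tau> = exp (- of_real pi * \<i> * (\<tau> + 2 * u)) * theta3 u \<tau>"
proof -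
  have "theta3 (u + \<tau>) \<tau> = theta0 (u + 1 / 2 + \<tau>) \<tau>"
    using theta0_plus_half[of "u + \<tau>" \<tau>] by (simp add: add_ac)
  also have "\<dots> = - exp (- of_real pi * \<i> * (\<tau> + 2 * (u + 1 / 2))) * theta3 u \<tau>"
    by (simp only: theta0_plus_tau theta0_plus_half)
  also have "exp (- of_real pi * \<i> * (\<tau> + 2 * (u + 1 / 2))) = exp (- of_real pi * \<i>) * exp (- of_real pi * \<i> * (\<tau> + 2 * u))"
    by (simp add: algebra_simps flip: exp_add)
  also have "exp (- of_real pi * \<i>) = -1"
    by (simp add: exp_minus)
  finally show ?thesis by simp
qed

lemma holomorphic_theta0: "(\<lambda>u. theta0 u \<tau>) holomorphic_on UNIV"
proof -
  have "(\<lambda>u. theta1 (u + \<tau> / 2) \<tau>) holomorphic_on UNIV"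
    using holomorphic_on_compose_gen[of "\<lambda>u. u + \<tau> / 2" UNIV "\<lambda>u. theta1 u \<tau>" UNIV]
    by (simp add: o_def holomorphic_theta1[OF tau] holomorphic_on_add)
  then show ?thesis
    unfolding theta0_def by (intro holomorphic_intros)
qed

lemma holomorphic_theta3: "(\<lambda>u. theta3 u \<tau>) holomorphic_on UNIV"
  using holomorphic_on_compose_gen[of "\<lambda>u. u + 1 / 2" UNIV "\<lambda>u. theta0 u \<tau>" UNIV]
  by (simp add: o_def holomorphic_theta0 holomorphic_on_add theta0_plus_half)

section \<open>The addition formula\<close>

text \<open>The quotient \<open>f / theta1\<close> has periods \<open>1\<close> and \<open>\<tau>\<close>. At \<open>0\<close> it extends holomorphically since \<open>theta1\<close> has a
simple zero there. Hence its modulus attains its supremum on a period parallelogram centred at \<open>0\<close>, which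
contains no other lattice point. The plane without the nonzero lattice points is open and connected, so the maximum modulus
principle makes the quotient constant.\<close>

lemma theta1_characterisation:
  assumes holf: "f holomorphic_on UNIV" and f0: "f 0 = 0"
    and f1: "\<And>u. f (u + 1) = - f u"
    and ft: "\<And>u. f (u + \<tau>) = - exp (- of_real pi * \<i> * (\<tau> + 2 * u)) * f u"
  shows "\<exists>c. \<forall>u. f u = c * theta1 u \<tau>"
proof -
  define t where "t = (\<lambda>u. theta1 u \<tau>)"
  have holt: "t holomorphic_on UNIV"
    unfolding t_def by (rule holomorphic_theta1[OF tau])
  have t0: "t 0 = 0" and t1: "t (u + 1) = - t u"
    and tt: "t (u + \<tau>) = - exp (- of_real pi * \<i> * (\<tau> + 2 * u)) * t u" for u
    by (simp_all only: t_def theta1_plus_1 theta1_plus_tau[OF tau]) (simp add: theta1_def)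
  define E where "E = (\<lambda>u. - exp (- of_real pi * \<i> * (\<tau> + 2 * u)))"
  have Enz: "E u \<noteq> 0" for u by (simp add: E_def)
  \<comment> \<open>Dividing both functions by \<open>u\<close> removes the zero at the origin, where the quotient is needed.\<close>
  define F where "F = (\<lambda>u. if u = 0 then deriv f 0 else f u / u)"
  define T where "T = (\<lambda>u. if u = 0 then deriv t 0 else t u / u)"
  have holF: "F holomorphic_on UNIV" and holT: "T holomorphic_on UNIV"
    using pole_theorem_open_0[OF holf open_UNIV, of 0 F] pole_theorem_open_0[OF holt open_UNIV, of 0 T]
    by (simp_all add: F_def T_def f0 t0)
  have Tnz: "T u \<noteq> 0 \<longleftrightarrow> u = 0 \<or> t u \<noteq> 0" for u
    using deriv_theta1_0_nonzero[OF tau] by (auto simp: T_def t_def)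
  define D where "D = {u. T u \<noteq> 0}"
  define h where "h = (\<lambda>u. F u / T u)"
  have holh: "h holomorphic_on D"
    unfolding h_def D_def
    by (intro holomorphic_intros holomorphic_on_subset[OF holF] holomorphic_on_subset[OF holT]) auto
  have openD: "open D"
  proof -
    have "open (T -` (- {0}))"
      using holomorphic_on_imp_continuous_on[OF holT] by (intro open_vimage) auto
    then show ?thesis by (simp add: D_def vimage_def)
  qed
  have connD: "connected D"
  proof -
    have "countable ((\<lambda>(m, n). of_int m + of_int n * \<tau>) ` (UNIV :: (int \<times> int) set))"
      by simp
    then have "countable (- D)"
      by (rule countable_subset[rotated]) (auto simp: D_def Tnz t_def theta1_eq_0_iff[OF tau])
    then have "connected (UNIV - (- D))"
      by (intro connected_open_diff_countable) auto
    then show ?thesis by simp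
  qed
  have h_eq: "h u = f u / t u" if "t u \<noteq> 0" for u
    using that t0 by (auto simp: h_def F_def T_def)
  \<comment> \<open>Periodicity of \<open>f / t\<close>, cleared of denominators so that it also holds at the zeros of \<open>t\<close>.\<close>
  have per1: "f (u + of_int m) * t u = f u * t (u + of_int m)" for u and m :: int
  proof (induction m rule: int_induct[where k = 0])
    case (step1 i)
    have "f (u + of_int (i + 1)) = - f (u + of_int i)" "t (u + of_int (i + 1)) = - t (u + of_int i)"
      using f1[of "u + of_int i"] t1[of "u + of_int i"] by (simp_all add: add_ac)
    with step1 show ?case by simp
  next
    case (step2 i)
    have "f (u + of_int i) = - f (u + of_int (i - 1))" "t (u + of_int i) = - t (u + of_int (i - 1))"
      using f1[of "u + of_int (i - 1)"] t1[of "u + of_int (i - 1)"] by simp_all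
    with step2 show ?case by simp
  qed simp
  have pert: "f (u + of_int m * \<tau>) * t u = f u * t (u + of_int m * \<tau>)" for u and m :: int
  proof (induction m rule: int_induct[where k = 0])
    case (step1 i)
    have "f (u + of_int (i + 1) * \<tau>) = E (u + of_int i * \<tau>) * f (u + of_int i * \<tau>)"
        "t (u + of_int (i + 1) * \<tau>) = E (u + of_int i * \<tau>) * t (u + of_int i * \<tau>)"
      using ft[of "u + of_int i * \<tau>"] tt[of "u + of_int i * \<tau>"] by (simp_all add: algebra_simps E_def)
    with step1 show ?case by simp
  next
    case (step2 i)
    have "f (u + of_int i * \<tau>) = E (u + of_int (i - 1) * \<tau>) * f (u + of_int (i - 1) * \<tau>)"
        "t (u + of_int i * \<tau>) = E (u + of_int (i - 1) * \<tau>) * t (u + of_int (i - 1) * \<tau>)"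
      using ft[of "u + of_int (i - 1) * \<tau>"] tt[of "u + of_int (i - 1) * \<tau>"]
      by (simp_all add: algebra_simps E_def)
    with step2 show ?case using Enz[of "u + of_int (i - 1) * \<tau>"] by simp
  qed simp
  define Q where "Q = (\<lambda>(x, y). of_real x + of_real y * \<tau>) ` (cbox (-1/2) (1/2) \<times> cbox (-1/2) (1/2 :: real))"
  have compQ: "compact Q"
    unfolding Q_def
    by (intro compact_continuous_image compact_Times compact_cbox) (auto intro!: continuous_intros simp: case_prod_beta)
  have QD: "Q \<subseteq> D"
  proof
    fix u assume "u \<in> Q"
    then obtain x y :: real where u: "u = of_real x + of_real y * \<tau>" "\<bar>x\<bar> \<le> 1/2" "\<bar>y\<bar> \<le> 1/2"
      unfolding Q_def by (auto simp: abs_le_iff)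
    show "u \<in> D"
    proof (rule ccontr)
      assume "u \<notin> D"
      then have "u \<noteq> 0" and "t u = 0" by (auto simp: D_def Tnz)
      then obtain m n :: int where mn: "u = of_int m + of_int n * \<tau>"
        by (auto simp: t_def theta1_eq_0_iff[OF tau])
      note eq = trans[OF u(1)[symmetric] mn]
      have "y = of_int n" using arg_cong[OF eq, of Im] tau by simp
      moreover from this have "n = 0" using u(3) by linarith
      ultimately have "x = of_int m" using arg_cong[OF eq, of Re] by simp
      then have "m = 0" using u(2) by linarith
      with \<open>n = 0\<close> mn \<open>u \<noteq> 0\<close> show False by simp
    qed
  qed
  have "0 \<in> Q" unfolding Q_def by (auto intro!: image_eqI[where x = "(0, 0)"])
  have "continuous_on Q (\<lambda>u. norm (h u))"
    using holomorphic_on_imp_continuous_on[OF holh] QD by (intro continuous_intros) (rule continuous_on_subset)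
  then obtain u0 where u0: "u0 \<in> Q" "\<And>u. u \<in> Q \<Longrightarrow> norm (h u) \<le> norm (h u0)"
    using continuous_attains_sup[OF compQ, of "\<lambda>u. norm (h u)"] \<open>0 \<in> Q\<close> by auto
  have bound: "norm (h u) \<le> norm (h u0)" if "u \<in> D" for u
  proof (cases "u = 0")
    case True
    with u0 \<open>0 \<in> Q\<close> show ?thesis by simp
  next
    case False
    with that have tu: "t u \<noteq> 0" by (simp add: D_def Tnz)
    define y where "y = Im u / Im \<tau>"
    define x where "x = Re u - y * Re \<tau>"
    define n where "n = round y"
    define m where "m = round x"
    define u' where "u' = u - of_int m - of_int n * \<tau>"
    have u_xy: "u = of_real x + of_real y * \<tau>"
      using tau by (simp add: complex_eq_iff x_def y_def)
    have "u' = of_real (x - of_int m) + of_real (y - of_int n) * \<tau>"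
      by (simp add: u'_def u_xy algebra_simps)
    moreover have "\<bar>x - of_int m\<bar> \<le> 1/2" "\<bar>y - of_int n\<bar> \<le> 1/2"
      using of_int_round_abs_le[of x] of_int_round_abs_le[of y] by (simp_all add: m_def n_def abs_minus_commute)
    then have "- 1 / 2 \<le> x - of_int m" "x - of_int m \<le> 1 / 2" "- 1 / 2 \<le> y - of_int n" "y - of_int n \<le> 1 / 2"
      by linarith+
    ultimately have "u' \<in> Q"
      unfolding Q_def by (intro image_eqI[where x = "(x - of_int m, y - of_int n)"]) auto
    have tu': "t u' \<noteq> 0"
    proof
      assume "t u' = 0"
      then obtain i j :: int where "u' = of_int i + of_int j * \<tau>"
        by (auto simp: t_def theta1_eq_0_iff[OF tau])
      then have "u = of_int (i + m) + of_int (j + n) * \<tau>" by (simp add: u'_def algebra_simps)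
      then have "t u = 0" unfolding t_def theta1_eq_0_iff[OF tau] by blast
      with tu show False by simp
    qed
    define u'' where "u'' = u' + of_int m"
    have "u'' + of_int n * \<tau> = u" by (simp add: u''_def u'_def)
    have "t u'' \<noteq> 0"
    proof
      assume "t u'' = 0"
      then obtain i j :: int where "u'' = of_int i + of_int j * \<tau>"
        by (auto simp: t_def theta1_eq_0_iff[OF tau])
      then have "u' = of_int (i - m) + of_int j * \<tau>" by (simp add: u''_def algebra_simps)
      then have "t u' = 0" unfolding t_def theta1_eq_0_iff[OF tau] by blast
      with tu' show False by simp
    qed
    then have "f u / t u = f u'' / t u''"
      using pert[of u'' n] \<open>u'' + of_int n * \<tau> = u\<close> tu by (simp add: field_simps)
    also have "\<dots> = f u' / t u'"
      using per1[of u' m] \<open>t u'' \<noteq> 0\<close> tu' by (simp add: field_simps u''_def)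
    finally have "h u = h u'" using tu tu' by (simp add: h_eq)
    with u0(2)[OF \<open>u' \<in> Q\<close>] show ?thesis by simp
  qed
  have "h constant_on D"
    using maximum_modulus_principle[OF holh openD connD openD order_refl, of u0] u0(1) QD bound by blast
  then obtain c where c: "\<And>u. u \<in> D \<Longrightarrow> h u = c"
    by (auto simp: constant_on_def)
  have "f u = c * t u" for u
  proof (cases "t u = 0")
    case False
    with c[of u] h_eq[of u] show ?thesis by (auto simp: D_def Tnz field_simps)
  next
    case True
    then obtain m n :: int where "u = of_int m + of_int n * \<tau>"
      by (auto simp: t_def theta1_eq_0_iff[OF tau])
    \<comment> \<open>The zero of \<open>f\<close> at the origin propagates to all lattice points.\<close>
    moreover have "f (of_int m) = 0"
    proof (induction m rule: int_induct[where k = 0])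
      case (step2 i)
      with f1[of "of_int (i - 1)"] show ?case by simp
    qed (use f1 f0 in simp_all)
    moreover have "f (of_int m + of_int n * \<tau>) = 0" if "f (of_int m) = 0"
    proof (induction n rule: int_induct[where k = 0])
      case (step1 i)
      with ft[of "of_int m + of_int i * \<tau>"] show ?case by (simp add: algebra_simps)
    next
      case (step2 i)
      with ft[of "of_int m + of_int (i - 1) * \<tau>"] show ?case by (simp add: algebra_simps)
    qed (use that in simp)
    ultimately show ?thesis using True by simp
  qed
  then show ?thesis by (auto simp: t_def)
qed

end

text \<open>As a function of \<open>2 x\<close> the left-hand side vanishes at \<open>0\<close> by parity and has the multipliers of \<open>theta1\<close>: a shift of
\<open>x\<close> by \<open>1/2\<close> exchanges \<open>theta0\<close> and \<open>theta3\<close>. So it is \<open>c y * theta1 (2 x) \<tau>\<close>, and its symmetry in \<open>x\<close> and \<open>y\<close>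
determines \<open>c\<close> up to a constant. The constant is not zero, for otherwise \<open>theta0\<close> and \<open>theta3\<close> would be
proportional, while at \<open>\<tau> / 4\<close> only the first of them vanishes.\<close>

lemma theta_addition_formula:
  assumes tau: "Im \<tau> > 0"
  obtains \<kappa> where "\<kappa> \<noteq> 0"
    "\<And>x y. theta3 (x + y) (\<tau> / 2) * theta0 (x - y) (\<tau> / 2) - theta0 (x + y) (\<tau> / 2) * theta3 (x - y) (\<tau> / 2)
       = \<kappa> * theta1 (2 * x) \<tau> * theta1 (2 * y) \<tau>"
proof -
  define p where "p = (\<lambda>x. theta0 x (\<tau> / 2))"
  define q where "q = (\<lambda>x. theta3 x (\<tau> / 2))"
  define g where "g = (\<lambda>x y. q (x + y) * p (x - y) - p (x + y) * q (x - y))"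
  have tau2: "Im (\<tau> / 2) > 0" using tau by simp
  have half: "p (x + 1 / 2) = q x" "q (x + 1 / 2) = p x" for x
    by (simp_all add: p_def q_def theta0_plus_half theta3_plus_half)
  have per: "p (x + \<tau> / 2) = - exp (- of_real pi * \<i> * (\<tau> / 2 + 2 * x)) * p x"
      "q (x + \<tau> / 2) = exp (- of_real pi * \<i> * (\<tau> / 2 + 2 * x)) * q x" for x
    unfolding p_def q_def by (simp_all only: theta0_plus_tau[OF tau2] theta3_plus_tau[OF tau2])
  have even: "p (- x) = p x" "q (- x) = q x" for x
    by (simp_all add: p_def q_def theta0_minus[OF tau2] theta3_minus[OF tau2])
  have hol: "(\<lambda>u. p (u / 2 + y)) holomorphic_on UNIV" "(\<lambda>u. q (u / 2 + y)) holomorphic_on UNIV" for y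
    using holomorphic_on_compose_gen[of "\<lambda>u. u / 2 + y" UNIV p UNIV]
      holomorphic_on_compose_gen[of "\<lambda>u. u / 2 + y" UNIV q UNIV]
    by (simp_all add: o_def p_def q_def holomorphic_theta0[OF tau2] holomorphic_theta3[OF tau2]
        holomorphic_on_add holomorphic_on_divide)
  have "\<exists>c. \<forall>u. g (u / 2) y = c * theta1 u \<tau>" for y
  proof (rule theta1_characterisation[OF tau])
    show "(\<lambda>u. g (u / 2) y) holomorphic_on UNIV"
      unfolding g_def using hol[of y] hol[of "- y"] by (auto intro!: holomorphic_intros)
    show "g (0 / 2) y = 0"
      by (simp add: g_def even)
    fix u
    have sh: "(u + 1) / 2 + y = (u / 2 + y) + 1 / 2" "(u + 1) / 2 - y = (u / 2 - y) + 1 / 2"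
        "(u + \<tau>) / 2 + y = (u / 2 + y) + \<tau> / 2" "(u + \<tau>) / 2 - y = (u / 2 - y) + \<tau> / 2"
      by (simp_all add: add_divide_distrib)
    show "g ((u + 1) / 2) y = - g (u / 2) y"
      unfolding g_def sh half by simp
    define e where "e = exp (- of_real pi * \<i> * (\<tau> / 2 + 2 * (u / 2 + y)))"
    define e' where "e' = exp (- of_real pi * \<i> * (\<tau> / 2 + 2 * (u / 2 - y)))"
    have ee': "exp (- of_real pi * \<i> * (\<tau> + 2 * u)) = e * e'"
      unfolding exp_add[symmetric] e_def e'_def
      by (rule arg_cong[of _ _ exp]) (simp add: algebra_simps)
    show "g ((u + \<tau>) / 2) y = - exp (- of_real pi * \<i> * (\<tau> + 2 * u)) * g (u / 2) y"
      unfolding g_def sh per e_def[symmetric] e'_def[symmetric] ee' by (simp add: algebra_simps)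
  qed
  then obtain c where c: "\<And>u y. g (u / 2) y = c y * theta1 u \<tau>" by metis
  then have c': "g x y = c y * theta1 (2 * x) \<tau>" for x y
    using c[of "2 * x" y] by simp
  have sym: "g x y = g y x" for x y
    using even[of "x - y"] by (simp add: g_def add.commute)
  have nz: "theta1 (1 / 2) \<tau> \<noteq> 0"
  proof
    assume "theta1 (1 / 2) \<tau> = 0"
    then obtain m n :: int where mn: "1 / 2 = of_int m + of_int n * \<tau>"
      by (auto simp: theta1_eq_0_iff[OF tau])
    then have "Im (1 / 2) = of_int n * Im \<tau>" by (simp only:) simp
    then have "n = 0" using tau by simp
    with mn have "(1 :: complex) = of_int (2 * m)" by (simp add: field_simps)
    then have "1 = 2 * m" by (metis of_int_1 of_int_eq_iff)
    then show False by presburger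
  qed
  define \<kappa> where "\<kappa> = c (1 / 4) / theta1 (1 / 2) \<tau>"
  have add: "g x y = \<kappa> * theta1 (2 * x) \<tau> * theta1 (2 * y) \<tau>" for x y
  proof -
    have "c y * theta1 (1 / 2) \<tau> = c (1 / 4) * theta1 (2 * y) \<tau>" for y
      using sym[of "1 / 4" y] by (simp add: c')
    then have "c y = \<kappa> * theta1 (2 * y) \<tau>"
      using nz by (simp add: \<kappa>_def field_simps)
    then show ?thesis by (simp add: c' mult_ac)
  qed
  moreover have "\<kappa> \<noteq> 0"
  proof
    assume "\<kappa> = 0"
    have swap: "q x * p y = p x * q y" for x y
      using add[of "(x + y) / 2" "(x - y) / 2"] \<open>\<kappa> = 0\<close> by (simp add: g_def field_simps)
    have p0: "p x = 0 \<longleftrightarrow> (\<exists>m n :: int. x + \<tau> / 4 = of_int m + of_int n * (\<tau> / 2))" for x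
      by (simp add: p_def theta0_def theta1_eq_0_iff[OF tau2])
    have "p (\<tau> / 4) = 0"
      unfolding p0 by (rule exI[of _ 0], rule exI[of _ 1]) simp
    moreover have "p 0 \<noteq> 0"
    proof
      assume "p 0 = 0"
      then obtain m n :: int where "0 + \<tau> / 4 = of_int m + of_int n * (\<tau> / 2)"
        unfolding p0 by blast
      from arg_cong[OF this, of Im] have "Im \<tau> = Im \<tau> * (2 * of_int n)" by (simp add: field_simps)
      then have "(1 :: real) = of_int (2 * n)" using tau by simp
      then have "1 = 2 * n" by (metis of_int_1 of_int_eq_iff)
      then show False by presburger
    qed
    moreover have "q (\<tau> / 4) \<noteq> 0"
    proof
      assume "q (\<tau> / 4) = 0"
      then have "p (\<tau> / 4 + 1 / 2) = 0" by (simp add: half)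
      then obtain m n :: int where mn: "\<tau> / 4 + 1 / 2 + \<tau> / 4 = of_int m + of_int n * (\<tau> / 2)"
        unfolding p0 by blast
      from arg_cong[OF mn, of Im] have "Im \<tau> = Im \<tau> * of_int n" by (simp add: field_simps)
      then have "n = 1" using tau by simp
      with mn have "(1 :: complex) = of_int (2 * m)" by (simp add: field_simps)
      then have "1 = 2 * m" by (metis of_int_1 of_int_eq_iff)
      then show False by presburger
    qed
    ultimately show False using swap[of "\<tau> / 4" 0] by simp
  qed
  ultimately show thesis
    using that[of \<kappa>] by (simp add: g_def p_def q_def)
qed

section \<open>Height paths\<close>

definition nbrs :: "int \<Rightarrow> int set" where
  "nbrs d = {d - 1, d + 1}"

lemma in_nbrs_iff: "y \<in> nbrs d \<longleftrightarrow> \<bar>d - y\<bar> = 1"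
  by (auto simp: nbrs_def abs_if)

lemma finite_nbrs [simp]: "finite (nbrs d)"
  by (simp add: nbrs_def)

lemma sum_nbrs: "b \<in> nbrs a \<Longrightarrow> (\<Sum>d\<in>nbrs a. f d) = f b + f (2 * a - b)"
  for f :: "int \<Rightarrow> complex"
  by (auto simp: nbrs_def algebra_simps)

text \<open>Two adjacent faces along the top path \<open>a, x, a\<close>, with spectral parameters \<open>u + 1\<close> and \<open>u\<close>, are summed over the
middle height of the bottom path. Invariance means that the corner \<open>x\<close> does not matter.\<close>

definition flip_invariant :: "(int \<Rightarrow> int \<Rightarrow> int \<Rightarrow> int \<Rightarrow> complex \<Rightarrow> complex) \<Rightarrow> complex \<Rightarrow> bool" where
  "flip_invariant K u \<longleftrightarrow> (\<forall>a x x' d c. x \<in> nbrs a \<longrightarrow> x' \<in> nbrs a \<longrightarrow>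
     (\<Sum>y\<in>nbrs d. K a x d y (u + 1) * K x a y c u) = (\<Sum>y\<in>nbrs d. K a x' d y (u + 1) * K x' a y c u))"

lemma flip_invariantI:
  assumes "\<And>a d c. (\<Sum>y\<in>nbrs d. K a (a + 1) d y (u + 1) * K (a + 1) a y c u)
      = (\<Sum>y\<in>nbrs d. K a (a - 1) d y (u + 1) * K (a - 1) a y c u)"
  shows "flip_invariant K u"
  unfolding flip_invariant_def
proof (intro allI impI)
  fix a x x' d c :: int
  assume "x \<in> nbrs a" "x' \<in> nbrs a"
  then have "x = a + 1 \<or> x = a - 1" "x' = a + 1 \<or> x' = a - 1" by (auto simp: nbrs_def)
  then show "(\<Sum>y\<in>nbrs d. K a x d y (u + 1) * K x a y c u) = (\<Sum>y\<in>nbrs d. K a x' d y (u + 1) * K x' a y c u)"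
    using assms[of a d c] by (elim disjE) (simp_all only:)
qed

lemma height_paths_0: "height_paths 0 a b = (if a = b then {[a]} else {})"
  by (auto simp: height_paths_def length_Suc_conv)

lemma height_paths_Suc: "height_paths (Suc k) a b = (\<Union>x\<in>nbrs a. (#) a ` height_paths k x b)"
proof (intro set_eqI iffI)
  fix hs assume hs: "hs \<in> height_paths (Suc k) a b"
  then obtain h t where ht: "hs = h # t" by (cases hs) (auto simp: height_paths_def)
  have l: "length t = k + 1" "h = a" "t ! k = b" and d: "\<And>i. i \<in> {1..Suc k} \<Longrightarrow> \<bar>hs ! (i - 1) - hs ! i\<bar> = 1"
    using hs by (auto simp: height_paths_def ht)
  have "t ! 0 \<in> nbrs a" using d[of 1] by (simp add: ht l in_nbrs_iff)
  moreover have "\<bar>t ! (i - 1) - t ! i\<bar> = 1" if "i \<in> {1..k}" for i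
    using d[of "Suc i"] that by (cases i) (auto simp: ht)
  then have "t \<in> height_paths k (t ! 0) b"
    using l by (auto simp: height_paths_def)
  ultimately show "hs \<in> (\<Union>x\<in>nbrs a. (#) a ` height_paths k x b)"
    by (auto simp: ht l)
next
  fix hs assume "hs \<in> (\<Union>x\<in>nbrs a. (#) a ` height_paths k x b)"
  then obtain x t where x: "x \<in> nbrs a" and t: "t \<in> height_paths k x b" and hs: "hs = a # t" by auto
  have "\<bar>hs ! (i - 1) - hs ! i\<bar> = 1" if i: "i \<in> {1..Suc k}" for i
  proof (cases "i = 1")
    case True
    with x t show ?thesis by (simp add: hs height_paths_def in_nbrs_iff)
  next
    case False
    with i obtain j where j: "i = Suc j" "j \<in> {1..k}" by (cases i) auto
    have "\<forall>i\<in>{1..k}. \<bar>t ! (i - 1) - t ! i\<bar> = 1" using t by (simp add: height_paths_def)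
    with j(2) have "\<bar>t ! (j - 1) - t ! j\<bar> = 1" by blast
    with j show ?thesis by (cases j) (simp_all add: hs)
  qed
  with t show "hs \<in> height_paths (Suc k) a b"
    by (auto simp: height_paths_def hs)
qed

lemma finite_height_paths [simp]: "finite (height_paths k a b)"
  by (induction k arbitrary: a) (auto simp: height_paths_0 height_paths_Suc)

lemma height_paths_hd: "hs \<in> height_paths k a b \<Longrightarrow> \<exists>t. hs = a # t \<and> length t = k"
  by (cases hs) (auto simp: height_paths_def)

lemma steps_0: "steps 0 = {0}"
  by (auto simp: steps_def)

lemma steps_iff: "n \<in> steps k \<longleftrightarrow> - int k \<le> n \<and> n \<le> int k \<and> even (n + int k)"
proof
  assume "- int k \<le> n \<and> n \<le> int k \<and> even (n + int k)"
  then have "n = 2 * int (nat ((n + int k) div 2)) - int k" "nat ((n + int k) div 2) \<le> k" by auto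
  then show "n \<in> steps k" unfolding steps_def by blast
qed (auto simp: steps_def)

lemma finite_steps [simp]: "finite (steps k)"
  by (rule finite_subset[of _ "{- int k..int k}"]) (auto simp: steps_iff)

lemma height_paths_nonempty: "height_paths k a b \<noteq> {} \<longleftrightarrow> a - b \<in> steps k"
proof (induction k arbitrary: a)
  case 0
  then show ?case by (simp add: height_paths_0 steps_0)
next
  case (Suc k)
  have "height_paths (Suc k) a b \<noteq> {} \<longleftrightarrow> a - 1 - b \<in> steps k \<or> a + 1 - b \<in> steps k"
    unfolding Suc[symmetric] by (auto simp: height_paths_Suc nbrs_def)
  also have "\<dots> \<longleftrightarrow> a - b \<in> steps (Suc k)"
    unfolding steps_iff of_nat_Suc by presburger
  finally show ?case .
qed

lemma steps_Suc: "a - b \<in> steps (Suc k) \<longleftrightarrow> (\<exists>x\<in>nbrs a. x - b \<in> steps k)"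
  unfolding height_paths_nonempty[symmetric] by (auto simp: height_paths_Suc)

definition reach :: "nat \<Rightarrow> int \<Rightarrow> int set" where
  "reach k a = {b. a - b \<in> steps k}"

lemma in_reach_iff: "b \<in> reach k a \<longleftrightarrow> a - b \<in> steps k"
  by (simp add: reach_def)

lemma finite_reach [simp]: "finite (reach k a)"
proof -
  have "reach k a \<subseteq> {a - int k..a + int k}" by (auto simp: reach_def steps_iff)
  then show ?thesis by (rule finite_subset) simp
qed

lemma some_path_in: "a - b \<in> steps k \<Longrightarrow> some_path k a b \<in> height_paths k a b"
  unfolding some_path_def height_paths_nonempty[symmetric] by (simp add: some_in_eq)

section \<open>Fusion along a path\<close>

type_synonym kernel = "int \<Rightarrow> int \<Rightarrow> int \<Rightarrow> int \<Rightarrow> complex \<Rightarrow> complex"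

text \<open>Faces side by side along the fixed top path \<open>as\<close>, summed over all bottom paths from \<open>d\<close> to \<open>c\<close>. From left to right the
spectral parameter decreases in unit steps, ending with \<open>u\<close> at the last face. The
recursion on the top path replaces the indexed sums over \<open>height_paths\<close> (see \<open>chain_eq_sum\<close>).\<close>

fun chain :: "kernel \<Rightarrow> int list \<Rightarrow> int \<Rightarrow> int \<Rightarrow> complex \<Rightarrow> complex" where
  "chain K [] d c u = 0"
| "chain K [a] d c u = (if d = c then 1 else 0)"
| "chain K (a # x # as) d c u =
     (\<Sum>y\<in>nbrs d. K a x d y (u + of_nat (length as)) * chain K (x # as) y c u)"

lemma sum_height_paths_Suc:
  "(\<Sum>hs\<in>height_paths (Suc k) a b. f hs) = (\<Sum>x\<in>nbrs a. \<Sum>t\<in>height_paths k x b. f (a # t))"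
  for f :: "int list \<Rightarrow> complex"
proof -
  have "(\<Sum>hs\<in>height_paths (Suc k) a b. f hs) = (\<Sum>x\<in>nbrs a. \<Sum>hs\<in>(#) a ` height_paths k x b. f hs)"
    unfolding height_paths_Suc
    by (rule sum.UNION_disjoint) (auto dest!: height_paths_hd)
  also have "\<dots> = (\<Sum>x\<in>nbrs a. \<Sum>t\<in>height_paths k x b. f (a # t))"
    by (rule sum.cong[OF refl], subst sum.reindex) (simp_all add: o_def)
  finally show ?thesis .
qed

lemma prod_Suc_shift: "(\<Prod>i=1..Suc k. f i) = f 1 * (\<Prod>i=1..k. f (Suc i))" for f :: "nat \<Rightarrow> complex"
  using prod.atLeast_Suc_atMost[of 1 "Suc k" f] prod.shift_bounds_cl_Suc_ivl[of f 1 k]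
  by (simp del: prod.cl_ivl_Suc)

lemma chain_eq_sum:
  assumes "as \<in> height_paths k a b"
  shows "chain K as d c u = (\<Sum>ds\<in>height_paths k d c. \<Prod>i=1..k.
     K (as ! (i - 1)) (as ! i) (ds ! (i - 1)) (ds ! i) (u + of_nat k - of_nat i))"
  using assms
proof (induction k arbitrary: as a d)
  case 0
  then show ?case by (auto simp: height_paths_0 split: if_splits)
next
  case (Suc k)
  then obtain x t where x: "x \<in> nbrs a" and t: "t \<in> height_paths k x b" and as: "as = a # t"
    by (auto simp: height_paths_Suc)
  from height_paths_hd[OF t] obtain t' where t': "t = x # t'" "length t' = k" by blast
  have prod: "(\<Prod>i=1..Suc k. K (as ! (i - 1)) (as ! i) ((d # ds) ! (i - 1)) ((d # ds) ! i) (u + of_nat (Suc k) - of_nat i))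
      = K a x d y (u + of_nat k) * (\<Prod>i=1..k. K (t ! (i - 1)) (t ! i) (ds ! (i - 1)) (ds ! i) (u + of_nat k - of_nat i))"
    if "ds \<in> height_paths k y c" for ds y
  proof -
    have ds0: "ds ! 0 = y" using that by (auto simp: height_paths_def)
    have "(\<Prod>i=1..Suc k. K (as ! (i - 1)) (as ! i) ((d # ds) ! (i - 1)) ((d # ds) ! i) (u + of_nat (Suc k) - of_nat i))
      = K a x d y (u + of_nat k) * (\<Prod>i=1..k. K (as ! i) (as ! Suc i) ((d # ds) ! i) ((d # ds) ! Suc i) (u + of_nat (Suc k) - of_nat (Suc i)))"
      by (subst prod_Suc_shift) (simp add: as t' ds0)
    also have "(\<Prod>i=1..k. K (as ! i) (as ! Suc i) ((d # ds) ! i) ((d # ds) ! Suc i) (u + of_nat (Suc k) - of_nat (Suc i)))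
       = (\<Prod>i=1..k. K (t ! (i - 1)) (t ! i) (ds ! (i - 1)) (ds ! i) (u + of_nat k - of_nat i))"
    proof (rule prod.cong[OF refl])
      fix i assume "i \<in> {1..k}"
      then obtain j where "i = Suc j" by (cases i) auto
      moreover have e: "u + of_nat (Suc k) - of_nat (Suc i) = u + of_nat k - of_nat i" by simp
      ultimately show "K (as ! i) (as ! Suc i) ((d # ds) ! i) ((d # ds) ! Suc i) (u + of_nat (Suc k) - of_nat (Suc i))
          = K (t ! (i - 1)) (t ! i) (ds ! (i - 1)) (ds ! i) (u + of_nat k - of_nat i)"
        unfolding e by (simp add: as)
    qed
    finally show ?thesis .
  qed
  have "chain K as d c u = (\<Sum>y\<in>nbrs d. K a x d y (u + of_nat k) * chain K t y c u)"
    by (simp add: as t')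
  also have "\<dots> = (\<Sum>y\<in>nbrs d. \<Sum>ds\<in>height_paths k y c. \<Prod>i=1..Suc k.
      K (as ! (i - 1)) (as ! i) ((d # ds) ! (i - 1)) ((d # ds) ! i) (u + of_nat (Suc k) - of_nat i))"
    unfolding Suc.IH[OF t] sum_distrib_left by (intro sum.cong refl prod[symmetric])
  also have "\<dots> = (\<Sum>ds\<in>height_paths (Suc k) d c. \<Prod>i=1..Suc k.
      K (as ! (i - 1)) (as ! i) (ds ! (i - 1)) (ds ! i) (u + of_nat (Suc k) - of_nat i))"
    by (rule sum_height_paths_Suc[symmetric])
  finally show ?case .
qed

definition fusible :: "kernel \<Rightarrow> complex \<Rightarrow> bool" where
  "fusible K u \<longleftrightarrow> (\<forall>a b d c v. c \<notin> nbrs d \<longrightarrow> K a b d c v = 0) \<and>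
     (\<forall>n :: nat. flip_invariant K (u + of_nat n))"

lemma flip_invariantD:
  assumes "flip_invariant K u" "x \<in> nbrs a" "x' \<in> nbrs a"
  shows "(\<Sum>y\<in>nbrs d. K a x d y (u + 1) * K x a y c u) = (\<Sum>y\<in>nbrs d. K a x' d y (u + 1) * K x' a y c u)"
  using assms(1)[unfolded flip_invariant_def, rule_format, OF assms(2,3)] .

lemma chain_flip:
  assumes K: "fusible K u" and x: "x \<in> nbrs a" "x' \<in> nbrs a"
  shows "chain K (a # x # a # as) d c u = chain K (a # x' # a # as) d c u"
proof -
  define n where "n = length as"
  have "chain K (a # x # a # as) d c u = (\<Sum>z\<in>{d - 2, d, d + 2}.
     (\<Sum>y\<in>nbrs d. K a x d y (u + of_nat n + 1) * K x a y z (u + of_nat n)) * chain K (a # as) z c u)" for x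
  proof -
    have "chain K (a # x # a # as) d c u =
        (\<Sum>y\<in>nbrs d. K a x d y (u + of_nat n + 1) * (\<Sum>z\<in>nbrs y. K x a y z (u + of_nat n) * chain K (a # as) z c u))"
      by (simp add: n_def add_ac)
    also have "\<dots> = (\<Sum>y\<in>nbrs d. K a x d y (u + of_nat n + 1) *
        (\<Sum>z\<in>{d - 2, d, d + 2}. K x a y z (u + of_nat n) * chain K (a # as) z c u))"
    proof (rule sum.cong[OF refl], rule arg_cong2[where f = "(*)", OF refl])
      fix y assume "y \<in> nbrs d"
      then show "(\<Sum>z\<in>nbrs y. K x a y z (u + of_nat n) * chain K (a # as) z c u)
        = (\<Sum>z\<in>{d - 2, d, d + 2}. K x a y z (u + of_nat n) * chain K (a # as) z c u)"
        using K by (intro sum.mono_neutral_left) (auto simp: fusible_def nbrs_def)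
    qed
    also have "\<dots> = (\<Sum>z\<in>{d - 2, d, d + 2}.
     (\<Sum>y\<in>nbrs d. K a x d y (u + of_nat n + 1) * K x a y z (u + of_nat n)) * chain K (a # as) z c u)"
      unfolding sum_distrib_left sum_distrib_right by (subst sum.swap) (simp only: mult.assoc)
    finally show ?thesis .
  qed
  moreover have "flip_invariant K (u + of_nat n)" using K by (simp add: fusible_def)
  then have "(\<Sum>y\<in>nbrs d. K a x d y (u + of_nat n + 1) * K x a y z (u + of_nat n)) =
      (\<Sum>y\<in>nbrs d. K a x' d y (u + of_nat n + 1) * K x' a y z (u + of_nat n))" for z
    by (rule flip_invariantD[OF _ x])
  ultimately show ?thesis by simp
qed

text \<open>Suppose two paths start with different steps, to \<open>a + 1\<close> and to \<open>a - 1\<close>. Since both reach \<open>b\<close> in the remaining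
\<open>k - 1\<close> steps, \<open>b\<close> can also be reached from \<open>a\<close> in \<open>k - 2\<close> steps. So both paths can be compared, by induction, with paths
that return to \<open>a\<close> after two steps, and those differ by one flip.\<close>

lemma chain_independent:
  assumes K: "fusible K u" and "as \<in> height_paths k a b" "as' \<in> height_paths k a b"
  shows "chain K as d c u = chain K as' d c u"
  using assms(2,3)
proof (induction k arbitrary: a as as' d)
  case 0
  then show ?case by (auto simp: height_paths_0 split: if_splits)
next
  case (Suc k)
  have cons: "chain K (a # t) d c u = chain K (a # t') d c u"
    if "t \<in> height_paths k x b" "t' \<in> height_paths k x b" for x t t'
    using height_paths_hd[OF that(1)] height_paths_hd[OF that(2)] Suc.IH[OF that] by auto
  from Suc.prems obtain x t x' t' where x: "x \<in> nbrs a" "t \<in> height_paths k x b" "as = a # t"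
      and x': "x' \<in> nbrs a" "t' \<in> height_paths k x' b" "as' = a # t'"
    by (auto simp: height_paths_Suc)
  show ?case
  proof (cases "x = x'")
    case True
    with x x' cons show ?thesis by blast
  next
    case False
    have "x - b \<in> steps k" "x' - b \<in> steps k"
      using x x' height_paths_nonempty by blast+
    with False x(1) x'(1) have "a - 1 - b \<in> steps k" "a + 1 - b \<in> steps k" by (auto simp: nbrs_def)
    then have *: "k \<ge> 1 \<and> a - b \<in> steps (k - 1)" unfolding steps_iff by auto
    then obtain k' where k': "k = Suc k'" by (cases k) auto
    with * obtain as0 where as0: "as0 \<in> height_paths k' a b" using height_paths_nonempty by fastforce
    then have mem: "y # as0 \<in> height_paths k y b" if "y \<in> nbrs a" for y
      using that by (force simp: k' height_paths_Suc nbrs_def)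
    obtain t0 where t0: "as0 = a # t0" using height_paths_hd[OF as0] by blast
    have "chain K as d c u = chain K (a # x # as0) d c u"
      using cons[OF x(2) mem[OF x(1)]] x(3) by simp
    also have "\<dots> = chain K (a # x' # as0) d c u"
      unfolding t0 by (rule chain_flip[OF K x(1) x'(1)])
    also have "\<dots> = chain K as' d c u"
      using cons[OF x'(2) mem[OF x'(1)]] x'(3) by simp
    finally show ?thesis .
  qed
qed

definition fuse :: "kernel \<Rightarrow> nat \<Rightarrow> kernel" where
  "fuse K k a b d c u = (if a - b \<in> steps k then chain K (some_path k a b) d c u else 0)"

lemma fuse_eq_sum:
  "fuse K k a b d c u = (if height_paths k a b = {} then 0 else
     \<Sum>ds\<in>height_paths k d c. \<Prod>i=1..k. K (some_path k a b ! (i - 1)) (some_path k a b ! i)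
       (ds ! (i - 1)) (ds ! i) (u + of_nat k - of_nat i))"
  using chain_eq_sum[OF some_path_in, of a b k K d c u] height_paths_nonempty[of k a b]
  by (auto simp: fuse_def)

lemma fuse_0: "fuse K 0 a b d c u = (if a = b \<and> d = c then 1 else 0)"
  using some_path_in[of a b 0] by (auto simp: fuse_def steps_0 height_paths_0)

lemma fuse_top: "a - b \<notin> steps k \<Longrightarrow> fuse K k a b d c u = 0"
  by (simp add: fuse_def)

lemma fuse_bottom: "d - c \<notin> steps k \<Longrightarrow> fuse K k a b d c u = 0"
  using height_paths_nonempty[of k d c] by (auto simp: fuse_def chain_eq_sum[OF some_path_in])

text \<open>Peeling off the first face. The freedom to choose the intermediate height \<open>x\<close> is what all inductions below rely on.\<close>

lemma fuse_Suc:
  assumes K: "fusible K u" and x: "x \<in> nbrs a" "x - b \<in> steps k"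
  shows "fuse K (Suc k) a b d c u = (\<Sum>y\<in>nbrs d. K a x d y (u + of_nat k) * fuse K k x b y c u)"
proof -
  have ab: "a - b \<in> steps (Suc k)" using x steps_Suc by blast
  obtain t where t: "some_path k x b = x # t" "length t = k"
    using height_paths_hd[OF some_path_in[OF x(2)]] by blast
  have "a # some_path k x b \<in> height_paths (Suc k) a b"
    using x some_path_in[OF x(2)] by (auto simp: height_paths_Suc)
  from chain_independent[OF K some_path_in[OF ab] this]
  have "fuse K (Suc k) a b d c u = chain K (a # some_path k x b) d c u"
    using ab by (simp add: fuse_def)
  then show ?thesis using t x by (simp add: fuse_def)
qed

lemma sum_neutral_eq:
  fixes f :: "'a \<Rightarrow> complex"
  assumes "finite A" "finite B" "\<And>x. x \<in> A \<Longrightarrow> x \<notin> B \<Longrightarrow> f x = 0" "\<And>x. x \<in> B \<Longrightarrow> x \<notin> A \<Longrightarrow> f x = 0"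
  shows "sum f A = sum f B"
proof -
  have "sum f A = sum f (A \<inter> B)" using assms by (intro sum.mono_neutral_right) auto
  also have "\<dots> = sum f B" using assms by (intro sum.mono_neutral_left) auto
  finally show ?thesis .
qed

section \<open>Fusion of the exchange relation\<close>

text \<open>Here \<open>A\<close> stands for the face weights, \<open>B\<close> for the \<open>L\<close>-matrices that are fused and \<open>C\<close> for the one that is passed
through. After the first column has been peeled off, the relation for a single face moves \<open>C\<close> across it, and
the induction hypothesis moves \<open>C\<close> across the remaining columns.\<close>

lemma exchange_fuse_horizontal:
  fixes A B :: kernel and C :: "int \<Rightarrow> int \<Rightarrow> int \<Rightarrow> int \<Rightarrow> complex"
  assumes A: "fusible A w" and B: "fusible B u"
    and suppA: "\<And>a b d c v. c \<notin> nbrs b \<Longrightarrow> A a b d c v = 0"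
    and suppC: "\<And>a d g f. d \<notin> nbrs a \<Longrightarrow> C a d g f = 0"
    and ex: "\<And>(n :: nat) a b c e f g.
      (\<Sum>d\<in>nbrs a. A a b d c (w + of_nat n) * B d c f e (u + of_nat n) * C a d g f) =
      (\<Sum>d\<in>nbrs g. B a b g d (u + of_nat n) * C b c d e * A g d f e (w + of_nat n))"
  shows "(\<Sum>d\<in>nbrs a. fuse A k a b d c w * fuse B k d c f e u * C a d g f) =
      (\<Sum>d\<in>reach k g. fuse B k a b g d u * C b c d e * fuse A k g d f e w)"
proof (induction k arbitrary: a f g)
  case 0
  have "(\<Sum>d\<in>nbrs a. fuse A 0 a b d c w * fuse B 0 d c f e u * C a d g f)
      = (\<Sum>d\<in>{c}. fuse A 0 a b d c w * fuse B 0 d c f e u * C a d g f)"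
    using suppC by (intro sum_neutral_eq) (auto simp: fuse_0)
  also have "\<dots> = (\<Sum>d\<in>reach 0 g. fuse B 0 a b g d u * C b c d e * fuse A 0 g d f e w)"
    by (simp add: reach_def steps_0 fuse_0)
  finally show ?case .
next
  case (Suc k)
  show ?case
  proof (cases "a - b \<in> steps (Suc k)")
    case False
    then show ?thesis by (simp add: fuse_top)
  next
    case True
    then obtain x where x: "x \<in> nbrs a" "x - b \<in> steps k" using steps_Suc by blast
    let ?A = "\<lambda>a b d c. A a b d c (w + of_nat k)" and ?B = "\<lambda>a b d c. B a b d c (u + of_nat k)"
    let ?fA = "\<lambda>a b d c. fuse A k a b d c w" and ?fB = "\<lambda>a b d c. fuse B k a b d c u"
    have "(\<Sum>d\<in>nbrs a. fuse A (Suc k) a b d c w * fuse B (Suc k) d c f e u * C a d g f)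
      = (\<Sum>d\<in>nbrs a. \<Sum>y\<in>nbrs d. \<Sum>z\<in>nbrs f. ?A a x d y * ?fA x b y c * (?B d y f z * ?fB y c z e) * C a d g f)"
    proof (rule sum.cong[OF refl])
      fix d
      have "?A a x d y * ?fA x b y c * fuse B (Suc k) d c f e u * C a d g f
          = (\<Sum>z\<in>nbrs f. ?A a x d y * ?fA x b y c * (?B d y f z * ?fB y c z e) * C a d g f)"
        if "y \<in> nbrs d" for y
      proof (cases "y - c \<in> steps k")
        case True
        then show ?thesis
          unfolding fuse_Suc[OF B that True] by (simp add: sum_distrib_left sum_distrib_right)
      next
        case False
        then show ?thesis by (simp add: fuse_bottom)
      qed
      then show "fuse A (Suc k) a b d c w * fuse B (Suc k) d c f e u * C a d g f
        = (\<Sum>y\<in>nbrs d. \<Sum>z\<in>nbrs f. ?A a x d y * ?fA x b y c * (?B d y f z * ?fB y c z e) * C a d g f)"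
        unfolding fuse_Suc[OF A x] sum_distrib_right by (intro sum.cong refl)
    qed
    also have "\<dots> = (\<Sum>d\<in>nbrs a. \<Sum>y\<in>nbrs x. \<Sum>z\<in>nbrs f. ?A a x d y * ?fA x b y c * (?B d y f z * ?fB y c z e) * C a d g f)"
      by (rule sum.cong[OF refl], rule sum_neutral_eq) (use suppA A in \<open>auto simp: fusible_def\<close>)
    also have "\<dots> = (\<Sum>y\<in>nbrs x. \<Sum>z\<in>nbrs f. \<Sum>d\<in>nbrs a. ?A a x d y * ?fA x b y c * (?B d y f z * ?fB y c z e) * C a d g f)"
      by (subst sum.swap) (intro sum.cong refl sum.swap)
    also have "\<dots> = (\<Sum>y\<in>nbrs x. \<Sum>z\<in>nbrs f. ?fA x b y c * ?fB y c z e * (\<Sum>d\<in>nbrs a. ?A a x d y * ?B d y f z * C a d g f))"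
      unfolding sum_distrib_left by (intro sum.cong refl) (simp add: mult_ac)
    also have "\<dots> = (\<Sum>y\<in>nbrs x. \<Sum>z\<in>nbrs f. ?fA x b y c * ?fB y c z e * (\<Sum>h\<in>nbrs g. ?B a x g h * C x y h z * ?A g h f z))"
      unfolding ex ..
    also have "\<dots> = (\<Sum>h\<in>nbrs g. \<Sum>z\<in>nbrs f. ?B a x g h * ?A g h f z * (\<Sum>y\<in>nbrs x. ?fA x b y c * ?fB y c z e * C x y h z))"
      unfolding sum_distrib_left
      by (subst (2) sum.swap, subst sum.swap, rule sum.cong[OF refl], subst sum.swap)
         (intro sum.cong refl, simp add: mult_ac)
    also have "\<dots> = (\<Sum>h\<in>nbrs g. \<Sum>z\<in>nbrs f. ?B a x g h * ?A g h f z * (\<Sum>d\<in>reach k h. ?fB x b h d * C b c d e * ?fA h d z e))"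
      unfolding Suc.IH ..
    also have "\<dots> = (\<Sum>h\<in>nbrs g. \<Sum>z\<in>nbrs f. ?B a x g h * ?A g h f z * (\<Sum>d\<in>reach (Suc k) g. ?fB x b h d * C b c d e * ?fA h d z e))"
    proof (rule sum.cong[OF refl], rule sum.cong[OF refl], rule arg_cong2[where f = "(*)", OF refl])
      fix h z assume "h \<in> nbrs g"
      then show "(\<Sum>d\<in>reach k h. ?fB x b h d * C b c d e * ?fA h d z e) = (\<Sum>d\<in>reach (Suc k) g. ?fB x b h d * C b c d e * ?fA h d z e)"
        using steps_Suc by (intro sum_neutral_eq) (auto simp: in_reach_iff fuse_bottom)
    qed
    also have "\<dots> = (\<Sum>d\<in>reach (Suc k) g. \<Sum>h\<in>nbrs g. (?B a x g h * ?fB x b h d) * C b c d e * (\<Sum>z\<in>nbrs f. ?A g h f z * ?fA h d z e))"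
      unfolding sum_distrib_left
      by (subst (2) sum.swap, subst sum.swap) (intro sum.cong refl, simp add: mult_ac)
    also have "\<dots> = (\<Sum>d\<in>reach (Suc k) g. \<Sum>h\<in>nbrs g. (?B a x g h * ?fB x b h d) * C b c d e * fuse A (Suc k) g d f e w)"
    proof (intro sum.cong refl)
      fix d h assume "h \<in> nbrs g"
      then show "(?B a x g h * ?fB x b h d) * C b c d e * (\<Sum>z\<in>nbrs f. ?A g h f z * ?fA h d z e)
          = (?B a x g h * ?fB x b h d) * C b c d e * fuse A (Suc k) g d f e w"
        using fuse_Suc[OF A, of h g d k f e] by (cases "h - d \<in> steps k") (simp_all add: fuse_bottom)
    qed
    also have "\<dots> = (\<Sum>d\<in>reach (Suc k) g. fuse B (Suc k) a b g d u * C b c d e * fuse A (Suc k) g d f e w)"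
      unfolding fuse_Suc[OF B x] by (simp only: sum_distrib_right)
    finally show ?thesis .
  qed
qed

text \<open>The counterpart of \<open>exchange_fuse_horizontal\<close> for rows: \<open>U\<close> is a row of faces, and \<open>C\<close> is now fused. The spectral parameter of the rows
increases from top to bottom, whereas \<open>fuse\<close> lets it decrease along the path. The
kernel \<open>T\<close> therefore reads a row sideways, with the parameter negated.\<close>

lemma exchange_fuse_vertical:
  fixes U C :: kernel and B :: "int \<Rightarrow> int \<Rightarrow> int \<Rightarrow> int \<Rightarrow> complex"
  defines "T \<equiv> (\<lambda>b0 b1 a0 a1 t. U a0 b0 a1 b1 (- t))"
  assumes T: "fusible T (- w)" and C: "fusible C v"
    and suppU: "\<And>a b d c v. d - c \<notin> steps k \<Longrightarrow> U a b d c v = 0"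
    and suppB: "\<And>a d g f. g - f \<notin> steps k \<Longrightarrow> B a d g f = 0"
    and ex: "\<And>(n :: nat) a b c e f g.
      (\<Sum>d\<in>nbrs a. U a b d c (w - of_nat n) * B d c f e * C a d g f (v + of_nat n)) =
      (\<Sum>d\<in>reach k g. B a b g d * C b c d e (v + of_nat n) * U g d f e (w - of_nat n))"
  shows "(\<Sum>d\<in>reach l a. fuse T l b c a d (- w) * B d c f e * fuse C l a d g f v) =
      (\<Sum>d\<in>reach k g. B a b g d * fuse C l b c d e v * fuse T l d e g f (- w))"
proof (induction l arbitrary: a b g)
  case 0
  have "(\<Sum>d\<in>reach k g. B a b g d * fuse C 0 b c d e v * fuse T 0 d e g f (- w))
      = (\<Sum>d\<in>{e}. B a b g d * fuse C 0 b c d e v * fuse T 0 d e g f (- w))"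
    using suppB by (intro sum_neutral_eq) (auto simp: fuse_0 in_reach_iff)
  also have "\<dots> = (\<Sum>d\<in>reach 0 a. fuse T 0 b c a d (- w) * B d c f e * fuse C 0 a d g f v)"
    by (auto simp add: reach_def steps_0 fuse_0)
  finally show ?case by simp
next
  case (Suc l)
  show ?case
  proof (cases "b - c \<in> steps (Suc l)")
    case False
    then show ?thesis by (simp add: fuse_top)
  next
    case True
    then obtain x where x: "x \<in> nbrs b" "x - c \<in> steps l" using steps_Suc by blast
    let ?U = "\<lambda>a b d c. U a b d c (w - of_nat l)" and ?C = "\<lambda>a b d c. C a b d c (v + of_nat l)"
    let ?fT = "\<lambda>a b d c. fuse T l a b d c (- w)" and ?fC = "\<lambda>a b d c. fuse C l a b d c v"
    have TU: "T b0 b1 a0 a1 (- w + of_nat l) = ?U a0 b0 a1 b1" for b0 b1 a0 a1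
      by (simp add: T_def algebra_simps)
    have "(\<Sum>d\<in>reach (Suc l) a. fuse T (Suc l) b c a d (- w) * B d c f e * fuse C (Suc l) a d g f v)
      = (\<Sum>d\<in>reach (Suc l) a. \<Sum>y\<in>nbrs a. \<Sum>z\<in>nbrs g. ?U a b y x * ?fT x c y d * B d c f e * (?C a y g z * ?fC y d z f))"
    proof (rule sum.cong[OF refl])
      fix d
      have "?U a b y x * ?fT x c y d * B d c f e * fuse C (Suc l) a d g f v
          = (\<Sum>z\<in>nbrs g. ?U a b y x * ?fT x c y d * B d c f e * (?C a y g z * ?fC y d z f))"
        if "y \<in> nbrs a" for y
      proof (cases "y - d \<in> steps l")
        case True
        then show ?thesis
          unfolding fuse_Suc[OF C that True] by (simp add: sum_distrib_left)
      next
        case False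
        then show ?thesis by (simp add: fuse_bottom)
      qed
      then show "fuse T (Suc l) b c a d (- w) * B d c f e * fuse C (Suc l) a d g f v
        = (\<Sum>y\<in>nbrs a. \<Sum>z\<in>nbrs g. ?U a b y x * ?fT x c y d * B d c f e * (?C a y g z * ?fC y d z f))"
        unfolding fuse_Suc[OF T x] sum_distrib_right TU by (intro sum.cong refl)
    qed
    also have "\<dots> = (\<Sum>y\<in>nbrs a. \<Sum>z\<in>nbrs g. ?U a b y x * ?C a y g z * (\<Sum>d\<in>reach (Suc l) a. ?fT x c y d * B d c f e * ?fC y d z f))"
      unfolding sum_distrib_left
      by (subst sum.swap, rule sum.cong[OF refl], subst sum.swap) (intro sum.cong refl, simp add: mult_ac)
    also have "\<dots> = (\<Sum>y\<in>nbrs a. \<Sum>z\<in>nbrs g. ?U a b y x * ?C a y g z * (\<Sum>d\<in>reach l y. ?fT x c y d * B d c f e * ?fC y d z f))"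
    proof (rule sum.cong[OF refl], rule sum.cong[OF refl], rule arg_cong2[where f = "(*)", OF refl])
      fix y z assume "y \<in> nbrs a"
      then show "(\<Sum>d\<in>reach (Suc l) a. ?fT x c y d * B d c f e * ?fC y d z f) = (\<Sum>d\<in>reach l y. ?fT x c y d * B d c f e * ?fC y d z f)"
        using steps_Suc by (intro sum_neutral_eq) (auto simp: in_reach_iff fuse_bottom)
    qed
    also have "\<dots> = (\<Sum>y\<in>nbrs a. \<Sum>z\<in>nbrs g. ?U a b y x * ?C a y g z * (\<Sum>h\<in>reach k z. B y x z h * ?fC x c h e * ?fT h e z f))"
      unfolding Suc.IH ..
    also have "\<dots> = (\<Sum>z\<in>nbrs g. \<Sum>h\<in>reach k z. ?fC x c h e * ?fT h e z f * (\<Sum>y\<in>nbrs a. ?U a b y x * B y x z h * ?C a y g z))"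
      unfolding sum_distrib_left
      by (subst sum.swap, rule sum.cong[OF refl], subst sum.swap) (intro sum.cong refl, simp add: mult_ac)
    also have "\<dots> = (\<Sum>z\<in>nbrs g. \<Sum>h\<in>reach k z. ?fC x c h e * ?fT h e z f * (\<Sum>d\<in>reach k g. B a b g d * ?C b x d h * ?U g d z h))"
      unfolding ex ..
    also have "\<dots> = (\<Sum>z\<in>nbrs g. \<Sum>d\<in>reach k g. \<Sum>h\<in>reach k z. B a b g d * (?C b x d h * ?fC x c h e) * (?U g d z h * ?fT h e z f))"
      unfolding sum_distrib_left by (rule sum.cong[OF refl], subst sum.swap) (intro sum.cong refl, simp add: mult_ac)
    also have "\<dots> = (\<Sum>z\<in>nbrs g. \<Sum>d\<in>reach k g. \<Sum>h\<in>nbrs d. B a b g d * (?C b x d h * ?fC x c h e) * (?U g d z h * ?fT h e z f))"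
      by (rule sum.cong[OF refl], rule sum.cong[OF refl], rule sum_neutral_eq)
         (use C suppU in \<open>auto simp: fusible_def in_reach_iff\<close>)
    also have "\<dots> = (\<Sum>d\<in>reach k g. \<Sum>h\<in>nbrs d. B a b g d * (?C b x d h * ?fC x c h e) * (\<Sum>z\<in>nbrs g. ?U g d z h * ?fT h e z f))"
      unfolding sum_distrib_left
      by (subst sum.swap, rule sum.cong[OF refl], subst sum.swap) (rule refl)
    also have "\<dots> = (\<Sum>d\<in>reach k g. \<Sum>h\<in>nbrs d. B a b g d * (?C b x d h * ?fC x c h e) * fuse T (Suc l) d e g f (- w))"
    proof (intro sum.cong refl)
      fix d h assume "h \<in> nbrs d"
      then show "B a b g d * (?C b x d h * ?fC x c h e) * (\<Sum>z\<in>nbrs g. ?U g d z h * ?fT h e z f)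
          = B a b g d * (?C b x d h * ?fC x c h e) * fuse T (Suc l) d e g f (- w)"
        using fuse_Suc[OF T, of h d e l g f, unfolded TU]
        by (cases "h - e \<in> steps l") (simp_all only: fuse_bottom fuse_top not_False_eq_True mult_zero_left mult_zero_right)
    qed
    also have "\<dots> = (\<Sum>d\<in>reach k g. B a b g d * fuse C (Suc l) b c d e v * fuse T (Suc l) d e g f (- w))"
      unfolding fuse_Suc[OF C x] by (simp only: sum_distrib_right sum_distrib_left)
    finally show ?thesis .
  qed
qed

lemma fuse_Suc_left:
  assumes suppA: "\<And>a b d c v. d \<notin> nbrs a \<Longrightarrow> A a b d c v = 0"
    and "fusible A u" and "fuse A (Suc k) a b d c u \<noteq> 0"
  shows "d \<in> nbrs a"
proof -
  have "a - b \<in> steps (Suc k)" using assms(3) fuse_top by blast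
  then obtain x where x: "x \<in> nbrs a" "x - b \<in> steps k" using steps_Suc by blast
  show ?thesis
  proof (rule ccontr)
    assume "d \<notin> nbrs a"
    then have "fuse A (Suc k) a b d c u = 0"
      unfolding fuse_Suc[OF assms(2) x] by (simp add: suppA)
    with assms(3) show False by contradiction
  qed
qed

text \<open>Flipping a corner of the right boundary of two rows. After the first column has been peeled off both rows, its sum \<open>G t r\<close> over
the left boundary depends on the inner boundary only through its endpoints: if these agree, this is the flip
for single faces, and otherwise the middle height \<open>t\<close> is determined by them. So the constant factors
out and the claim reduces to the remaining columns.\<close>

lemma fuse_flip_invariant_vertical:
  fixes A :: kernel
  assumes A: "\<And>n :: int. fusible A (w + of_int n)"
    and supp: "\<And>a b d c v. d \<notin> nbrs a \<Longrightarrow> A a b d c v = 0" "\<And>a b d c v. c \<notin> nbrs b \<Longrightarrow> A a b d c v = 0"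
    and flip: "\<And>n :: int. flip_invariant (\<lambda>b0 b1 a0 a1 t. A a0 b0 a1 b1 (- t)) (- (w + of_int n))"
  shows "flip_invariant (\<lambda>b0 b1 a0 a1 t. fuse A k a0 b0 a1 b1 (- t)) (- w)"
  unfolding flip_invariant_def
proof (intro allI impI)
  fix b x x' a d :: int assume x: "x \<in> nbrs b" and x': "x' \<in> nbrs b"
  have "(\<Sum>y\<in>nbrs a. fuse A k a b y x (w - 1) * fuse A k y x d b w)
      = (\<Sum>y\<in>nbrs a. fuse A k a b y x' (w - 1) * fuse A k y x' d b w)"
  proof (induction k arbitrary: a d)
    case 0
    have "(\<Sum>y\<in>nbrs a. fuse A 0 a b y x (w - 1) * fuse A 0 y x d b w) = (if a = b \<and> d = b then 1 else 0)"
      if "x \<in> nbrs b" for x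
    proof (cases "a = b")
      case True
      have "(\<Sum>y\<in>nbrs a. fuse A 0 a b y x (w - 1) * fuse A 0 y x d b w)
          = (\<Sum>y\<in>{x}. fuse A 0 a b y x (w - 1) * fuse A 0 y x d b w)"
        using True that by (intro sum_neutral_eq) (auto simp: fuse_0)
      then show ?thesis by (simp add: fuse_0)
    qed (simp add: fuse_0)
    from this[OF x] this[OF x'] show ?case by simp
  next
    case (Suc k)
    show ?case
    proof (cases "a - b \<in> steps (Suc k)")
      case False
      then show ?thesis by (simp add: fuse_top)
    next
      case True
      then obtain m where m: "m \<in> nbrs a" "m - b \<in> steps k" using steps_Suc by blast
      have A1: "fusible A (w - 1)" and A0: "fusible A w" using A[of "-1"] A[of 0] by simp_all
      define G where "G = (\<lambda>t r. \<Sum>y\<in>nbrs a. A a m y t (w - 1 + of_nat k) * A y t d r (w + of_nat k))"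
      have G0: "G t r = 0" if "t \<notin> nbrs r" for t r
      proof -
        have "A y t d r (w + of_nat k) = 0" for y
          using supp(2)[of r t y d] that by (auto simp: nbrs_def)
        then show ?thesis by (simp add: G_def)
      qed
      \<comment> \<open>The common value of \<open>G t r\<close> over the admissible \<open>t\<close>, evaluated at an arbitrary one of them.\<close>
      define gr where "gr = (\<lambda>r. if r = m then G (m + 1) m else G ((m + r) div 2) r)"
      have G_eq: "G t r = gr r" if "t \<in> nbrs m" "t \<in> nbrs r" for t r
      proof (cases "r = m")
        case True
        have "- (w + of_nat k) + 1 = - (w - 1 + of_nat k)" by simp
        with flip[of "int k", unfolded flip_invariant_def, rule_format, of t m "m + 1" a d] that
        show ?thesis by (simp add: True gr_def G_def in_nbrs_iff algebra_simps)
      next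
        case False
        then have "(m + r) div 2 = t" using that by (auto simp: nbrs_def)
        with False show ?thesis by (simp add: gr_def)
      qed
      have supp_t: "t \<in> nbrs r" if "t \<in> nbrs m" "fuse A k m b t x (w - 1) * fuse A k t x r b w \<noteq> 0" for t x r
      proof (cases k)
        case 0
        with that show ?thesis by (auto simp: fuse_0 split: if_splits)
      next
        case (Suc k')
        have "r \<in> nbrs t"
          using that(2) unfolding Suc by (intro fuse_Suc_left[OF supp(1) A0]) auto
        then show ?thesis by (auto simp: nbrs_def)
      qed
      have "(\<Sum>y\<in>nbrs a. fuse A (Suc k) a b y x (w - 1) * fuse A (Suc k) y x d b w)
          = (\<Sum>r\<in>nbrs d. gr r * (\<Sum>t\<in>nbrs m. fuse A k m b t x (w - 1) * fuse A k t x r b w))" for x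
      proof -
        let ?f = "\<lambda>y t r. A a m y t (w - 1 + of_nat k) * fuse A k m b t x (w - 1) * (A y t d r (w + of_nat k) * fuse A k t x r b w)"
        have "(\<Sum>y\<in>nbrs a. fuse A (Suc k) a b y x (w - 1) * fuse A (Suc k) y x d b w)
            = (\<Sum>y\<in>nbrs a. \<Sum>t\<in>nbrs y. \<Sum>r\<in>nbrs d. ?f y t r)"
        proof (rule sum.cong[OF refl])
          fix y
          have "A a m y t (w - 1 + of_nat k) * fuse A k m b t x (w - 1) * fuse A (Suc k) y x d b w = (\<Sum>r\<in>nbrs d. ?f y t r)"
            if "t \<in> nbrs y" for t
          proof (cases "t - x \<in> steps k")
            case True
            then show ?thesis unfolding fuse_Suc[OF A0 that True] by (simp add: sum_distrib_left)
          next
            case False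
            then show ?thesis by (simp add: fuse_bottom)
          qed
          then show "fuse A (Suc k) a b y x (w - 1) * fuse A (Suc k) y x d b w = (\<Sum>t\<in>nbrs y. \<Sum>r\<in>nbrs d. ?f y t r)"
            unfolding fuse_Suc[OF A1 m] sum_distrib_right by (intro sum.cong refl)
        qed
        also have "\<dots> = (\<Sum>y\<in>nbrs a. \<Sum>t\<in>nbrs m. \<Sum>r\<in>nbrs d. ?f y t r)"
          by (rule sum.cong[OF refl], rule sum_neutral_eq) (use supp(2) A0 in \<open>auto simp: fusible_def\<close>)
        also have "\<dots> = (\<Sum>r\<in>nbrs d. \<Sum>t\<in>nbrs m. G t r * (fuse A k m b t x (w - 1) * fuse A k t x r b w))"
          unfolding G_def sum_distrib_right
          by (subst sum.swap, subst (2) sum.swap, subst sum.swap) (intro sum.cong refl, simp add: mult_ac)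
        also have "\<dots> = (\<Sum>r\<in>nbrs d. gr r * (\<Sum>t\<in>nbrs m. fuse A k m b t x (w - 1) * fuse A k t x r b w))"
          unfolding sum_distrib_left
        proof (intro sum.cong refl)
          fix r t assume "t \<in> nbrs m"
          then show "G t r * (fuse A k m b t x (w - 1) * fuse A k t x r b w)
              = gr r * (fuse A k m b t x (w - 1) * fuse A k t x r b w)"
            using G_eq[of t r] supp_t[of t x r] by (cases "t \<in> nbrs r") auto
        qed
        finally show ?thesis .
      qed
      then show ?thesis using Suc.IH by simp
    qed
  qed
  then show "(\<Sum>y\<in>nbrs a. fuse A k a b y x (- (- w + 1)) * fuse A k y x d b (- (- w))) =
    (\<Sum>y\<in>nbrs a. fuse A k a b y x' (- (- w + 1)) * fuse A k y x' d b (- (- w)))"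
    by simp
qed

section \<open>The exchange relation for a single face\<close>

text \<open>The identities for one face use only that \<open>p\<close> and \<open>q\<close> are the coordinates of an even map into the plane whose
determinants factor through the odd function \<open>s\<close>, the bracket. The number \<open>cc\<close> is the normalisation \<open>C\<^sup>2\<close> of the dual vectors.\<close>

locale theta_pair =
  fixes p q s :: "complex \<Rightarrow> complex" and \<kappa> cc :: complex
  assumes p_even: "p (- x) = p x" and q_even: "q (- x) = q x" and s_odd: "s (- x) = - s x"
    and \<kappa>_nonzero: "\<kappa> \<noteq> 0"
    and addition: "q (x + y) * p (x - y) - p (x + y) * q (x - y) = \<kappa> * s x * s y"
begin

definition vcomp :: "int \<Rightarrow> complex \<Rightarrow> complex" where
  "vcomp \<epsilon> x = (if \<epsilon> = 1 then p x else q x)"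

lemma vcomp_even: "vcomp \<epsilon> (- x) = vcomp \<epsilon> x"
  by (simp add: vcomp_def p_even q_even)

definition pdet :: "complex \<Rightarrow> complex \<Rightarrow> complex" where
  "pdet x y = q x * p y - p x * q y"

lemma pdet: "pdet x y = \<kappa> * s ((x + y) / 2) * s ((x - y) / 2)"
  using addition[of "(x + y) / 2" "(x - y) / 2"] by (simp add: pdet_def field_simps)

text \<open>The Pluecker relation for four vectors of a plane, with determinants written in terms of \<open>s\<close>.\<close>

lemma three_term:
  "s (a + b) * s (a - b) * s (c + d) * s (c - d) =
   s (a + c) * s (a - c) * s (b + d) * s (b - d) - s (a + d) * s (a - d) * s (b + c) * s (b - c)"
proof -
  have P: "pdet (2 * x) (2 * y) = \<kappa> * (s (x + y) * s (x - y))" for x y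
  proof -
    have "(2 * x + 2 * y) / 2 = x + y" "(2 * x - 2 * y) / 2 = x - y" by (simp_all add: field_simps)
    then show ?thesis unfolding pdet by (simp only: mult.assoc)
  qed
  have "pdet (2 * a) (2 * b) * pdet (2 * c) (2 * d) =
      pdet (2 * a) (2 * c) * pdet (2 * b) (2 * d) - pdet (2 * a) (2 * d) * pdet (2 * b) (2 * c)"
    by (simp add: pdet_def algebra_simps)
  then have "\<kappa>\<^sup>2 * (s (a + b) * s (a - b) * s (c + d) * s (c - d)) = \<kappa>\<^sup>2 *
   (s (a + c) * s (a - c) * s (b + d) * s (b - d) - s (a + d) * s (a - d) * s (b + c) * s (b - c))"
    unfolding P by (simp add: power2_eq_square algebra_simps)
  then show ?thesis using \<kappa>_nonzero by simp
qed

lemma vcomp_plucker: "pdet y z * vcomp \<epsilon> x = pdet x z * vcomp \<epsilon> y - pdet x y * vcomp \<epsilon> z"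
  by (simp add: vcomp_def pdet_def algebra_simps)

definition tens :: "complex \<Rightarrow> complex \<Rightarrow> int \<Rightarrow> int \<Rightarrow> complex" where
  "tens x y = (\<lambda>\<epsilon> \<epsilon>'. vcomp \<epsilon> x * vcomp \<epsilon>' y)"

lemma tens_even: "tens (- x) y = tens x y" "tens x (- y) = tens x y"
  by (simp_all add: tens_def vcomp_even)

text \<open>The tensor square of the determinant form; compare \<open>pairing_tens\<close>.\<close>

definition pairing :: "(int \<Rightarrow> int \<Rightarrow> complex) \<Rightarrow> (int \<Rightarrow> int \<Rightarrow> complex) \<Rightarrow> complex" where
  "pairing S T = S (-1) (-1) * T 1 1 - S (-1) 1 * T 1 (-1) - S 1 (-1) * T (-1) 1 + S 1 1 * T (-1) (-1)"

lemma pairing_tens: "pairing (tens x y) (tens z w) = pdet x z * pdet y w"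
  by (simp add: pairing_def tens_def vcomp_def pdet_def algebra_simps)

lemma pairing_lincomb:
  "pairing (\<lambda>\<epsilon> \<epsilon>'. \<alpha> * S \<epsilon> \<epsilon>' + \<beta> * S' \<epsilon> \<epsilon>') T = \<alpha> * pairing S T + \<beta> * pairing S' T"
  "pairing T (\<lambda>\<epsilon> \<epsilon>'. \<alpha> * S \<epsilon> \<epsilon>' + \<beta> * S' \<epsilon> \<epsilon>') = \<alpha> * pairing T S + \<beta> * pairing T S'"
  by (simp_all add: pairing_def algebra_simps)

text \<open>\<open>I\<close> arises from \<open>S\<close> by the rule \<open>v x \<otimes> v (x + 1 + w) \<mapsto> v (x + 1) \<otimes> v (x + w)\<close>, applied to a particular way of writing \<open>S\<close> as a
combination of two such tensors. This says that the eight-vertex R-matrix maps \<open>S\<close> to \<open>I\<close>, without presupposing that the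
rule defines a linear map.\<close>

definition exchanged :: "complex \<Rightarrow> (int \<Rightarrow> int \<Rightarrow> complex) \<Rightarrow> (int \<Rightarrow> int \<Rightarrow> complex) \<Rightarrow> bool" where
  "exchanged w S I \<longleftrightarrow> (\<exists>\<alpha> \<beta> x y.
     S = (\<lambda>\<epsilon> \<epsilon>'. \<alpha> * tens x (x + 1 + w) \<epsilon> \<epsilon>' + \<beta> * tens y (y + 1 + w) \<epsilon> \<epsilon>') \<and>
     I = (\<lambda>\<epsilon> \<epsilon>'. \<alpha> * tens (x + 1) (x + w) \<epsilon> \<epsilon>' + \<beta> * tens (y + 1) (y + w) \<epsilon> \<epsilon>'))"

text \<open>The rule behind \<open>exchanged\<close> is self-adjoint for the pairing: on two basic tensors both sides are products of the same
four values of \<open>s\<close>.\<close>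

lemma exchanged_pairing:
  assumes "exchanged w S I" and "exchanged w S' I'"
  shows "pairing S I' = pairing I S'"
proof -
  have "pairing (tens z (z + 1 + w)) (tens (x + 1) (x + w))
      = pairing (tens (z + 1) (z + w)) (tens x (x + 1 + w))" for x z
  proof -
    have "(z - (x + 1)) / 2 = (z + w - (x + 1 + w)) / 2" "(z + 1 + w - (x + w)) / 2 = (z + 1 - x) / 2"
        "(z + 1 + w + (x + w)) / 2 = (z + w + (x + 1 + w)) / 2" "(z + (x + 1)) / 2 = (z + 1 + x) / 2"
      by (simp_all add: algebra_simps)
    then show ?thesis
      unfolding pairing_tens pdet by (simp only: mult_ac)
  qed
  note basic = this
  from assms show ?thesis
    unfolding exchanged_def by (auto simp: pairing_lincomb basic)
qed

lemma exchanged_scale: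
  assumes "exchanged w S I"
  shows "exchanged w (\<lambda>\<epsilon> \<epsilon>'. k * S \<epsilon> \<epsilon>') (\<lambda>\<epsilon> \<epsilon>'. k * I \<epsilon> \<epsilon>')"
proof -
  from assms obtain \<alpha> \<beta> x y where
    "S = (\<lambda>\<epsilon> \<epsilon>'. \<alpha> * tens x (x + 1 + w) \<epsilon> \<epsilon>' + \<beta> * tens y (y + 1 + w) \<epsilon> \<epsilon>')"
    "I = (\<lambda>\<epsilon> \<epsilon>'. \<alpha> * tens (x + 1) (x + w) \<epsilon> \<epsilon>' + \<beta> * tens (y + 1) (y + w) \<epsilon> \<epsilon>')"
    unfolding exchanged_def by blast
  then show ?thesis
    unfolding exchanged_def
    by (intro exI[of _ "k * \<alpha>"] exI[of _ "k * \<beta>"] exI[of _ x] exI[of _ y]) (simp add: algebra_simps)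
qed

lemma exchanged_tens: "exchanged w (tens x (x + 1 + w)) (tens (x + 1) (x + w))"
  unfolding exchanged_def by (intro exI[of _ 1] exI[of _ 0] exI[of _ x]) simp

text \<open>Expanding \<open>v Y\<close> in \<open>v (X + 1 + w)\<close> and \<open>v (- X + 1 + w)\<close> writes \<open>v X \<otimes> v Y\<close> as a combination of two basic tensors, since \<open>v\<close>
is even. The image of that combination equals the required one if their difference, a sum of two tensors with
a common factor each, cancels; the number \<open>\<gamma>\<close> expresses this.\<close>

lemma exchanged_combination:
  fixes A B \<alpha> \<beta> \<gamma> :: complex
  assumes "\<And>\<epsilon>. vcomp \<epsilon> Y = \<alpha> * vcomp \<epsilon> (X + 1 + w) + \<beta> * vcomp \<epsilon> (- X + 1 + w)"
    and "\<And>\<epsilon>. \<alpha> * vcomp \<epsilon> (X + 1) - A * vcomp \<epsilon> Z = \<gamma> * vcomp \<epsilon> (- X + 1)"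
    and "\<And>\<epsilon>. B * vcomp \<epsilon> V - \<beta> * vcomp \<epsilon> (- X + w) = \<gamma> * vcomp \<epsilon> (X + w)"
  shows "exchanged w (tens X Y)
    (\<lambda>\<epsilon> \<epsilon>'. A * tens Z (X + w) \<epsilon> \<epsilon>' + B * tens (- X + 1) V \<epsilon> \<epsilon>')"
proof -
  have 1: "tens X Y \<epsilon> \<epsilon>' = \<alpha> * tens X (X + 1 + w) \<epsilon> \<epsilon>' + \<beta> * tens (- X) (- X + 1 + w) \<epsilon> \<epsilon>'" for \<epsilon> \<epsilon>'
    unfolding tens_def assms(1) vcomp_even by (simp add: algebra_simps)
  have 2: "A * tens Z (X + w) \<epsilon> \<epsilon>' + B * tens (- X + 1) V \<epsilon> \<epsilon>'
      = \<alpha> * tens (X + 1) (X + w) \<epsilon> \<epsilon>' + \<beta> * tens (- X + 1) (- X + w) \<epsilon> \<epsilon>'" for \<epsilon> \<epsilon>'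
  proof -
    have "(\<alpha> * vcomp \<epsilon> (X + 1) - A * vcomp \<epsilon> Z) * vcomp \<epsilon>' (X + w)
        = vcomp \<epsilon> (- X + 1) * (B * vcomp \<epsilon>' V - \<beta> * vcomp \<epsilon>' (- X + w))"
      unfolding assms by simp
    then show ?thesis by (simp add: tens_def algebra_simps)
  qed
  show ?thesis
    unfolding exchanged_def using 1 2 by blast
qed

text \<open>The Pluecker relation with the half sums and half differences given explicitly, for ease of instantiation.\<close>

lemma vcomp_plucker_s:
  assumes "y + z = 2 * m1" "y - z = 2 * n1" "x + z = 2 * m2" "x - z = 2 * n2" "x + y = 2 * m3" "x - y = 2 * n3"
  shows "s m1 * s n1 * vcomp \<epsilon> x = s m2 * s n2 * vcomp \<epsilon> y - s m3 * s n3 * vcomp \<epsilon> z"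
proof -
  have "\<kappa> * (s m1 * s n1 * vcomp \<epsilon> x) = \<kappa> * (s m2 * s n2 * vcomp \<epsilon> y - s m3 * s n3 * vcomp \<epsilon> z)"
    using vcomp_plucker[of y z \<epsilon> x] unfolding pdet assms by (simp add: algebra_simps)
  then show ?thesis using \<kappa>_nonzero by simp
qed

text \<open>The product of intertwining vectors along \<open>a, a + 1, a\<close>, where \<open>H\<close> is the height \<open>a\<close>. The scalars of the image are the two face weights
of a square with equal opposite corners, and the three expansions needed are instances of the Pluecker relation.\<close>

lemma exchanged_turn:
  assumes nz: "s H \<noteq> 0" "s (H - u) \<noteq> 0" "s (1 + u - v) \<noteq> 0"
  shows "exchanged (u - v) (tens (H - u) (H + 1 + v))
    (\<lambda>\<epsilon> \<epsilon>'. s (H - (u - v)) * s 1 / (s H * s (1 + (u - v))) * tens (H + 1 + u) (H - v) \<epsilon> \<epsilon>'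
       + s (H + 1) * s (u - v) / (s H * s (1 + (u - v))) * tens (H - 1 - u) (H + v) \<epsilon> \<epsilon>')"
proof -
  define w where "w = u - v"
  define k where "k = s (H - u) * s (1 + w)"
  have k: "k \<noteq> 0" using nz by (simp add: k_def w_def add_diff_eq)
  have 1: "k * vcomp \<epsilon> (H + 1 + v) = s (H - w) * s (1 + u) * vcomp \<epsilon> (H - u + 1 + w)
      - s (H + 1) * s v * vcomp \<epsilon> (- (H - u) + 1 + w)" for \<epsilon>
    using vcomp_plucker_s[of "H - u + 1 + w" "- (H - u) + 1 + w" "1 + w" "H - u" "H + 1 + v" "1 + u" "H - w" "H + 1" v \<epsilon>]
    by (simp add: w_def k_def mult_ac)
  have 2: "s (1 + u) * s H * vcomp \<epsilon> (H - u + 1) = s 1 * s (H - u) * vcomp \<epsilon> (H + 1 + u)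
      + s (H + 1) * s u * vcomp \<epsilon> (- (H - u) + 1)" for \<epsilon>
    using vcomp_plucker_s[of "H + 1 + u" "- (H - u) + 1" "1 + u" H "H - u + 1" 1 "H - u" "H + 1" "- u" \<epsilon>]
    by (simp add: s_odd)
  have 3: "s w * s (H - u) * vcomp \<epsilon> (H + v) = s u * s (H - w) * vcomp \<epsilon> (H - u + w)
      - s H * s v * vcomp \<epsilon> (- (H - u) + w)" for \<epsilon>
    using vcomp_plucker_s[of "- (H - u) + w" "H - u + w" w "- (H - u)" "H + v" H v u "H - w" \<epsilon>] s_odd[of "H - u"]
    by (simp add: w_def algebra_simps)
  have "exchanged w (tens (H - u) (H + 1 + v))
    (\<lambda>\<epsilon> \<epsilon>'. s (H - w) * s 1 / (s H * s (1 + w)) * tens (H + 1 + u) (H - u + w) \<epsilon> \<epsilon>'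
       + s (H + 1) * s w / (s H * s (1 + w)) * tens (- (H - u) + 1) (H + v) \<epsilon> \<epsilon>')"
  proof (rule exchanged_combination[where \<alpha> = "s (H - w) * s (1 + u) / k" and \<beta> = "- s (H + 1) * s v / k"
        and \<gamma> = "s (H - w) * s (H + 1) * s u / (s H * k)"])
    fix \<epsilon>
    show "vcomp \<epsilon> (H + 1 + v) = s (H - w) * s (1 + u) / k * vcomp \<epsilon> (H - u + 1 + w)
        + - s (H + 1) * s v / k * vcomp \<epsilon> (- (H - u) + 1 + w)"
      using 1[of \<epsilon>] k by (simp add: field_simps)
    have "s (H - w) * (s (1 + u) * s H * vcomp \<epsilon> (H - u + 1)) / (s H * k)
       = s (H - w) * (s 1 * s (H - u) * vcomp \<epsilon> (H + 1 + u) + s (H + 1) * s u * vcomp \<epsilon> (- (H - u) + 1)) / (s H * k)"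
      unfolding 2 ..
    then show "s (H - w) * s (1 + u) / k * vcomp \<epsilon> (H - u + 1) - s (H - w) * s 1 / (s H * s (1 + w)) * vcomp \<epsilon> (H + 1 + u)
       = s (H - w) * s (H + 1) * s u / (s H * k) * vcomp \<epsilon> (- (H - u) + 1)"
      using nz(1) k by (simp add: k_def field_simps)
    have "s (H + 1) * (s w * s (H - u) * vcomp \<epsilon> (H + v)) / (s H * k)
        = s (H + 1) * (s u * s (H - w) * vcomp \<epsilon> (H - u + w) - s H * s v * vcomp \<epsilon> (- (H - u) + w)) / (s H * k)"
      unfolding 3 ..
    then show "s (H + 1) * s w / (s H * s (1 + w)) * vcomp \<epsilon> (H + v) - - s (H + 1) * s v / k * vcomp \<epsilon> (- (H - u) + w)
       = s (H - w) * s (H + 1) * s u / (s H * k) * vcomp \<epsilon> (H - u + w)"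
      using nz(1) k by (simp add: k_def field_simps)
  qed
  moreover have "tens (- (H - u) + 1) (H + v) = tens (H - 1 - u) (H + v)"
    using tens_even(1)[of "H - 1 - u" "H + v"] by (simp add: algebra_simps)
  ultimately show ?thesis by (simp add: w_def)
qed

text \<open>The corresponding statement for dual vectors along \<open>g, g + 1, g\<close>. The factors \<open>1 / s\<close> are those that the dual vectors carry at their
lower heights.\<close>

lemma exchanged_dual_turn:
  assumes nz: "s G \<noteq> 0" "s (G + 1) \<noteq> 0" "s (G - 1) \<noteq> 0" "s (G + 1 - u) \<noteq> 0" "s (1 + u - v) \<noteq> 0"
  shows "exchanged (u - v) (\<lambda>\<epsilon> \<epsilon>'. 1 / s (G + 1) * tens (G + 1 - u) (G + v) \<epsilon> \<epsilon>')
    (\<lambda>\<epsilon> \<epsilon>'. s (G - (u - v)) * s 1 / (s G * s (1 + (u - v))) / s (G + 1) * tens (G + u) (G + 1 - v) \<epsilon> \<epsilon>'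
       + s (G - 1) * s (u - v) / (s G * s (1 + (u - v))) / s (G - 1) * tens (G - u) (G - 1 + v) \<epsilon> \<epsilon>')"
proof -
  define w where "w = u - v"
  define X where "X = G + 1 - u"
  define k where "k = s X * s (1 + w)"
  have k: "k \<noteq> 0" using nz by (simp add: k_def X_def w_def add_diff_eq)
  have 1: "k * vcomp \<epsilon> (G + v) = s (G - w) * s u * vcomp \<epsilon> (X + 1 + w)
      - s (G + 1) * s (v - 1) * vcomp \<epsilon> (- X + 1 + w)" for \<epsilon>
    using vcomp_plucker_s[of "X + 1 + w" "- X + 1 + w" "1 + w" X "G + v" u "G - w" "G + 1" "v - 1" \<epsilon>]
    by (simp add: w_def k_def X_def mult_ac)
  have 2: "s u * s G * vcomp \<epsilon> (X + 1) = s 1 * s X * vcomp \<epsilon> (G + u)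
      - s (G + 1) * s (1 - u) * vcomp \<epsilon> (- X + 1)" for \<epsilon>
    using vcomp_plucker_s[of "G + u" "- X + 1" u G "X + 1" 1 X "G + 1" "1 - u" \<epsilon>]
    by (simp add: X_def)
  have 3: "s w * s X * vcomp \<epsilon> (G - 1 + v) = s (u - 1) * s (G - w) * vcomp \<epsilon> (X + w)
      - s G * s (v - 1) * vcomp \<epsilon> (- X + w)" for \<epsilon>
    using vcomp_plucker_s[of "- X + w" "X + w" w "- X" "G - 1 + v" G "v - 1" "u - 1" "G - w" \<epsilon>] s_odd[of X]
    by (simp add: w_def X_def algebra_simps)
  have 4: "s (1 - u) = - s (u - 1)"
    using s_odd[of "u - 1"] by simp
  have "exchanged w (tens X (G + v))
    (\<lambda>\<epsilon> \<epsilon>'. s (G - w) * s 1 / (s G * s (1 + w)) * tens (G + u) (X + w) \<epsilon> \<epsilon>'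
       + s (G + 1) * s w / (s G * s (1 + w)) * tens (- X + 1) (G - 1 + v) \<epsilon> \<epsilon>')"
  proof (rule exchanged_combination[where \<alpha> = "s (G - w) * s u / k" and \<beta> = "- s (G + 1) * s (v - 1) / k"
        and \<gamma> = "s (G - w) * s (G + 1) * s (u - 1) / (s G * k)"])
    fix \<epsilon>
    show "vcomp \<epsilon> (G + v) = s (G - w) * s u / k * vcomp \<epsilon> (X + 1 + w)
        + - s (G + 1) * s (v - 1) / k * vcomp \<epsilon> (- X + 1 + w)"
      using 1[of \<epsilon>] k by (simp add: field_simps)
    have "s (G - w) * (s u * s G * vcomp \<epsilon> (X + 1)) / (s G * k)
       = s (G - w) * (s 1 * s X * vcomp \<epsilon> (G + u) + s (G + 1) * s (u - 1) * vcomp \<epsilon> (- X + 1)) / (s G * k)"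
      unfolding 2 4 by simp
    then show "s (G - w) * s u / k * vcomp \<epsilon> (X + 1) - s (G - w) * s 1 / (s G * s (1 + w)) * vcomp \<epsilon> (G + u)
       = s (G - w) * s (G + 1) * s (u - 1) / (s G * k) * vcomp \<epsilon> (- X + 1)"
      using nz(1) k by (simp add: k_def field_simps)
    have "s (G + 1) * (s w * s X * vcomp \<epsilon> (G - 1 + v)) / (s G * k)
        = s (G + 1) * (s (u - 1) * s (G - w) * vcomp \<epsilon> (X + w) - s G * s (v - 1) * vcomp \<epsilon> (- X + w)) / (s G * k)"
      unfolding 3 ..
    then show "s (G + 1) * s w / (s G * s (1 + w)) * vcomp \<epsilon> (G - 1 + v) - - s (G + 1) * s (v - 1) / k * vcomp \<epsilon> (- X + w)
       = s (G - w) * s (G + 1) * s (u - 1) / (s G * k) * vcomp \<epsilon> (X + w)"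
      using nz(1) k by (simp add: k_def field_simps)
  qed
  from exchanged_scale[OF this, of "1 / s (G + 1)"]
  have "exchanged w (\<lambda>\<epsilon> \<epsilon>'. 1 / s (G + 1) * tens X (G + v) \<epsilon> \<epsilon>')
    (\<lambda>\<epsilon> \<epsilon>'. s (G - w) * s 1 / (s G * s (1 + w)) / s (G + 1) * tens (G + u) (X + w) \<epsilon> \<epsilon>'
       + s (G - 1) * s w / (s G * s (1 + w)) / s (G - 1) * tens (- X + 1) (G - 1 + v) \<epsilon> \<epsilon>')"
    using nz(2,3) by (simp add: distrib_left mult_ac)
  moreover have "tens (- X + 1) (G - 1 + v) = tens (G - u) (G - 1 + v)"
    using tens_even(1)[of "G - u" "G - 1 + v"] by (simp add: X_def algebra_simps)
  ultimately show ?thesis using nz(3) by (simp add: w_def X_def add_diff_eq)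
qed

lemma tens_cong:
  assumes "x = x' \<or> x = - x'" "y = y' \<or> y = - y'"
  shows "tens x y = tens x' y'"
  using assms by (auto simp: tens_even)

lemma s_flip: "x = - y \<Longrightarrow> s x = - s y"
  by (simp add: s_odd)

text \<open>Both directions of the first step are covered by \<open>\<sigma> = \<plusminus> 1\<close>: reflecting all heights reduces \<open>\<sigma> = - 1\<close> to \<open>\<sigma> = 1\<close>.\<close>

lemma exchanged_turn_signed:
  fixes \<sigma> :: complex
  assumes "\<sigma> = 1 \<or> \<sigma> = -1" and nz: "s h \<noteq> 0" "s (h - \<sigma> * u) \<noteq> 0" "s (1 + u - v) \<noteq> 0"
  shows "exchanged (u - v) (tens (h - \<sigma> * u) (h + \<sigma> + \<sigma> * v))
    (\<lambda>\<epsilon> \<epsilon>'. s (h - \<sigma> * (u - v)) * s 1 / (s h * s (1 + (u - v))) * tens (h + \<sigma> + \<sigma> * u) (h - \<sigma> * v) \<epsilon> \<epsilon>'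
       + s (h + \<sigma>) * s (u - v) / (s h * s (1 + (u - v))) * tens (h - \<sigma> - \<sigma> * u) (h + \<sigma> * v) \<epsilon> \<epsilon>')"
  using assms(1)
proof
  assume "\<sigma> = 1"
  then show ?thesis using exchanged_turn[of h u v] nz by simp
next
  assume \<sigma>: "\<sigma> = -1"
  have t: "tens (- h - u) (- h + 1 + v) = tens (h - \<sigma> * u) (h + \<sigma> + \<sigma> * v)"
      "tens (- h + 1 + u) (- h - v) = tens (h + \<sigma> + \<sigma> * u) (h - \<sigma> * v)"
      "tens (- h - 1 - u) (- h + v) = tens (h - \<sigma> - \<sigma> * u) (h + \<sigma> * v)"
    by (rule tens_cong; simp add: \<sigma>)+
  have e: "s (- h - (u - v)) = - s (h - \<sigma> * (u - v))" "s (- h + 1) = - s (h + \<sigma>)"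
      "s (- h) = - s h" "s (- h - u) = - s (h - \<sigma> * u)"
    by (rule s_flip; simp add: \<sigma>)+
  have "s (- h) \<noteq> 0" "s (- h - u) \<noteq> 0" using nz by (simp_all add: e)
  from exchanged_turn[OF this nz(3)] show ?thesis
    unfolding t e by simp
qed

lemma exchanged_dual_turn_signed:
  fixes \<sigma> :: complex
  assumes "\<sigma> = 1 \<or> \<sigma> = -1"
    and nz: "s h \<noteq> 0" "s (h + \<sigma>) \<noteq> 0" "s (h - \<sigma>) \<noteq> 0" "s (h + \<sigma> - \<sigma> * u) \<noteq> 0" "s (1 + u - v) \<noteq> 0"
  shows "exchanged (u - v) (\<lambda>\<epsilon> \<epsilon>'. 1 / s (h + \<sigma>) * tens (h + \<sigma> - \<sigma> * u) (h + \<sigma> * v) \<epsilon> \<epsilon>')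
    (\<lambda>\<epsilon> \<epsilon>'. s (h - \<sigma> * (u - v)) * s 1 / (s h * s (1 + (u - v))) / s (h + \<sigma>) * tens (h + \<sigma> * u) (h + \<sigma> - \<sigma> * v) \<epsilon> \<epsilon>'
       + s (h - \<sigma>) * s (u - v) / (s h * s (1 + (u - v))) / s (h - \<sigma>) * tens (h - \<sigma> * u) (h - \<sigma> + \<sigma> * v) \<epsilon> \<epsilon>')"
  using assms(1)
proof
  assume "\<sigma> = 1"
  then show ?thesis using exchanged_dual_turn[of h u v] nz by simp
next
  assume \<sigma>: "\<sigma> = -1"
  have t: "tens (- h + 1 - u) (- h + v) = tens (h + \<sigma> - \<sigma> * u) (h + \<sigma> * v)"
      "tens (- h + u) (- h + 1 - v) = tens (h + \<sigma> * u) (h + \<sigma> - \<sigma> * v)"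
      "tens (- h - u) (- h - 1 + v) = tens (h - \<sigma> * u) (h - \<sigma> + \<sigma> * v)"
    by (rule tens_cong; simp add: \<sigma>)+
  have e: "s (- h - (u - v)) = - s (h - \<sigma> * (u - v))" "s (- h + 1) = - s (h + \<sigma>)"
      "s (- h - 1) = - s (h - \<sigma>)" "s (- h) = - s h" "s (- h + 1 - u) = - s (h + \<sigma> - \<sigma> * u)"
    by (rule s_flip; simp add: \<sigma>)+
  have "s (- h) \<noteq> 0" "s (- h + 1) \<noteq> 0" "s (- h - 1) \<noteq> 0" "s (- h + 1 - u) \<noteq> 0"
    unfolding e using nz by simp_all
  from exchanged_scale[OF exchanged_dual_turn[OF this nz(5)], of "- 1"] show ?thesis
    unfolding t e using nz(3) by (simp add: add.commute)
qed

text \<open>The face weights without the factor \<open>R0\<close>, and below the intertwining vectors and the \<open>L\<close>-matrix, with all heights displaced by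
\<open>\<xi>\<close>. For generic \<open>\<xi>\<close> no bracket of a height vanishes.\<close>

definition weight :: "complex \<Rightarrow> int \<Rightarrow> int \<Rightarrow> int \<Rightarrow> int \<Rightarrow> complex \<Rightarrow> complex" where
  "weight \<xi> a b d c u =
     (if \<not> face_adjacent a b d c then 0
      else if c \<noteq> a then 1
      else if d = b then s (of_int a + \<xi> - of_int (b - a) * u) * s 1 / (s (of_int a + \<xi>) * s (1 + u))
      else s (of_int b + \<xi>) * s u / (s (of_int a + \<xi>) * s (1 + u)))"

definition ivec :: "complex \<Rightarrow> int \<Rightarrow> complex \<Rightarrow> int \<Rightarrow> int \<Rightarrow> complex" where
  "ivec \<xi> \<epsilon> u a b = vcomp \<epsilon> (of_int (a - b) * u + of_int a + \<xi>)"

definition dvec :: "complex \<Rightarrow> int \<Rightarrow> complex \<Rightarrow> int \<Rightarrow> int \<Rightarrow> complex" where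
  "dvec \<xi> \<epsilon> u a b = - of_int \<epsilon> * (of_int (a - b) / (2 * s (of_int b + \<xi>) * s u)) * cc * ivec \<xi> (- \<epsilon>) (u - 1) a b"

definition lmat :: "complex \<Rightarrow> int \<Rightarrow> int \<Rightarrow> int \<Rightarrow> int \<Rightarrow> complex \<Rightarrow> complex" where
  "lmat \<xi> a b c d u = (if b \<in> nbrs a \<and> d \<in> nbrs c then
     dvec \<xi> 1 u d c * ivec \<xi> 1 u a b + dvec \<xi> (-1) u d c * ivec \<xi> (-1) u a b else 0)"

text \<open>The last two conditions concern the denominators in the expansions of \<open>exchanged_turn\<close> and \<open>exchanged_dual_turn\<close>; they do not occur in the
weights themselves.\<close>

definition generic :: "complex \<Rightarrow> complex \<Rightarrow> complex \<Rightarrow> bool" where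
  "generic \<xi> u v \<longleftrightarrow> (\<forall>n :: int. s (of_int n + \<xi>) \<noteq> 0 \<and> s (u - v + of_int n) \<noteq> 0 \<and>
     s (of_int n + \<xi> - u) \<noteq> 0 \<and> s (of_int n + \<xi> + u) \<noteq> 0)"

text \<open>The vertex-face correspondence. For a straight path \<open>a, a \<plusminus> 1, a \<plusminus> 2\<close> the product is itself a basic tensor.\<close>

lemma ivec_exchanged:
  assumes g: "generic \<xi> u v" and ab: "b \<in> nbrs a" and bc: "c \<in> nbrs b"
  shows "exchanged (u - v) (\<lambda>\<epsilon> \<epsilon>'. ivec \<xi> \<epsilon> u a b * ivec \<xi> \<epsilon>' v b c)
    (\<lambda>\<epsilon> \<epsilon>'. \<Sum>d\<in>nbrs a. weight \<xi> a b d c (u - v) * (ivec \<xi> \<epsilon> u d c * ivec \<xi> \<epsilon>' v a d))"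
proof -
  define h where "h = of_int a + \<xi>"
  define \<sigma> :: int where "\<sigma> = b - a"
  have \<sigma>: "\<sigma> = 1 \<or> \<sigma> = -1" using ab by (auto simp: \<sigma>_def nbrs_def)
  have b: "b = a + \<sigma>" by (simp add: \<sigma>_def)
  have c: "c = a \<or> c = a + 2 * \<sigma>" using bc \<sigma> by (auto simp: b nbrs_def)
  have d: "2 * a - b = a - \<sigma>" by (simp add: b)
  have gn: "s h \<noteq> 0" "s (h - of_int \<sigma> * u) \<noteq> 0" "s (1 + u - v) \<noteq> 0"
    using g[unfolded generic_def, rule_format, of a] g[unfolded generic_def, rule_format, of 1] \<sigma>
    by (auto simp: h_def algebra_simps)
  have \<sigma>': "(of_int \<sigma> :: complex) = 1 \<or> (of_int \<sigma> :: complex) = -1" using \<sigma> by auto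
  from c show ?thesis
  proof
    assume c: "c = a"
    have "face_adjacent a b b a" "face_adjacent a b (a - \<sigma>) a" "a - \<sigma> \<noteq> b"
      using \<sigma> by (auto simp: face_adjacent_def b)
    then have w: "weight \<xi> a b b a (u - v) = s (h - of_int \<sigma> * (u - v)) * s 1 / (s h * s (1 + (u - v)))"
        "weight \<xi> a b (a - \<sigma>) a (u - v) = s (h + of_int \<sigma>) * s (u - v) / (s h * s (1 + (u - v)))"
      by (simp_all add: weight_def h_def b algebra_simps)
    from exchanged_turn_signed[OF \<sigma>' gn] show ?thesis
      unfolding sum_nbrs[OF ab] c d w by (simp add: ivec_def tens_def b h_def algebra_simps)
  next
    assume c: "c = a + 2 * \<sigma>"
    have w: "weight \<xi> a b b c (u - v) = 1" "weight \<xi> a b (a - \<sigma>) c (u - v) = 0"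
      using \<sigma> by (auto simp: weight_def face_adjacent_def b c)
    have "of_int \<sigma> * of_int \<sigma> = (1 :: complex)" using \<sigma> by auto
    then have \<sigma>\<sigma>: "of_int \<sigma> * (of_int \<sigma> * x) = x" for x :: complex
      by (simp flip: mult.assoc)
    have *: "tens (of_int \<sigma> * x) (of_int \<sigma> * y) = tens x y" for x y
      using \<sigma> by (auto simp: tens_even)
    from exchanged_tens[of "u - v" "of_int \<sigma> * h - u"]
    have "exchanged (u - v) (tens (of_int \<sigma> * (of_int \<sigma> * h - u)) (of_int \<sigma> * (of_int \<sigma> * h - u + 1 + (u - v))))
        (tens (of_int \<sigma> * (of_int \<sigma> * h - u + 1)) (of_int \<sigma> * (of_int \<sigma> * h - u + (u - v))))"
      unfolding * .
    then show ?thesis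
      unfolding sum_nbrs[OF ab] d w
      by (simp add: ivec_def tens_def b c h_def distrib_left right_diff_distrib \<sigma>\<sigma>) (simp add: algebra_simps)
  qed
qed

text \<open>The part of \<open>dvec\<close> that depends on the heights. The sign \<open>\<epsilon>\<close> and the exchange of \<open>\<epsilon>\<close> and \<open>- \<epsilon>\<close> are absorbed by \<open>pairing\<close>.\<close>

definition dual_vec :: "complex \<Rightarrow> int \<Rightarrow> complex \<Rightarrow> int \<Rightarrow> int \<Rightarrow> complex" where
  "dual_vec \<xi> \<epsilon> u a b = of_int (a - b) / s (of_int b + \<xi>) * vcomp \<epsilon> (of_int (a - b) * u + of_int b + \<xi>)"

lemma dvec_eq: "dvec \<xi> \<epsilon> u a b = - of_int \<epsilon> * (cc / (2 * s u)) * dual_vec \<xi> (- \<epsilon>) u a b"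
proof -
  have "of_int (a - b) * (u - 1) + of_int a + \<xi> = of_int (a - b) * u + of_int b + \<xi>"
    by (simp add: algebra_simps)
  then show ?thesis by (simp add: dvec_def dual_vec_def ivec_def mult_ac)
qed

lemma dual_vec_exchanged:
  assumes g: "generic \<xi> u v" and gf: "f \<in> nbrs g" and fe: "e \<in> nbrs f"
  shows "exchanged (u - v) (\<lambda>\<epsilon> \<epsilon>'. dual_vec \<xi> \<epsilon> u e f * dual_vec \<xi> \<epsilon>' v f g)
    (\<lambda>\<epsilon> \<epsilon>'. \<Sum>d\<in>nbrs g. weight \<xi> g d f e (u - v) * (dual_vec \<xi> \<epsilon> u d g * dual_vec \<xi> \<epsilon>' v e d))"
proof -
  define h where "h = of_int g + \<xi>"
  define \<sigma> :: int where "\<sigma> = f - g"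
  have \<sigma>: "\<sigma> = 1 \<or> \<sigma> = -1" using gf by (auto simp: \<sigma>_def nbrs_def)
  have f: "f = g + \<sigma>" by (simp add: \<sigma>_def)
  have e: "e = g \<or> e = g + 2 * \<sigma>" using fe \<sigma> by (auto simp: f nbrs_def)
  have d: "2 * g - f = g - \<sigma>" by (simp add: f)
  have gn: "s h \<noteq> 0" "s (h + of_int \<sigma>) \<noteq> 0" "s (h - of_int \<sigma>) \<noteq> 0"
     "s (h + of_int \<sigma> - of_int \<sigma> * u) \<noteq> 0" "s (1 + u - v) \<noteq> 0"
    using g[unfolded generic_def, rule_format, of g] g[unfolded generic_def, rule_format, of "g + 1"]
      g[unfolded generic_def, rule_format, of "g - 1"] g[unfolded generic_def, rule_format, of 1] \<sigma>
    by (auto simp: h_def algebra_simps)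
  have \<sigma>': "(of_int \<sigma> :: complex) = 1 \<or> (of_int \<sigma> :: complex) = -1" using \<sigma> by auto
  have sq: "of_int \<sigma> * of_int \<sigma> = (1 :: complex)" using \<sigma> by auto
  then have \<sigma>\<sigma>: "of_int \<sigma> * (of_int \<sigma> * x) = x" for x :: complex
    by (simp flip: mult.assoc)
  from e show ?thesis
  proof
    assume e: "e = g"
    have "face_adjacent g f f g" "face_adjacent g (g - \<sigma>) f g" "g - \<sigma> \<noteq> f"
      using \<sigma> by (auto simp: face_adjacent_def f)
    then have w: "weight \<xi> g f f g (u - v) = s (h - of_int \<sigma> * (u - v)) * s 1 / (s h * s (1 + (u - v)))"
        "weight \<xi> g (g - \<sigma>) f g (u - v) = s (h - of_int \<sigma>) * s (u - v) / (s h * s (1 + (u - v)))"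
      by (simp_all add: weight_def h_def f algebra_simps)
    have v: "dual_vec \<xi> \<epsilon> u g f * dual_vec \<xi> \<epsilon>' v f g
          = - 1 / s h * (1 / s (h + of_int \<sigma>) * tens (h + of_int \<sigma> - of_int \<sigma> * u) (h + of_int \<sigma> * v) \<epsilon> \<epsilon>')"
        "dual_vec \<xi> \<epsilon> u f g * dual_vec \<xi> \<epsilon>' v g f
          = - 1 / s h * (1 / s (h + of_int \<sigma>) * tens (h + of_int \<sigma> * u) (h + of_int \<sigma> - of_int \<sigma> * v) \<epsilon> \<epsilon>')"
        "dual_vec \<xi> \<epsilon> u (g - \<sigma>) g * dual_vec \<xi> \<epsilon>' v g (g - \<sigma>)
          = - 1 / s h * (1 / s (h - of_int \<sigma>) * tens (h - of_int \<sigma> * u) (h - of_int \<sigma> + of_int \<sigma> * v) \<epsilon> \<epsilon>')"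
      for \<epsilon> \<epsilon>'
      by (simp_all add: dual_vec_def tens_def f h_def \<sigma>\<sigma> algebra_simps)
    from exchanged_scale[OF exchanged_dual_turn_signed[OF \<sigma>' gn], of "- 1 / s h"] show ?thesis
      unfolding sum_nbrs[OF gf] e d w v using gn by (simp add: distrib_left mult_ac)
  next
    assume e: "e = g + 2 * \<sigma>"
    have w: "weight \<xi> g f f e (u - v) = 1" "weight \<xi> g (g - \<sigma>) f e (u - v) = 0"
      using \<sigma> by (auto simp: weight_def face_adjacent_def f e)
    have *: "tens (- of_int \<sigma> * x) (- of_int \<sigma> * y) = tens x y" for x y
      using \<sigma> by (auto simp: tens_even)
    define k where "k = 1 / (s h * s (h + of_int \<sigma>))"
    from exchanged_scale[OF exchanged_tens[of "u - v" "- of_int \<sigma> * h - u - 1"], of k]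
    have "exchanged (u - v)
       (\<lambda>\<epsilon> \<epsilon>'. k * tens (- of_int \<sigma> * (- of_int \<sigma> * h - u - 1)) (- of_int \<sigma> * (- of_int \<sigma> * h - u - 1 + 1 + (u - v))) \<epsilon> \<epsilon>')
       (\<lambda>\<epsilon> \<epsilon>'. k * tens (- of_int \<sigma> * (- of_int \<sigma> * h - u - 1 + 1)) (- of_int \<sigma> * (- of_int \<sigma> * h - u - 1 + (u - v))) \<epsilon> \<epsilon>')"
      unfolding * .
    moreover have
      "- of_int \<sigma> * (- of_int \<sigma> * h - u - 1) = h + of_int \<sigma> + of_int \<sigma> * u"
      "- of_int \<sigma> * (- of_int \<sigma> * h - u - 1 + 1 + (u - v)) = h + of_int \<sigma> * v"
      "- of_int \<sigma> * (- of_int \<sigma> * h - u - 1 + 1) = h + of_int \<sigma> * u"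
      "- of_int \<sigma> * (- of_int \<sigma> * h - u - 1 + (u - v)) = h + of_int \<sigma> + of_int \<sigma> * v"
      by (simp_all add: algebra_simps \<sigma>\<sigma> sq)
    ultimately have "exchanged (u - v)
       (\<lambda>\<epsilon> \<epsilon>'. k * tens (h + of_int \<sigma> + of_int \<sigma> * u) (h + of_int \<sigma> * v) \<epsilon> \<epsilon>')
       (\<lambda>\<epsilon> \<epsilon>'. k * tens (h + of_int \<sigma> * u) (h + of_int \<sigma> + of_int \<sigma> * v) \<epsilon> \<epsilon>')"
      by (simp only:)
    moreover have
      "dual_vec \<xi> \<epsilon> u e f * dual_vec \<xi> \<epsilon>' v f g = k * tens (h + of_int \<sigma> + of_int \<sigma> * u) (h + of_int \<sigma> * v) \<epsilon> \<epsilon>'"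
      "dual_vec \<xi> \<epsilon> u f g * dual_vec \<xi> \<epsilon>' v e f = k * tens (h + of_int \<sigma> * u) (h + of_int \<sigma> + of_int \<sigma> * v) \<epsilon> \<epsilon>'"
      for \<epsilon> \<epsilon>'
      by (simp_all add: dual_vec_def tens_def f e h_def k_def \<sigma>\<sigma> algebra_simps)
    ultimately show ?thesis
      unfolding sum_nbrs[OF gf] d w by simp
  qed
qed

lemma lmat_pairing:
  assumes "b \<in> nbrs a" "d \<in> nbrs c" "b' \<in> nbrs a'" "d' \<in> nbrs c'"
  shows "lmat \<xi> a b c d u * lmat \<xi> a' b' c' d' v = (cc / (2 * s u)) * (cc / (2 * s v)) *
    pairing (\<lambda>\<epsilon> \<epsilon>'. dual_vec \<xi> \<epsilon> u d c * dual_vec \<xi> \<epsilon>' v d' c') (\<lambda>\<epsilon> \<epsilon>'. ivec \<xi> \<epsilon> u a b * ivec \<xi> \<epsilon>' v a' b')"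
  using assms by (simp add: lmat_def dvec_eq pairing_def algebra_simps)

lemma pairing_sum:
  "pairing (\<lambda>\<epsilon> \<epsilon>'. \<Sum>d\<in>A. k d * S d \<epsilon> \<epsilon>') T = (\<Sum>d\<in>A. k d * pairing (S d) T)"
  "pairing T (\<lambda>\<epsilon> \<epsilon>'. \<Sum>d\<in>A. k d * S d \<epsilon> \<epsilon>') = (\<Sum>d\<in>A. k d * pairing T (S d))"
  by (simp_all add: pairing_def sum_distrib_left sum_distrib_right algebra_simps sum.distrib sum_subtractf)

lemma weight_supp: "weight \<xi> a b d c u \<noteq> 0 \<Longrightarrow> b \<in> nbrs a \<and> c \<in> nbrs b \<and> d \<in> nbrs a \<and> c \<in> nbrs d"
  by (auto simp: weight_def face_adjacent_def in_nbrs_iff split: if_splits)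

lemma lmat_supp: "lmat \<xi> a b c d u \<noteq> 0 \<Longrightarrow> b \<in> nbrs a \<and> d \<in> nbrs c"
  by (auto simp: lmat_def split: if_splits)

text \<open>Both sides are a multiple of a pairing. On the left the face weight acts on the intertwining vectors and on the right on
the dual vectors, so the self-adjointness in \<open>exchanged_pairing\<close> applies.\<close>

lemma local_exchange:
  assumes g: "generic \<xi> u v"
  shows "(\<Sum>d\<in>nbrs a. weight \<xi> a b d c (u - v) * lmat \<xi> d c f e u * lmat \<xi> a d g f v)
       = (\<Sum>d\<in>nbrs g. lmat \<xi> a b g d u * lmat \<xi> b c d e v * weight \<xi> g d f e (u - v))"
    (is "?L = ?R")
proof (cases "b \<in> nbrs a \<and> c \<in> nbrs b \<and> f \<in> nbrs g \<and> e \<in> nbrs f")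
  case True
  define k where "k = (cc / (2 * s u)) * (cc / (2 * s v))"
  define S where "S = (\<lambda>\<epsilon> \<epsilon>'. ivec \<xi> \<epsilon> u a b * ivec \<xi> \<epsilon>' v b c)"
  define S' where "S' = (\<lambda>\<epsilon> \<epsilon>'. dual_vec \<xi> \<epsilon> u e f * dual_vec \<xi> \<epsilon>' v f g)"
  have "?L = (\<Sum>d\<in>nbrs a. k * (weight \<xi> a b d c (u - v) *
      pairing S' (\<lambda>\<epsilon> \<epsilon>'. ivec \<xi> \<epsilon> u d c * ivec \<xi> \<epsilon>' v a d)))"
  proof (rule sum.cong[OF refl])
    fix d assume "d \<in> nbrs a"
    show "weight \<xi> a b d c (u - v) * lmat \<xi> d c f e u * lmat \<xi> a d g f v = k * (weight \<xi> a b d c (u - v) *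
      pairing S' (\<lambda>\<epsilon> \<epsilon>'. ivec \<xi> \<epsilon> u d c * ivec \<xi> \<epsilon>' v a d))"
    proof (cases "weight \<xi> a b d c (u - v) = 0")
      case False
      with weight_supp have "c \<in> nbrs d" by blast
      with lmat_pairing[of c d e f d a f g \<xi> u v] True \<open>d \<in> nbrs a\<close> show ?thesis
        by (simp add: k_def S'_def mult_ac)
    qed simp
  qed
  also have "\<dots> = k * pairing S' (\<lambda>\<epsilon> \<epsilon>'. \<Sum>d\<in>nbrs a. weight \<xi> a b d c (u - v) * (ivec \<xi> \<epsilon> u d c * ivec \<xi> \<epsilon>' v a d))"
    by (simp only: pairing_sum sum_distrib_left)
  also have "\<dots> = k * pairing (\<lambda>\<epsilon> \<epsilon>'. \<Sum>d\<in>nbrs g. weight \<xi> g d f e (u - v) * (dual_vec \<xi> \<epsilon> u d g * dual_vec \<xi> \<epsilon>' v e d)) S"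
    using exchanged_pairing[OF dual_vec_exchanged[OF g, of f g e] ivec_exchanged[OF g, of b a c]] True
    by (simp add: S_def S'_def)
  also have "\<dots> = (\<Sum>d\<in>nbrs g. k * (weight \<xi> g d f e (u - v) *
      pairing (\<lambda>\<epsilon> \<epsilon>'. dual_vec \<xi> \<epsilon> u d g * dual_vec \<xi> \<epsilon>' v e d) S))"
    by (simp only: pairing_sum sum_distrib_left)
  also have "\<dots> = ?R"
  proof (rule sum.cong[OF refl])
    fix d assume "d \<in> nbrs g"
    show "k * (weight \<xi> g d f e (u - v) * pairing (\<lambda>\<epsilon> \<epsilon>'. dual_vec \<xi> \<epsilon> u d g * dual_vec \<xi> \<epsilon>' v e d) S)
      = lmat \<xi> a b g d u * lmat \<xi> b c d e v * weight \<xi> g d f e (u - v)"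
    proof (cases "weight \<xi> g d f e (u - v) = 0")
      case False
      with weight_supp have "e \<in> nbrs d" by blast
      with lmat_pairing[of b a d g c b e d \<xi> u v] True \<open>d \<in> nbrs g\<close> show ?thesis
        by (simp add: k_def S_def mult_ac)
    qed simp
  qed
  finally show ?thesis .
next
  case False
  have "weight \<xi> a b d c (u - v) = 0 \<or> lmat \<xi> d c f e u = 0 \<or> lmat \<xi> a d g f v = 0" for d
    using False weight_supp[of \<xi> a b d c "u - v"] lmat_supp[of \<xi> d c f e u] lmat_supp[of \<xi> a d g f v] by blast
  then have "?L = 0"
    by (intro sum.neutral) auto
  moreover have "lmat \<xi> a b g d u = 0 \<or> lmat \<xi> b c d e v = 0 \<or> weight \<xi> g d f e (u - v) = 0" for d
    using False weight_supp[of \<xi> g d f e "u - v"] lmat_supp[of \<xi> a b g d u] lmat_supp[of \<xi> b c d e v] by blast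
  then have "?R = 0"
    by (intro sum.neutral) auto
  ultimately show ?thesis by simp
qed

section \<open>Flips of the local weights\<close>

lemma
  assumes "\<sigma> = 1 \<or> \<sigma> = -1"
  shows weight_turn_same: "weight \<xi> a (a + \<sigma>) (a + \<sigma>) a u =
      s (of_int a + \<xi> - of_int \<sigma> * u) * s 1 / (s (of_int a + \<xi>) * s (1 + u))"
    and weight_turn_diff: "weight \<xi> a (a + \<sigma>) (a - \<sigma>) a u =
      s (of_int a + \<xi> + of_int \<sigma>) * s u / (s (of_int a + \<xi>) * s (1 + u))"
    and weight_straight: "weight \<xi> a (a + \<sigma>) (a + \<sigma>) (a + 2 * \<sigma>) u = 1"
  using assms by (auto simp: weight_def face_adjacent_def algebra_simps)

lemma weight_eq_0: "\<not> face_adjacent a b d c \<Longrightarrow> weight \<xi> a b d c u = 0"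
  by (simp add: weight_def)

lemma three_term_fractions:
  fixes H :: complex
  assumes "H \<noteq> 0" "D1 \<noteq> 0" "D2 \<noteq> 0" "Hp \<noteq> 0" and tt: "Hm * D1 * (D1 * Hp) = N1 * N2 + H * U * (H * D2)"
  shows "N1 / (H * D2) * (N2 / (Hp * D1)) + H * U / (Hp * D1) = Hm * D1 / (H * D2)"
proof -
  have "N1 / (H * D2) * (N2 / (Hp * D1)) + H * U / (Hp * D1)
      = (N1 * N2 + H * U * (H * D2)) / ((H * D2) * (Hp * D1))"
    using assms(1-4) by (simp add: add_divide_distrib)
  also have "\<dots> = Hm * D1 / (H * D2)"
    unfolding tt[symmetric] using assms(1-4) by simp
  finally show ?thesis .
qed

text \<open>With \<open>c\<close> the bottom right height, \<open>c = a + \<sigma>\<close> is the three-term identity and \<open>c = a - \<sigma>\<close> a comparison of two single products.\<close>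

lemma weight_flip:
  assumes g: "\<And>n :: int. s (of_int n + \<xi>) \<noteq> 0" "\<And>n :: int. s (u + of_int n) \<noteq> 0"
    and \<sigma>: "\<sigma> = 1 \<or> \<sigma> = -1"
  shows "(\<Sum>y\<in>nbrs (a + \<sigma>). weight \<xi> a (a + \<sigma>) (a + \<sigma>) y (u + 1) * weight \<xi> (a + \<sigma>) a y c u) =
      (\<Sum>y\<in>nbrs (a + \<sigma>). weight \<xi> a (a - \<sigma>) (a + \<sigma>) y (u + 1) * weight \<xi> (a - \<sigma>) a y c u)"
proof -
  define h where "h = of_int a + \<xi>"
  define \<rho> :: complex where "\<rho> = of_int \<sigma>"
  have \<rho>: "\<rho> = 1 \<or> \<rho> = -1" using \<sigma> by (auto simp: \<rho>_def)
  have nz: "s h \<noteq> 0" "s (h + \<rho>) \<noteq> 0" "s (h - \<rho>) \<noteq> 0" "s (1 + u) \<noteq> 0" "s (2 + u) \<noteq> 0"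
    using g(1)[of a] g(1)[of "a + \<sigma>"] g(1)[of "a - \<sigma>"] g(2)[of 1] g(2)[of 2]
    by (simp_all add: h_def \<rho>_def algebra_simps)
  have sum: "(\<Sum>y\<in>nbrs (a + \<sigma>). f y) = f a + f (a + 2 * \<sigma>)" for f :: "int \<Rightarrow> complex"
    using sum_nbrs[of a "a + \<sigma>" f] \<sigma> by (auto simp: nbrs_def algebra_simps)
  have n\<sigma>: "- \<sigma> = 1 \<or> - \<sigma> = -1" using \<sigma> by auto
  have w1: "weight \<xi> a (a + \<sigma>) (a + \<sigma>) a (u + 1) = s (h - \<rho> * (u + 1)) * s 1 / (s h * s (2 + u))"
    using weight_turn_same[OF \<sigma>, of \<xi> a "u + 1"] by (simp add: h_def \<rho>_def algebra_simps)
  have w2: "weight \<xi> a (a + \<sigma>) (a + \<sigma>) (a + 2 * \<sigma>) (u + 1) = 1"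
    by (rule weight_straight[OF \<sigma>])
  have w3: "weight \<xi> a (a - \<sigma>) (a + \<sigma>) a (u + 1) = s (h - \<rho>) * s (u + 1) / (s h * s (2 + u))"
    using weight_turn_diff[OF n\<sigma>, of \<xi> a "u + 1"] by (simp add: h_def \<rho>_def algebra_simps)
  have w4: "weight \<xi> a (a - \<sigma>) (a + \<sigma>) (a + 2 * \<sigma>) (u + 1) = 0"
    using \<sigma> by (intro weight_eq_0) (auto simp: face_adjacent_def)
  have "c = a + \<sigma> \<or> c = a - \<sigma> \<or> c \<notin> nbrs a"
    using \<sigma> by (auto simp: nbrs_def)
  then consider "c = a + \<sigma>" | "c = a - \<sigma>" | "c \<notin> nbrs a"
    by blast
  then show ?thesis
  proof cases
    case 1
    have tt: "s (h - \<rho>) * s (1 + u) * (s (1 + u) * s (h + \<rho>))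
        = s (h - \<rho> * (u + 1)) * s 1 * (s (h + \<rho> * (1 + u)) * s 1) + s h * s u * (s h * s (2 + u))"
      using three_term[of h 1 "1 + u" 0] \<rho> s_odd[of "1 - u"] s_odd[of u] by (auto simp: algebra_simps)
    have w5: "weight \<xi> (a + \<sigma>) a a (a + \<sigma>) u = s (h + \<rho> * (1 + u)) * s 1 / (s (h + \<rho>) * s (1 + u))"
      using weight_turn_same[OF n\<sigma>, of \<xi> "a + \<sigma>"] by (simp add: h_def \<rho>_def algebra_simps)
    have w6: "weight \<xi> (a + \<sigma>) a (a + 2 * \<sigma>) (a + \<sigma>) u = s h * s u / (s (h + \<rho>) * s (1 + u))"
      using weight_turn_diff[OF n\<sigma>, of \<xi> "a + \<sigma>"] by (simp add: h_def \<rho>_def algebra_simps)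
    have w7: "weight \<xi> (a - \<sigma>) a a (a + \<sigma>) u = 1"
      using weight_straight[OF \<sigma>, of \<xi> "a - \<sigma>"] by (simp add: algebra_simps)
    show ?thesis
      unfolding sum 1 w1 w2 w3 w4 w5 w6 w7 using three_term_fractions[OF nz(1,4,5,2) tt] by (simp add: add.commute)
  next
    case 2
    have w5: "weight \<xi> (a + \<sigma>) a a (a - \<sigma>) u = 1"
      using weight_straight[OF n\<sigma>, of \<xi> "a + \<sigma>"] by (simp add: algebra_simps)
    have w6: "weight \<xi> (a + \<sigma>) a (a + 2 * \<sigma>) (a - \<sigma>) u = 0"
      using \<sigma> by (intro weight_eq_0) (auto simp: face_adjacent_def)
    have w7: "weight \<xi> (a - \<sigma>) a a (a - \<sigma>) u = s (h - \<rho> * (u + 1)) * s 1 / (s (h - \<rho>) * s (1 + u))"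
      using weight_turn_same[OF \<sigma>, of \<xi> "a - \<sigma>"] by (simp add: h_def \<rho>_def algebra_simps)
    show ?thesis
      unfolding sum 2 w1 w2 w3 w4 w5 w6 w7 using nz by (simp add: field_simps)
  next
    case 3
    then have "weight \<xi> b a y c u = 0" for b y
      by (intro weight_eq_0) (simp add: face_adjacent_def in_nbrs_iff)
    then show ?thesis by simp
  qed
qed

lemma weight_flip_invariant:
  assumes g: "\<And>n :: int. s (of_int n + \<xi>) \<noteq> 0" "\<And>n :: int. s (u + of_int n) \<noteq> 0"
  shows "flip_invariant (weight \<xi>) u"
proof (rule flip_invariantI)
  fix a d c :: int
  show "(\<Sum>y\<in>nbrs d. weight \<xi> a (a + 1) d y (u + 1) * weight \<xi> (a + 1) a y c u) =
      (\<Sum>y\<in>nbrs d. weight \<xi> a (a - 1) d y (u + 1) * weight \<xi> (a - 1) a y c u)"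
  proof (cases "d \<in> nbrs a")
    case True
    then show ?thesis
      using weight_flip[OF g, of 1 a c] weight_flip[OF g, of "-1" a c] by (auto simp: nbrs_def[of a])
  next
    case False
    then have "weight \<xi> a b d y (u + 1) = 0" for b y
      by (intro weight_eq_0) (simp add: face_adjacent_def in_nbrs_iff)
    then show ?thesis by simp
  qed
qed

lemma weight_flip_vertical:
  assumes g: "\<And>n :: int. s (of_int n + \<xi>) \<noteq> 0" "\<And>n :: int. s (u + of_int n) \<noteq> 0"
    and \<sigma>: "\<sigma> = 1 \<or> \<sigma> = -1"
  shows "(\<Sum>y\<in>nbrs (a + \<sigma>). weight \<xi> (a + \<sigma>) a y (a + \<sigma>) (u - 1) * weight \<xi> y (a + \<sigma>) c a u) =
      (\<Sum>y\<in>nbrs (a + \<sigma>). weight \<xi> (a + \<sigma>) a y (a - \<sigma>) (u - 1) * weight \<xi> y (a - \<sigma>) c a u)"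
proof -
  define h where "h = of_int a + \<xi>"
  define \<rho> :: complex where "\<rho> = of_int \<sigma>"
  have \<rho>: "\<rho> = 1 \<or> \<rho> = -1" using \<sigma> by (auto simp: \<rho>_def)
  have nz: "s h \<noteq> 0" "s (h + \<rho>) \<noteq> 0" "s (h - \<rho>) \<noteq> 0" "s (1 + u) \<noteq> 0" "s u \<noteq> 0"
    using g(1)[of a] g(1)[of "a + \<sigma>"] g(1)[of "a - \<sigma>"] g(2)[of 1] g(2)[of 0]
    by (simp_all add: h_def \<rho>_def algebra_simps)
  have sum: "(\<Sum>y\<in>nbrs (a + \<sigma>). f y) = f a + f (a + 2 * \<sigma>)" for f :: "int \<Rightarrow> complex"
    using sum_nbrs[of a "a + \<sigma>" f] \<sigma> by (auto simp: nbrs_def algebra_simps)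
  have n\<sigma>: "- \<sigma> = 1 \<or> - \<sigma> = -1" using \<sigma> by auto
  have w1: "weight \<xi> (a + \<sigma>) a a (a + \<sigma>) (u - 1) = s (h + \<rho> * u) * s 1 / (s (h + \<rho>) * s u)"
    using weight_turn_same[OF n\<sigma>, of \<xi> "a + \<sigma>"] by (simp add: h_def \<rho>_def algebra_simps)
  have w2: "weight \<xi> (a + \<sigma>) a (a + 2 * \<sigma>) (a + \<sigma>) (u - 1) = s h * s (u - 1) / (s (h + \<rho>) * s u)"
    using weight_turn_diff[OF n\<sigma>, of \<xi> "a + \<sigma>"] by (simp add: h_def \<rho>_def algebra_simps)
  have w3: "weight \<xi> (a + \<sigma>) a a (a - \<sigma>) (u - 1) = 1"
    using weight_straight[OF n\<sigma>, of \<xi> "a + \<sigma>"] by (simp add: algebra_simps)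
  have w4: "weight \<xi> (a + \<sigma>) a (a + 2 * \<sigma>) (a - \<sigma>) (u - 1) = 0"
    using \<sigma> by (intro weight_eq_0) (auto simp: face_adjacent_def)
  have "c = a + \<sigma> \<or> c = a - \<sigma> \<or> c \<notin> nbrs a"
    using \<sigma> by (auto simp: nbrs_def)
  then consider "c = a + \<sigma>" | "c = a - \<sigma>" | "c \<notin> nbrs a"
    by blast
  then show ?thesis
  proof cases
    case 1
    have tt: "s (h - \<rho>) * s u * (s u * s (h + \<rho>))
        = s (h - \<rho> * u) * s 1 * (s (h + \<rho> * u) * s 1) + s h * s (u - 1) * (s h * s (1 + u))"
      using three_term[of h 1 u 0] \<rho> s_odd[of "u - 1"] by (auto simp: algebra_simps)
    have w5: "weight \<xi> a (a + \<sigma>) (a + \<sigma>) a u = s (h - \<rho> * u) * s 1 / (s h * s (1 + u))"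
      using weight_turn_same[OF \<sigma>] by (simp add: h_def \<rho>_def)
    have w6: "weight \<xi> (a + 2 * \<sigma>) (a + \<sigma>) (a + \<sigma>) a u = 1"
      using weight_straight[OF n\<sigma>, of \<xi> "a + 2 * \<sigma>"] by (simp add: algebra_simps)
    have w7: "weight \<xi> a (a - \<sigma>) (a + \<sigma>) a u = s (h - \<rho>) * s u / (s h * s (1 + u))"
      using weight_turn_diff[OF n\<sigma>] by (simp add: h_def \<rho>_def)
    show ?thesis
      unfolding sum 1 w1 w2 w3 w4 w5 w6 w7 using three_term_fractions[OF nz(1,5,4,2) tt] by (simp add: mult.commute)
  next
    case 2
    have w5: "weight \<xi> a (a + \<sigma>) (a - \<sigma>) a u = s (h + \<rho>) * s u / (s h * s (1 + u))"
      using weight_turn_diff[OF \<sigma>] by (simp add: h_def \<rho>_def)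
    have w6: "weight \<xi> (a + 2 * \<sigma>) (a + \<sigma>) (a - \<sigma>) a u = 0"
      using \<sigma> by (intro weight_eq_0) (auto simp: face_adjacent_def)
    have w7: "weight \<xi> a (a - \<sigma>) (a - \<sigma>) a u = s (h + \<rho> * u) * s 1 / (s h * s (1 + u))"
      using weight_turn_same[OF n\<sigma>] by (simp add: h_def \<rho>_def)
    show ?thesis
      unfolding sum 2 w1 w2 w3 w4 w5 w6 w7 using nz by (simp add: field_simps)
  next
    case 3
    then have "weight \<xi> y b c a u = 0" for b y
      by (intro weight_eq_0) (auto simp: face_adjacent_def in_nbrs_iff)
    then show ?thesis by simp
  qed
qed

lemma weight_flip_invariant_vertical:
  assumes g: "\<And>n :: int. s (of_int n + \<xi>) \<noteq> 0" "\<And>n :: int. s (u + of_int n) \<noteq> 0"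
  shows "flip_invariant (\<lambda>b0 b1 a0 a1 t. weight \<xi> a0 b0 a1 b1 (- t)) (- u)"
proof (rule flip_invariantI)
  fix a d c :: int
  show "(\<Sum>y\<in>nbrs d. weight \<xi> d a y (a + 1) (- (- u + 1)) * weight \<xi> y (a + 1) c a (- (- u))) =
      (\<Sum>y\<in>nbrs d. weight \<xi> d a y (a - 1) (- (- u + 1)) * weight \<xi> y (a - 1) c a (- (- u)))"
  proof (cases "d \<in> nbrs a")
    case True
    then show ?thesis
      using weight_flip_vertical[OF g, of 1 a c] weight_flip_vertical[OF g, of "-1" a c]
      by (auto simp: nbrs_def[of a])
  next
    case False
    then have "weight \<xi> d a y b v = 0" for b y v
      by (intro weight_eq_0) (auto simp: face_adjacent_def in_nbrs_iff)
    then show ?thesis by simp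
  qed
qed

text \<open>A sign sequence is encoded as a height path whose steps are the signs, so that reordering the signs becomes flipping corners and
\<open>chain_independent\<close> also applies to the dual vectors.\<close>

definition sign_weight :: "complex \<Rightarrow> int \<Rightarrow> int \<Rightarrow> int \<Rightarrow> int \<Rightarrow> complex \<Rightarrow> complex" where
  "sign_weight \<xi> a b d c u = (if c \<in> nbrs d then dvec \<xi> (b - a) u c d else 0)"

text \<open>For \<open>c = d\<close> the difference of the two sides is a sum of two determinants of \<open>v\<close> divided by brackets of heights, which the addition formula evaluates to opposite values.
For \<open>c = d \<plusminus> 2\<close> the two factors have the same argument, so that their signs can be exchanged.\<close>

lemma sign_weight_flip_invariant:
  assumes g: "\<And>n :: int. s (of_int n + \<xi>) \<noteq> 0"
  shows "flip_invariant (sign_weight \<xi>) u"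
proof (rule flip_invariantI)
  fix a d c :: int
  define h where "h = of_int d + \<xi>"
  have nz: "s h \<noteq> 0" "s (h + 1) \<noteq> 0" "s (h - 1) \<noteq> 0"
    using g[of d] g[of "d + 1"] g[of "d - 1"] by (simp_all add: h_def algebra_simps)
  define k where "k = cc / (2 * s (u + 1)) * (cc / (2 * s u))"
  have dd: "dvec \<xi> 1 (u + 1) y d * dvec \<xi> (- 1) u c y = - k * (dual_vec \<xi> (- 1) (u + 1) y d * dual_vec \<xi> 1 u c y)"
    "dvec \<xi> (- 1) (u + 1) y d * dvec \<xi> 1 u c y = - k * (dual_vec \<xi> 1 (u + 1) y d * dual_vec \<xi> (- 1) u c y)" for y
    by (simp_all add: dvec_eq k_def)
  have sum: "(\<Sum>y\<in>nbrs d. f y) = f (d + 1) + f (d - 1)" for f :: "int \<Rightarrow> complex"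
    by (simp add: nbrs_def)
  have "c = d \<or> c = d + 2 \<or> c = d - 2 \<or> c \<notin> nbrs (d + 1) \<and> c \<notin> nbrs (d - 1)"
    by (auto simp: nbrs_def)
  then consider "c = d" | "c = d + 2" | "c = d - 2" | "c \<notin> nbrs (d + 1)" "c \<notin> nbrs (d - 1)"
    by blast
  then show "(\<Sum>y\<in>nbrs d. sign_weight \<xi> a (a + 1) d y (u + 1) * sign_weight \<xi> (a + 1) a y c u) =
      (\<Sum>y\<in>nbrs d. sign_weight \<xi> a (a - 1) d y (u + 1) * sign_weight \<xi> (a - 1) a y c u)"
  proof cases
    case 1
    have a1: "vcomp (- 1) (h + 1 + u) * vcomp 1 (h + 1 - u) - vcomp 1 (h + 1 + u) * vcomp (- 1) (h + 1 - u) = \<kappa> * s (h + 1) * s u"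
      using addition[of "h + 1" u] by (simp add: vcomp_def)
    have a2: "vcomp (- 1) (h - 1 - u) * vcomp 1 (h - 1 + u) - vcomp 1 (h - 1 - u) * vcomp (- 1) (h - 1 + u) = - \<kappa> * s (h - 1) * s u"
      using addition[of "h - 1" "- u"] by (simp add: vcomp_def s_odd)
    have "(vcomp (- 1) (h + 1 + u) * vcomp 1 (h + 1 - u) - vcomp 1 (h + 1 + u) * vcomp (- 1) (h + 1 - u)) / s (h + 1)
        + (vcomp (- 1) (h - 1 - u) * vcomp 1 (h - 1 + u) - vcomp 1 (h - 1 - u) * vcomp (- 1) (h - 1 + u)) / s (h - 1) = 0"
      unfolding a1 a2 using nz by simp
    note E = this
    have v: "dual_vec \<xi> \<epsilon> (u + 1) (d + 1) d = vcomp \<epsilon> (h + 1 + u) / s h"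
      "dual_vec \<xi> \<epsilon> u d (d + 1) = - vcomp \<epsilon> (h + 1 - u) / s (h + 1)"
      "dual_vec \<xi> \<epsilon> (u + 1) (d - 1) d = - vcomp \<epsilon> (h - 1 - u) / s h"
      "dual_vec \<xi> \<epsilon> u d (d - 1) = vcomp \<epsilon> (h - 1 + u) / s (h - 1)" for \<epsilon>
      by (simp_all add: dual_vec_def h_def algebra_simps)
    define A where "A = dual_vec \<xi> (- 1) (u + 1) (d + 1) d * dual_vec \<xi> 1 u d (d + 1)
        + dual_vec \<xi> (- 1) (u + 1) (d - 1) d * dual_vec \<xi> 1 u d (d - 1)"
    define B where "B = dual_vec \<xi> 1 (u + 1) (d + 1) d * dual_vec \<xi> (- 1) u d (d + 1)
        + dual_vec \<xi> 1 (u + 1) (d - 1) d * dual_vec \<xi> (- 1) u d (d - 1)"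
    have "A - B = - (1 / s h) * ((vcomp (- 1) (h + 1 + u) * vcomp 1 (h + 1 - u) - vcomp 1 (h + 1 + u) * vcomp (- 1) (h + 1 - u)) / s (h + 1)
        + (vcomp (- 1) (h - 1 - u) * vcomp 1 (h - 1 + u) - vcomp 1 (h - 1 - u) * vcomp (- 1) (h - 1 + u)) / s (h - 1))"
      unfolding A_def B_def v by (simp add: diff_divide_distrib distrib_left right_diff_distrib)
    then have "A = B" unfolding E by simp
    moreover have "(\<Sum>y\<in>nbrs d. sign_weight \<xi> a (a + 1) d y (u + 1) * sign_weight \<xi> (a + 1) a y c u) = - k * A"
      "(\<Sum>y\<in>nbrs d. sign_weight \<xi> a (a - 1) d y (u + 1) * sign_weight \<xi> (a - 1) a y c u) = - k * B"
      unfolding sum 1 A_def B_def by (simp_all add: sign_weight_def in_nbrs_iff dd[unfolded 1] distrib_left)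
    ultimately show ?thesis by simp
  next
    case 2
    have "dual_vec \<xi> \<epsilon> (u + 1) (d + 1) d * dual_vec \<xi> \<epsilon>' u (d + 2) (d + 1)
        = dual_vec \<xi> \<epsilon>' (u + 1) (d + 1) d * dual_vec \<xi> \<epsilon> u (d + 2) (d + 1)" for \<epsilon> \<epsilon>'
      by (simp add: dual_vec_def algebra_simps)
    then show ?thesis
      unfolding sum 2 by (simp add: sign_weight_def in_nbrs_iff dd[unfolded 2])
  next
    case 3
    have "dual_vec \<xi> \<epsilon> (u + 1) (d - 1) d * dual_vec \<xi> \<epsilon>' u (d - 2) (d - 1)
        = dual_vec \<xi> \<epsilon>' (u + 1) (d - 1) d * dual_vec \<xi> \<epsilon> u (d - 2) (d - 1)" for \<epsilon> \<epsilon>'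
      by (simp add: dual_vec_def algebra_simps)
    then show ?thesis
      unfolding sum 3 by (simp add: sign_weight_def in_nbrs_iff dd[unfolded 3])
  next
    case 4
    then show ?thesis unfolding sum by (simp add: sign_weight_def)
  qed
qed

text \<open>The intertwining vectors along \<open>a, a + 1, a\<close> and \<open>a, a - 1, a\<close> have the same two arguments in opposite order, so the flip
exchanges the two mixed sign patterns; by \<open>sign_weight_flip_invariant\<close> their coefficients agree.\<close>

lemma lmat_flip_invariant:
  assumes g: "\<And>n :: int. s (of_int n + \<xi>) \<noteq> 0"
  shows "flip_invariant (lmat \<xi>) u"
proof (rule flip_invariantI)
  fix a d c :: int
  define i where "i = (\<lambda>\<epsilon> \<epsilon>' x. ivec \<xi> \<epsilon> (u + 1) a x * ivec \<xi> \<epsilon>' u x a)"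
  define w where "w = (\<lambda>\<epsilon> \<epsilon>'. \<Sum>y\<in>nbrs d. if c \<in> nbrs y then dvec \<xi> \<epsilon> (u + 1) y d * dvec \<xi> \<epsilon>' u c y else 0)"
  have "w 1 (- 1) = (\<Sum>y\<in>nbrs d. sign_weight \<xi> 0 1 d y (u + 1) * sign_weight \<xi> 1 0 y c u)"
    unfolding w_def by (intro sum.cong refl) (simp add: sign_weight_def)
  also have "\<dots> = (\<Sum>y\<in>nbrs d. sign_weight \<xi> 0 (- 1) d y (u + 1) * sign_weight \<xi> (- 1) 0 y c u)"
    using sign_weight_flip_invariant[OF g, of u, unfolded flip_invariant_def, rule_format, of 1 0 "-1" d c]
    by (simp add: in_nbrs_iff)
  also have "\<dots> = w (- 1) 1"
    unfolding w_def by (intro sum.cong refl) (simp add: sign_weight_def)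
  finally have "w 1 (- 1) = w (- 1) 1" .
  moreover have "i 1 1 (a + 1) = i 1 1 (a - 1)" "i (- 1) (- 1) (a + 1) = i (- 1) (- 1) (a - 1)"
     "i 1 (- 1) (a + 1) = i (- 1) 1 (a - 1)" "i (- 1) 1 (a + 1) = i 1 (- 1) (a - 1)"
    by (simp_all add: i_def ivec_def algebra_simps)
  moreover have "(\<Sum>y\<in>nbrs d. lmat \<xi> a x d y (u + 1) * lmat \<xi> x a y c u) =
      w 1 1 * i 1 1 x + w (- 1) (- 1) * i (- 1) (- 1) x + w 1 (- 1) * i 1 (- 1) x + w (- 1) 1 * i (- 1) 1 x"
    if "x \<in> nbrs a" for x
  proof -
    have "a \<in> nbrs x" using that by (auto simp: nbrs_def)
    then have "(\<Sum>y\<in>nbrs d. lmat \<xi> a x d y (u + 1) * lmat \<xi> x a y c u) =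
      (\<Sum>y\<in>nbrs d. (if c \<in> nbrs y then dvec \<xi> 1 (u + 1) y d * dvec \<xi> 1 u c y else 0) * i 1 1 x
         + (if c \<in> nbrs y then dvec \<xi> (- 1) (u + 1) y d * dvec \<xi> (- 1) u c y else 0) * i (- 1) (- 1) x
         + (if c \<in> nbrs y then dvec \<xi> 1 (u + 1) y d * dvec \<xi> (- 1) u c y else 0) * i 1 (- 1) x
         + (if c \<in> nbrs y then dvec \<xi> (- 1) (u + 1) y d * dvec \<xi> 1 u c y else 0) * i (- 1) 1 x)"
      using that by (intro sum.cong refl) (simp add: lmat_def i_def algebra_simps)
    then show ?thesis
      by (simp only: sum.distrib w_def sum_distrib_right)
  qed
  moreover have "a + 1 \<in> nbrs a" "a - 1 \<in> nbrs a" by (auto simp: nbrs_def)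
  ultimately show "(\<Sum>y\<in>nbrs d. lmat \<xi> a (a + 1) d y (u + 1) * lmat \<xi> (a + 1) a y c u) =
      (\<Sum>y\<in>nbrs d. lmat \<xi> a (a - 1) d y (u + 1) * lmat \<xi> (a - 1) a y c u)"
    by simp
qed

end

section \<open>Sign sequences\<close>

definition sign_seqs :: "nat \<Rightarrow> int list set" where
  "sign_seqs k = {es. length es = k \<and> set es \<subseteq> {1, -1}}"

lemma sign_seqs_0: "sign_seqs 0 = {[]}"
  by (auto simp: sign_seqs_def)

lemma sign_seqs_Suc: "sign_seqs (Suc k) = (\<Union>e\<in>{1, -1}. (#) e ` sign_seqs k)"
proof (intro set_eqI iffI)
  fix es assume "es \<in> sign_seqs (Suc k)"
  then show "es \<in> (\<Union>e\<in>{1, -1}. (#) e ` sign_seqs k)"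
    by (cases es) (auto simp: sign_seqs_def)
qed (auto simp: sign_seqs_def)

lemma finite_sign_seqs [simp]: "finite (sign_seqs k)"
  by (induction k) (auto simp: sign_seqs_0 sign_seqs_Suc)

lemma sum_sign_seqs_prod:
  "(\<Sum>es\<in>sign_seqs k. \<Prod>i=1..k. f i (es ! (i - 1))) = (\<Prod>i=1..k. f i 1 + f i (-1))"
  for f :: "nat \<Rightarrow> int \<Rightarrow> complex"
proof (induction k arbitrary: f)
  case 0
  then show ?case by (simp add: sign_seqs_0)
next
  case (Suc k)
  have "(\<Sum>es\<in>sign_seqs (Suc k). \<Prod>i=1..Suc k. f i (es ! (i - 1)))
      = (\<Sum>e\<in>{1, -1}. \<Sum>es\<in>(#) e ` sign_seqs k. \<Prod>i=1..Suc k. f i (es ! (i - 1)))"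
    unfolding sign_seqs_Suc by (rule sum.UNION_disjoint) auto
  also have "\<dots> = (\<Sum>e\<in>{1, -1}. \<Sum>es\<in>sign_seqs k. \<Prod>i=1..Suc k. f i ((e # es) ! (i - 1)))"
    by (rule sum.cong[OF refl], subst sum.reindex) (simp_all add: o_def)
  also have "\<dots> = (\<Sum>e\<in>{1, -1}. f 1 e * (\<Sum>es\<in>sign_seqs k. \<Prod>i=1..k. f (Suc i) (es ! (i - 1))))"
    unfolding sum_distrib_left
  proof (intro sum.cong refl)
    fix e :: int and es
    have "(\<Prod>i=1..k. f (Suc i) ((e # es) ! (Suc i - 1))) = (\<Prod>i=1..k. f (Suc i) (es ! (i - 1)))"
      by (intro prod.cong refl) (auto simp: nth_Cons')
    then show "(\<Prod>i=1..Suc k. f i ((e # es) ! (i - 1))) = f 1 e * (\<Prod>i=1..k. f (Suc i) (es ! (i - 1)))"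
      by (subst prod_Suc_shift) simp
  qed
  also have "\<dots> = (f 1 1 + f 1 (-1)) * (\<Prod>i=1..k. f (Suc i) 1 + f (Suc i) (-1))"
    unfolding Suc.IH[of "\<lambda>i. f (Suc i)"] by (simp add: distrib_right)
  also have "\<dots> = (\<Prod>i=1..Suc k. f i 1 + f i (-1))"
    by (rule prod_Suc_shift[symmetric])
  finally show ?case .
qed

fun sign_path :: "int \<Rightarrow> int list \<Rightarrow> int list" where
  "sign_path a [] = [a]"
| "sign_path a (e # es) = a # sign_path (a + e) es"

lemma sign_path_in: "es \<in> sign_seqs k \<Longrightarrow> sign_path a es \<in> height_paths k a (a + sum_list es)"
proof (induction es arbitrary: k a)
  case Nil
  then show ?case by (auto simp: sign_seqs_def height_paths_0)
next
  case (Cons e es)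
  then obtain k' where k: "k = Suc k'" and es: "es \<in> sign_seqs k'" and e: "e = 1 \<or> e = -1"
    by (auto simp: sign_seqs_def)
  from Cons.IH[OF es, of "a + e"] e show ?case
    by (force simp: k height_paths_Suc in_nbrs_iff add.assoc)
qed

lemma sign_path_diff:
  "i < length es \<Longrightarrow> sign_path a es ! Suc i - sign_path a es ! i = es ! i"
proof (induction es arbitrary: a i)
  case (Cons e es)
  have "sign_path b es ! 0 = b" for b by (cases es) auto
  with Cons show ?case by (cases i) auto
qed simp

lemma steps_minus: "- n \<in> steps k \<longleftrightarrow> n \<in> steps k"
  by (auto simp: steps_iff)

lemma sign_lists_eq: "sign_lists k \<mu> = {es \<in> sign_seqs k. sum_list es = \<mu>}"
  by (auto simp: sign_lists_def sign_seqs_def)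

lemma sum_list_sign_seq: "es \<in> sign_seqs k \<Longrightarrow> sum_list es \<in> steps k"
  using sign_path_in[of es k 0] height_paths_nonempty[of k 0 "sum_list es"] steps_minus by auto

lemma some_signs_in:
  assumes "\<mu> \<in> steps k"
  shows "some_signs k \<mu> \<in> sign_lists k \<mu>"
proof -
  obtain j where j: "\<mu> = 2 * int j - int k" "j \<le> k" using assms by (auto simp: steps_def)
  then have "replicate j 1 @ replicate (k - j) (-1) \<in> sign_lists k \<mu>"
    by (auto simp: sign_lists_def sum_list_replicate)
  then show ?thesis unfolding some_signs_def by (rule someI)
qed

lemma sum_over_sign_lists:
  "(\<Sum>\<mu>\<in>steps k. \<Sum>es\<in>sign_lists k \<mu>. f es) = (\<Sum>es\<in>sign_seqs k. f es)" for f :: "int list \<Rightarrow> complex"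
proof -
  have "sign_seqs k = (\<Union>\<mu>\<in>steps k. sign_lists k \<mu>)"
    using sum_list_sign_seq by (auto simp: sign_lists_eq)
  moreover have "(\<Sum>es\<in>(\<Union>\<mu>\<in>steps k. sign_lists k \<mu>). f es) = (\<Sum>\<mu>\<in>steps k. \<Sum>es\<in>sign_lists k \<mu>. f es)"
    by (rule sum.UNION_disjoint) (auto simp: sign_lists_eq)
  ultimately show ?thesis by simp
qed

section \<open>The exchange relation for fused weights with displaced heights\<close>

text \<open>A nonempty open set of complex numbers is uncountable, so points outside \<open>B\<close> accumulate at \<open>0\<close>.\<close>

lemma eq_at_0_of_countable_exceptions:
  fixes f g :: "complex \<Rightarrow> complex"
  assumes f: "isCont f 0" and g: "isCont g 0" and B: "countable B" and eq: "\<And>t. t \<notin> B \<Longrightarrow> f t = g t"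
  shows "f 0 = g 0"
proof (rule ccontr)
  assume "f 0 \<noteq> g 0"
  then have "isCont (\<lambda>t. f t - g t) 0" "f 0 - g 0 \<noteq> 0"
    using f g by (auto intro!: continuous_intros)
  then obtain e where e: "e > 0" "\<forall>t. dist 0 t < e \<longrightarrow> f t - g t \<noteq> 0"
    using continuous_at_avoid[of 0 "\<lambda>t. f t - g t" 0] by auto
  have "ball 0 e \<subseteq> B"
  proof
    fix t :: complex assume "t \<in> ball 0 e"
    with e have "f t \<noteq> g t" by auto
    with eq show "t \<in> B" by blast
  qed
  then have "countable (ball (0 :: complex) e)" using B countable_subset by blast
  with e(1) show False using uncountable_ball by blast
qed

context theta_pair
begin

text \<open>The rows of a fused face are read sideways and with negated parameter, as in \<open>exchange_fuse_vertical\<close>.\<close>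

definition fweight :: "complex \<Rightarrow> nat \<Rightarrow> nat \<Rightarrow> kernel" where
  "fweight \<xi> k l a b d c u =
     fuse (\<lambda>b0 b1 a0 a1 t. fuse (weight \<xi>) k a0 b0 a1 b1 (- t)) l b c a d (- u)"

lemma fweight_eq_sum:
  "fweight \<xi> k l a b d c u = (if height_paths l b c = {} then 0 else
     \<Sum>as\<in>height_paths l a d. \<Prod>j=1..l. fuse (weight \<xi>) k (as ! (j - 1)) (some_path l b c ! (j - 1))
       (as ! j) (some_path l b c ! j) (u - of_nat l + of_nat j))"
proof -
  have "- (- u + of_nat l - of_nat j) = u - of_nat l + of_nat j" for j by simp
  then show ?thesis
    unfolding fweight_def by (subst fuse_eq_sum) (simp only:)
qed

lemma generic_shift: "generic \<xi> u v \<Longrightarrow> generic \<xi> (u + of_int m) (v + of_int n)"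
  unfolding generic_def
proof (intro allI)
  fix j :: int
  assume *: "\<forall>n. s (of_int n + \<xi>) \<noteq> 0 \<and> s (u - v + of_int n) \<noteq> 0 \<and> s (of_int n + \<xi> - u) \<noteq> 0 \<and> s (of_int n + \<xi> + u) \<noteq> 0"
  show "s (of_int j + \<xi>) \<noteq> 0 \<and> s (u + of_int m - (v + of_int n) + of_int j) \<noteq> 0 \<and>
    s (of_int j + \<xi> - (u + of_int m)) \<noteq> 0 \<and> s (of_int j + \<xi> + (u + of_int m)) \<noteq> 0"
    using *[rule_format, of j] *[rule_format, of "m - n + j"] *[rule_format, of "j - m"] *[rule_format, of "j + m"]
    by (simp add: algebra_simps)
qed

text \<open>Horizontal fusion gives the relation for a row of \<open>k\<close> faces and one face of the other \<open>L\<close>-matrix, at all parameters that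
differ from \<open>u\<close> and \<open>v\<close> by integers; these relations are the input for the vertical fusion.\<close>

lemma fused_exchange:
  assumes g: "generic \<xi> u v" and k: "k \<ge> 1"
  shows "(\<Sum>d\<in>reach l a. fweight \<xi> k l a b d c (u - v) * fuse (lmat \<xi>) k d c f e u * fuse (lmat \<xi>) l a d g f v)
    = (\<Sum>d\<in>reach k g. fuse (lmat \<xi>) k a b g d u * fuse (lmat \<xi>) l b c d e v * fweight \<xi> k l g d f e (u - v))"
proof -
  have nz: "s (of_int n + \<xi>) \<noteq> 0" "s (u - v + of_int n) \<noteq> 0" for n :: int
    using g unfolding generic_def by auto
  have supp: "d \<notin> nbrs a \<Longrightarrow> weight \<xi> a b d c t = 0" "c \<notin> nbrs b \<Longrightarrow> weight \<xi> a b d c t = 0"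
      "c \<notin> nbrs d \<Longrightarrow> weight \<xi> a b d c t = 0" for a b d c t
    using weight_supp[of \<xi> a b d c t] by blast+
  have nz': "s (u - v + of_int m + of_int n) \<noteq> 0" for m n :: int
    using nz(2)[of "m + n"] by (simp add: add.assoc)
  have W: "fusible (weight \<xi>) (u - v + of_int m)" for m :: int
    unfolding fusible_def
  proof (intro conjI allI)
    fix n :: nat
    show "flip_invariant (weight \<xi>) (u - v + of_int m + of_nat n)"
      using weight_flip_invariant[of \<xi> "u - v + of_int (m + int n)"] nz nz'[of "m + int n"] by (simp add: add.assoc)
  qed (use supp in blast)
  have L: "fusible (lmat \<xi>) t" for t
    unfolding fusible_def using lmat_flip_invariant[of \<xi>] nz lmat_supp by blast
  define V where "V = (\<lambda>b0 b1 a0 a1 t. fuse (weight \<xi>) k a0 b0 a1 b1 (- t))"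
  have flipV: "flip_invariant V (- (u - v) + of_nat n)" for n
  proof -
    have "flip_invariant V (- (u - v + of_int (- int n)))"
      unfolding V_def
    proof (rule fuse_flip_invariant_vertical)
      fix m :: int
      show "fusible (weight \<xi>) (u - v + of_int (- int n) + of_int m)"
        using W[of "- int n + m"] by (simp add: algebra_simps)
      show "flip_invariant (\<lambda>b0 b1 a0 a1 t. weight \<xi> a0 b0 a1 b1 (- t)) (- (u - v + of_int (- int n) + of_int m))"
        using weight_flip_invariant_vertical[of \<xi> "u - v + of_int (- int n + m)"] nz nz'[of "- int n + m"]
        by (simp add: algebra_simps)
    qed (use supp in blast)+
    moreover have "- (u - v + of_int (- int n)) = - (u - v) + of_nat n" by simp
    ultimately show ?thesis by (simp only:)
  qed
  have V0: "V a b d c t = 0" if "c \<notin> nbrs d" for a b d c t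
  proof -
    show ?thesis
    proof (cases "d - a \<in> steps k")
      case True
      have "(\<Prod>i=1..k. weight \<xi> (some_path k d a ! (i - 1)) (some_path k d a ! i) (ds ! (i - 1)) (ds ! i)
          (- t + of_nat k - of_nat i)) = 0" if "ds \<in> height_paths k c b" for ds
      proof (rule prod_zero)
        have "some_path k d a ! 0 = d" "ds ! 0 = c"
          using some_path_in[OF True] that by (simp_all add: height_paths_def)
        with \<open>c \<notin> nbrs d\<close> supp(1) k show "\<exists>i\<in>{1..k}. weight \<xi> (some_path k d a ! (i - 1)) (some_path k d a ! i)
            (ds ! (i - 1)) (ds ! i) (- t + of_nat k - of_nat i) = 0"
          by (intro bexI[of _ 1]) auto
      qed simp
      then have z: "(\<Sum>ds\<in>height_paths k c b. \<Prod>i=1..k. weight \<xi> (some_path k d a ! (i - 1)) (some_path k d a ! i)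
          (ds ! (i - 1)) (ds ! i) (- t + of_nat k - of_nat i)) = 0"
        by (intro sum.neutral ballI)
      show ?thesis by (simp only: V_def fuse_eq_sum z if_cancel)
    next
      case False
      then show ?thesis by (simp add: V_def fuse_top)
    qed
  qed
  have fV: "fusible V (- (u - v))"
    unfolding fusible_def using V0 flipV by blast
  have h: "(\<Sum>d\<in>nbrs a. fuse (weight \<xi>) k a b d c (u - v - of_nat n) * fuse (lmat \<xi>) k d c f e u * lmat \<xi> a d g f (v + of_nat n))
      = (\<Sum>d\<in>reach k g. fuse (lmat \<xi>) k a b g d u * lmat \<xi> b c d e (v + of_nat n) * fuse (weight \<xi>) k g d f e (u - v - of_nat n))"
    for n :: nat and a b c e f g
  proof (rule exchange_fuse_horizontal)
    show "fusible (weight \<xi>) (u - v - of_nat n)" using W[of "- int n"] by simp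
    show "fusible (lmat \<xi>) u" by (rule L)
    show "c \<notin> nbrs b \<Longrightarrow> weight \<xi> a b d c t = 0" for a b d c t by (rule supp)
    show "d \<notin> nbrs a \<Longrightarrow> lmat \<xi> a d g f (v + of_nat n) = 0" for a d g f
      by (simp add: lmat_def)
    fix m :: nat and a b c e f g
    have "u + of_int (int m) - (v + of_int (int n)) = u - v - of_nat n + of_nat m" by simp
    with local_exchange[OF generic_shift[OF g, of "int m" "int n"], of a b c f e g]
    show "(\<Sum>d\<in>nbrs a. weight \<xi> a b d c (u - v - of_nat n + of_nat m) * lmat \<xi> d c f e (u + of_nat m) * lmat \<xi> a d g f (v + of_nat n))
       = (\<Sum>d\<in>nbrs g. lmat \<xi> a b g d (u + of_nat m) * lmat \<xi> b c d e (v + of_nat n) * weight \<xi> g d f e (u - v - of_nat n + of_nat m))"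
      by (simp only: of_int_of_nat_eq)
  qed
  show ?thesis
    unfolding fweight_def
    by (rule exchange_fuse_vertical[where U = "fuse (weight \<xi>) k" and C = "lmat \<xi>" and w = "u - v" and v = v
        and B = "\<lambda>a b c d. fuse (lmat \<xi>) k a b c d u" and k = k and l = l,
        OF fV[unfolded V_def] L fuse_bottom fuse_bottom h])
qed

text \<open>The fused \<open>L\<close>-matrix in its original form, a sum over \<open>\<mu>\<close>, for displaced heights. For generic \<open>\<xi>\<close> it coincides with the fusion of
the \<open>L\<close>-matrices of single faces (\<open>lmat_k_eq_fuse\<close>).\<close>

definition lmat_k :: "complex \<Rightarrow> nat \<Rightarrow> kernel" where
  "lmat_k \<xi> k a b c d u = (\<Sum>\<mu>\<in>steps k.
     (\<Sum>cs\<in>height_paths k c d. \<Prod>i=1..k.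
        dvec \<xi> (some_signs k \<mu> ! (i - 1)) (u + of_nat k - of_nat i) (cs ! i) (cs ! (i - 1))) *
     (\<Sum>es\<in>sign_lists k \<mu>. \<Prod>i=1..k.
        ivec \<xi> (es ! (i - 1)) (u + of_nat k - of_nat i) (some_path k a b ! (i - 1)) (some_path k a b ! i)))"

lemma dual_sum_sign_independent:
  assumes nz: "\<And>n :: int. s (of_int n + \<xi>) \<noteq> 0" and es: "es \<in> sign_lists k \<mu>" "es' \<in> sign_lists k \<mu>"
  shows "(\<Sum>cs\<in>height_paths k c d. \<Prod>i=1..k. dvec \<xi> (es ! (i - 1)) (u + of_nat k - of_nat i) (cs ! i) (cs ! (i - 1)))
    = (\<Sum>cs\<in>height_paths k c d. \<Prod>i=1..k. dvec \<xi> (es' ! (i - 1)) (u + of_nat k - of_nat i) (cs ! i) (cs ! (i - 1)))"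
proof -
  have f: "fusible (sign_weight \<xi>) u"
    unfolding fusible_def using sign_weight_flip_invariant[OF nz] by (simp add: sign_weight_def)
  have path: "sign_path 0 es \<in> height_paths k 0 \<mu>" if "es \<in> sign_lists k \<mu>" for es
    using sign_path_in[of es k 0] that by (simp add: sign_lists_eq)
  have "chain (sign_weight \<xi>) (sign_path 0 es) c d u =
      (\<Sum>cs\<in>height_paths k c d. \<Prod>i=1..k. dvec \<xi> (es ! (i - 1)) (u + of_nat k - of_nat i) (cs ! i) (cs ! (i - 1)))"
    if "es \<in> sign_lists k \<mu>" for es
    unfolding chain_eq_sum[OF path[OF that]]
  proof (rule sum.cong[OF refl], rule prod.cong[OF refl])
    fix cs i assume cs: "cs \<in> height_paths k c d" and i: "i \<in> {1..k}"
    then obtain j where j: "i = Suc j" by (cases i) auto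
    have "cs ! i \<in> nbrs (cs ! (i - 1))" using cs i by (simp add: height_paths_def in_nbrs_iff)
    moreover have "sign_path 0 es ! i - sign_path 0 es ! (i - 1) = es ! (i - 1)"
      using sign_path_diff[of j es 0] that i by (simp add: j sign_lists_def)
    ultimately show "sign_weight \<xi> (sign_path 0 es ! (i - 1)) (sign_path 0 es ! i) (cs ! (i - 1)) (cs ! i) (u + of_nat k - of_nat i)
      = dvec \<xi> (es ! (i - 1)) (u + of_nat k - of_nat i) (cs ! i) (cs ! (i - 1))"
      by (simp only: sign_weight_def if_True)
  qed
  note eq = this
  show ?thesis
    unfolding eq[OF es(1), symmetric] eq[OF es(2), symmetric]
    by (rule chain_independent[OF f path[OF es(1)] path[OF es(2)]])
qed

text \<open>Since the dual sum may be taken with any sign sequence of total \<open>\<mu>\<close>, it can be moved inside the sum over such sequences, with the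
same sequence in both factors. Then all sign sequences are summed over, and the sum factors over the faces.\<close>

lemma lmat_k_eq_fuse:
  assumes nz: "\<And>n :: int. s (of_int n + \<xi>) \<noteq> 0" and ab: "a - b \<in> steps k"
  shows "lmat_k \<xi> k a b c d u = fuse (lmat \<xi>) k a b c d u"
proof -
  let ?as = "some_path k a b"
  let ?u = "\<lambda>i. u + of_nat k - of_nat i"
  let ?D = "\<lambda>cs es. \<Prod>i=1..k. dvec \<xi> (es ! (i - 1)) (?u i) (cs ! i) (cs ! (i - 1))"
  let ?I = "\<lambda>es. \<Prod>i=1..k. ivec \<xi> (es ! (i - 1)) (?u i) (?as ! (i - 1)) (?as ! i)"
  have "lmat_k \<xi> k a b c d u = (\<Sum>\<mu>\<in>steps k. \<Sum>es\<in>sign_lists k \<mu>. (\<Sum>cs\<in>height_paths k c d. ?D cs es) * ?I es)"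
    unfolding lmat_k_def sum_distrib_left
  proof (rule sum.cong[OF refl], rule sum.cong[OF refl], rule arg_cong2[where f = "(*)", OF _ refl])
    fix \<mu> es assume "\<mu> \<in> steps k" "es \<in> sign_lists k \<mu>"
    then show "(\<Sum>cs\<in>height_paths k c d. ?D cs (some_signs k \<mu>)) = (\<Sum>cs\<in>height_paths k c d. ?D cs es)"
      by (intro dual_sum_sign_independent[OF nz some_signs_in])
  qed
  also have "\<dots> = (\<Sum>es\<in>sign_seqs k. (\<Sum>cs\<in>height_paths k c d. ?D cs es) * ?I es)"
    by (rule sum_over_sign_lists)
  also have "\<dots> = (\<Sum>cs\<in>height_paths k c d. \<Sum>es\<in>sign_seqs k. ?D cs es * ?I es)"
    unfolding sum_distrib_right by (rule sum.swap)
  also have "\<dots> = (\<Sum>cs\<in>height_paths k c d. \<Prod>i=1..k. lmat \<xi> (?as ! (i - 1)) (?as ! i) (cs ! (i - 1)) (cs ! i) (?u i))"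
  proof (rule sum.cong[OF refl])
    fix cs assume cs: "cs \<in> height_paths k c d"
    have "(\<Sum>es\<in>sign_seqs k. ?D cs es * ?I es) = (\<Sum>es\<in>sign_seqs k. \<Prod>i=1..k.
        (\<lambda>i \<epsilon>. dvec \<xi> \<epsilon> (?u i) (cs ! i) (cs ! (i - 1)) * ivec \<xi> \<epsilon> (?u i) (?as ! (i - 1)) (?as ! i)) i (es ! (i - 1)))"
      by (simp only: prod.distrib)
    also have "\<dots> = (\<Prod>i=1..k. dvec \<xi> 1 (?u i) (cs ! i) (cs ! (i - 1)) * ivec \<xi> 1 (?u i) (?as ! (i - 1)) (?as ! i) +
        dvec \<xi> (-1) (?u i) (cs ! i) (cs ! (i - 1)) * ivec \<xi> (-1) (?u i) (?as ! (i - 1)) (?as ! i))"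
      by (rule sum_sign_seqs_prod)
    also have "\<dots> = (\<Prod>i=1..k. lmat \<xi> (?as ! (i - 1)) (?as ! i) (cs ! (i - 1)) (cs ! i) (?u i))"
      using cs some_path_in[OF ab] by (intro prod.cong refl) (simp add: lmat_def height_paths_def in_nbrs_iff)
    finally show "(\<Sum>es\<in>sign_seqs k. ?D cs es * ?I es) = (\<Prod>i=1..k. lmat \<xi> (?as ! (i - 1)) (?as ! i) (cs ! (i - 1)) (cs ! i) (?u i))" .
  qed
  also have "\<dots> = fuse (lmat \<xi>) k a b c d u"
    using ab height_paths_nonempty[of k a b] by (simp add: fuse_eq_sum)
  finally show ?thesis .
qed

section \<open>Continuity in the displacement\<close>

lemma isCont_weight:
  assumes cont: "\<And>x. isCont s x" and g: "isCont g 0"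
    and nz: "face_adjacent a b d c \<Longrightarrow> c = a \<Longrightarrow> s (of_int a) \<noteq> 0 \<and> s (1 + g 0) \<noteq> 0"
  shows "isCont (\<lambda>t. weight t a b d c (g t)) 0"
proof -
  have s: "isCont (\<lambda>t. s (f t)) 0" if "isCont f 0" for f :: "complex \<Rightarrow> complex"
    using isCont_o2[OF that cont] .
  show ?thesis
  proof (cases "face_adjacent a b d c \<and> c = a")
    case True
    with nz have "s (of_int a + 0) \<noteq> 0" "s (1 + g 0) \<noteq> 0" by auto
    with True show ?thesis
      unfolding weight_def by (cases "d = b") (auto intro!: continuous_intros s g)
  next
    case False
    then have "weight t a b d c = weight 0 a b d c" "weight 0 a b d c x = weight 0 a b d c y" for t x y
      by (auto simp: weight_def)
    then have "(\<lambda>t. weight t a b d c (g t)) = (\<lambda>t. weight 0 a b d c 0)" by metis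
    then show ?thesis by simp
  qed
qed

text \<open>A bottom path that is not adjacent to the top path everywhere contributes \<open>0\<close> for all \<open>t\<close>; for the others the hypothesis keeps the
denominators away from \<open>0\<close>.\<close>

lemma isCont_fuse_weight:
  assumes cont: "\<And>x. isCont s x" and g: "isCont g 0" and k: "k \<ge> 1"
    and nz: "\<And>as ds i. as \<in> height_paths k a b \<Longrightarrow> ds \<in> height_paths k d c \<Longrightarrow>
      (\<forall>i\<le>k. \<bar>as ! i - ds ! i\<bar> = 1) \<Longrightarrow> i \<in> {1..k} \<Longrightarrow>
      face_adjacent (as ! (i - 1)) (as ! i) (ds ! (i - 1)) (ds ! i) \<Longrightarrow> ds ! i = as ! (i - 1) \<Longrightarrow>
      s (of_int (as ! (i - 1))) \<noteq> 0 \<and> s (1 + (g 0 + of_nat k - of_nat i)) \<noteq> 0"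
  shows "isCont (\<lambda>t. fuse (weight t) k a b d c (g t)) 0"
proof (cases "a - b \<in> steps k")
  case False
  then show ?thesis by (simp add: fuse_top)
next
  case True
  let ?as = "some_path k a b"
  note as = some_path_in[OF True]
  have "isCont (\<lambda>t. \<Prod>i=1..k. weight t (?as ! (i - 1)) (?as ! i) (ds ! (i - 1)) (ds ! i) (g t + of_nat k - of_nat i)) 0"
    if ds: "ds \<in> height_paths k d c" for ds
  proof (cases "\<forall>i\<le>k. \<bar>?as ! i - ds ! i\<bar> = 1")
    case True
    show ?thesis
      by (intro continuous_intros isCont_weight cont g nz[OF as ds True])
  next
    case False
    then obtain i where i: "i \<le> k" "\<bar>?as ! i - ds ! i\<bar> \<noteq> 1" by blast
    have "\<exists>j\<in>{1..k}. \<not> face_adjacent (?as ! (j - 1)) (?as ! j) (ds ! (j - 1)) (ds ! j)"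
    proof (cases "i = 0")
      case True
      with i k show ?thesis by (intro bexI[of _ 1]) (auto simp: face_adjacent_def)
    next
      case False
      with i show ?thesis by (intro bexI[of _ i]) (auto simp: face_adjacent_def)
    qed
    then obtain j where "j \<in> {1..k}" "\<not> face_adjacent (?as ! (j - 1)) (?as ! j) (ds ! (j - 1)) (ds ! j)" by blast
    then have "(\<Prod>i=1..k. weight t (?as ! (i - 1)) (?as ! i) (ds ! (i - 1)) (ds ! i) (g t + of_nat k - of_nat i)) = 0" for t
      by (intro prod_zero bexI[of _ j]) (auto simp: weight_def)
    then show ?thesis by (simp only: continuous_const)
  qed
  then show ?thesis
    using True height_paths_nonempty[of k a b] unfolding fuse_eq_sum by (auto intro!: continuous_intros)
qed

lemma isCont_fweight:
  assumes cont: "\<And>x. isCont s x" and g: "isCont g 0" and k: "k \<ge> 1" and l: "l \<ge> 1"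
    and nz: "\<And>as bs as' ds i j. as \<in> height_paths l a d \<Longrightarrow> bs \<in> height_paths l b c \<Longrightarrow>
      (\<forall>i\<le>l. as ! i - bs ! i \<in> steps k) \<Longrightarrow> j \<in> {1..l} \<Longrightarrow>
      as' \<in> height_paths k (as ! (j - 1)) (bs ! (j - 1)) \<Longrightarrow> ds \<in> height_paths k (as ! j) (bs ! j) \<Longrightarrow>
      (\<forall>i\<le>k. \<bar>as' ! i - ds ! i\<bar> = 1) \<Longrightarrow> i \<in> {1..k} \<Longrightarrow>
      face_adjacent (as' ! (i - 1)) (as' ! i) (ds ! (i - 1)) (ds ! i) \<Longrightarrow> ds ! i = as' ! (i - 1) \<Longrightarrow>
      s (of_int (as' ! (i - 1))) \<noteq> 0 \<and> s (1 + (g 0 - of_nat l + of_nat j + of_nat k - of_nat i)) \<noteq> 0"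
  shows "isCont (\<lambda>t. fweight t k l a b d c (g t)) 0"
proof (cases "b - c \<in> steps l")
  case False
  then show ?thesis by (simp add: fweight_def fuse_top)
next
  case True
  let ?bs = "some_path l b c"
  note bs = some_path_in[OF True]
  have "isCont (\<lambda>t. \<Prod>j=1..l. fuse (weight t) k (as ! (j - 1)) (?bs ! (j - 1)) (as ! j) (?bs ! j)
      (g t - of_nat l + of_nat j)) 0" if as: "as \<in> height_paths l a d" for as
  proof (cases "\<forall>i\<le>l. as ! i - ?bs ! i \<in> steps k")
    case True
    show ?thesis
      by (intro continuous_intros isCont_fuse_weight cont g k nz[OF as bs True])
  next
    case False
    then obtain i where i: "i \<le> l" "as ! i - ?bs ! i \<notin> steps k" by blast
    have "(\<Prod>j=1..l. fuse (weight t) k (as ! (j - 1)) (?bs ! (j - 1)) (as ! j) (?bs ! j)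
      (g t - of_nat l + of_nat j)) = 0" for t
    proof (cases "i = 0")
      case True
      with i l show ?thesis by (intro prod_zero bexI[of _ 1]) (auto simp: fuse_top)
    next
      case False
      with i show ?thesis by (intro prod_zero bexI[of _ i]) (auto simp: fuse_bottom)
    qed
    then show ?thesis by (simp only: continuous_const)
  qed
  then show ?thesis
    using True height_paths_nonempty[of l b c] unfolding fweight_eq_sum by (auto intro!: continuous_intros)
qed

lemma
  assumes cont: "\<And>x. isCont s x" "\<And>x. isCont p x" "\<And>x. isCont q x" and g: "isCont g 0"
  shows isCont_ivec: "isCont (\<lambda>t. ivec t \<epsilon> (g t) a b) 0"
    and isCont_dvec: "s (of_int b) \<noteq> 0 \<Longrightarrow> s (g 0) \<noteq> 0 \<Longrightarrow> isCont (\<lambda>t. dvec t \<epsilon> (g t) a b) 0"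
proof -
  have s: "isCont (\<lambda>t. s (f t)) 0" "isCont (\<lambda>t. p (f t)) 0" "isCont (\<lambda>t. q (f t)) 0"
    if "isCont f 0" for f :: "complex \<Rightarrow> complex"
    using isCont_o2[OF that cont(1)] isCont_o2[OF that cont(2)] isCont_o2[OF that cont(3)] by auto
  have i: "isCont (\<lambda>t. ivec t \<epsilon> (h t) a b) 0" if "isCont h 0" for \<epsilon> and h :: "complex \<Rightarrow> complex"
    unfolding ivec_def vcomp_def by (cases "\<epsilon> = 1") (auto intro!: continuous_intros s that)
  show "isCont (\<lambda>t. ivec t \<epsilon> (g t) a b) 0" by (rule i[OF g])
  assume "s (of_int b) \<noteq> 0" "s (g 0) \<noteq> 0"
  then show "isCont (\<lambda>t. dvec t \<epsilon> (g t) a b) 0"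
    unfolding dvec_def by (intro continuous_intros i s g) auto
qed

lemma isCont_fuse_lmat:
  assumes cont: "\<And>x. isCont s x" "\<And>x. isCont p x" "\<And>x. isCont q x" and g: "isCont g 0"
    and nz: "\<And>cs i. cs \<in> height_paths k c d \<Longrightarrow> i \<in> {1..k} \<Longrightarrow>
      s (of_int (cs ! (i - 1))) \<noteq> 0 \<and> s (g 0 + of_nat k - of_nat i) \<noteq> 0"
  shows "isCont (\<lambda>t. fuse (lmat t) k a b c d (g t)) 0"
proof (cases "a - b \<in> steps k")
  case False
  then show ?thesis by (simp add: fuse_top)
next
  case True
  have l: "isCont (\<lambda>t. lmat t a' b' c' d' (h t)) 0"
    if "s (of_int c') \<noteq> 0" "s (h 0) \<noteq> 0" "isCont h 0" for a' b' c' d' and h :: "complex \<Rightarrow> complex"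
    using that unfolding lmat_def
    by (cases "b' \<in> nbrs a' \<and> d' \<in> nbrs c'") (auto intro!: continuous_intros isCont_ivec[OF cont] isCont_dvec[OF cont])
  have "isCont (\<lambda>t. \<Prod>i=1..k. lmat t (as ! (i - 1)) (as ! i) (cs ! (i - 1)) (cs ! i) (g t + of_nat k - of_nat i)) 0"
    if "cs \<in> height_paths k c d" for as cs
    using nz[OF that] by (intro continuous_intros l g) auto
  then show ?thesis
    using True height_paths_nonempty[of k a b] unfolding fuse_eq_sum by (auto intro!: continuous_intros)
qed

lemma isCont_lmat_k:
  assumes cont: "\<And>x. isCont s x" "\<And>x. isCont p x" "\<And>x. isCont q x"
    and nz: "\<And>cs i. cs \<in> height_paths k c d \<Longrightarrow> i \<in> {1..k} \<Longrightarrow>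
      s (of_int (cs ! (i - 1))) \<noteq> 0 \<and> s (u + of_nat k - of_nat i) \<noteq> 0"
  shows "isCont (\<lambda>t. lmat_k t k a b c d u) 0"
  unfolding lmat_k_def
  by (intro continuous_intros isCont_ivec[OF cont] isCont_dvec[OF cont]) (use nz in auto)

lemma countable_affine_zeros:
  assumes "countable {x. s x = 0}" "\<beta> \<noteq> 0"
  shows "countable {t. s (\<alpha> + \<beta> * t) = 0}"
proof -
  have "{t. s (\<alpha> + \<beta> * t) = 0} \<subseteq> (\<lambda>x. (x - \<alpha>) / \<beta>) ` {x. s x = 0}"
  proof
    fix t assume "t \<in> {t. s (\<alpha> + \<beta> * t) = 0}"
    then show "t \<in> (\<lambda>x. (x - \<alpha>) / \<beta>) ` {x. s x = 0}"
      using assms(2) by (intro image_eqI[of _ _ "\<alpha> + \<beta> * t"]) auto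
  qed
  then show ?thesis using assms(1) by (meson countable_image countable_subset)
qed

text \<open>The displacement \<open>2 t\<close> of \<open>u\<close> makes each of the four families of brackets depend on \<open>t\<close>: their arguments move at the rates
\<open>1, 2, - 1\<close> and \<open>3\<close>.\<close>

lemma countable_not_generic:
  assumes z: "countable {x. s x = 0}"
  shows "countable {t. \<not> generic t (u + 2 * t) v}"
proof -
  have "{t. \<not> generic t (u + 2 * t) v} \<subseteq> (\<Union>n :: int. {t. s (of_int n + 1 * t) = 0} \<union>
      {t. s (u - v + of_int n + 2 * t) = 0} \<union> {t. s (of_int n - u + (- 1) * t) = 0} \<union>
      {t. s (of_int n + u + 3 * t) = 0})"
    by (auto simp: generic_def algebra_simps)
  moreover have "countable \<dots>"
    by (intro countable_UN countable_Un countable_affine_zeros[OF z]) auto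
  ultimately show ?thesis by (rule countable_subset)
qed

end

section \<open>Identification with the fused weights\<close>

definition nu0 :: "complex \<Rightarrow> complex \<Rightarrow> complex \<Rightarrow> complex" where
  "nu0 r \<tau> x = theta0 (x / (2 * r)) (\<tau> / 2)"

definition nu3 :: "complex \<Rightarrow> complex \<Rightarrow> complex \<Rightarrow> complex" where
  "nu3 r \<tau> x = theta3 (x / (2 * r)) (\<tau> / 2)"

lemma bracket_eq_0_iff:
  assumes "Im \<tau> > 0"
  shows "bracket r \<tau> x = 0 \<longleftrightarrow> (\<exists>m n :: int. x / r = of_int m + of_int n * \<tau>)"
proof -
  have "Cconst r \<tau> \<noteq> 0" using assms by (auto simp: Cconst_def xpow_def)
  then show ?thesis by (simp add: bracket_def theta1_eq_0_iff[OF assms])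
qed

lemma theta_pair_bracket:
  assumes tau: "Im \<tau> > 0" and r: "r \<noteq> 0"
  obtains \<kappa> where "theta_pair (nu0 r \<tau>) (nu3 r \<tau>) (bracket r \<tau>) \<kappa>"
proof -
  obtain \<kappa> where \<kappa>: "\<kappa> \<noteq> 0"
    "\<And>x y. theta3 (x + y) (\<tau> / 2) * theta0 (x - y) (\<tau> / 2) - theta0 (x + y) (\<tau> / 2) * theta3 (x - y) (\<tau> / 2)
       = \<kappa> * theta1 (2 * x) \<tau> * theta1 (2 * y) \<tau>"
    by (rule theta_addition_formula[OF tau]) (rule that)
  have C: "Cconst r \<tau> \<noteq> 0" using tau by (auto simp: Cconst_def xpow_def)
  have tau2: "Im (\<tau> / 2) > 0" using tau by simp
  have "theta_pair (nu0 r \<tau>) (nu3 r \<tau>) (bracket r \<tau>) (\<kappa> / (Cconst r \<tau>)\<^sup>2)"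
  proof
    fix x y
    show "nu0 r \<tau> (- x) = nu0 r \<tau> x" "nu3 r \<tau> (- x) = nu3 r \<tau> x"
      using theta0_minus[OF tau2, of "x / (2 * r)"] theta3_minus[OF tau2, of "x / (2 * r)"] by (simp_all add: nu0_def nu3_def)
    show "bracket r \<tau> (- x) = - bracket r \<tau> x"
      using theta1_minus[of "x / r"] by (simp add: bracket_def)
    show "\<kappa> / (Cconst r \<tau>)\<^sup>2 \<noteq> 0" using \<kappa> C by simp
    show "nu3 r \<tau> (x + y) * nu0 r \<tau> (x - y) - nu0 r \<tau> (x + y) * nu3 r \<tau> (x - y)
        = \<kappa> / (Cconst r \<tau>)\<^sup>2 * bracket r \<tau> x * bracket r \<tau> y"
      using \<kappa>(2)[of "x / (2 * r)" "y / (2 * r)"] C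
      by (simp add: nu0_def nu3_def bracket_def power2_eq_square add_divide_distrib diff_divide_distrib)
  qed
  then show thesis by (rule that)
qed

lemma countable_bracket_zeros:
  assumes "Im \<tau> > 0" "r \<noteq> 0"
  shows "countable {x. bracket r \<tau> x = 0}"
proof -
  have "{x. bracket r \<tau> x = 0} \<subseteq> (\<lambda>(m, n). r * (of_int m + of_int n * \<tau>)) ` (UNIV :: (int \<times> int) set)"
  proof
    fix x assume "x \<in> {x. bracket r \<tau> x = 0}"
    then obtain m n :: int where "x / r = of_int m + of_int n * \<tau>"
      by (auto simp: bracket_eq_0_iff[OF assms(1)])
    then have "x = r * (of_int m + of_int n * \<tau>)" using assms(2) by (simp add: field_simps)
    then show "x \<in> (\<lambda>(m, n). r * (of_int m + of_int n * \<tau>)) ` (UNIV :: (int \<times> int) set)"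
      by (intro image_eqI[of _ _ "(m, n)"]) auto
  qed
  then show ?thesis by (rule countable_subset) simp
qed

lemma
  assumes tau: "Im \<tau> > 0"
  shows isCont_bracket: "isCont (bracket r \<tau>) x" and isCont_nu0: "isCont (nu0 r \<tau>) x" and isCont_nu3: "isCont (nu3 r \<tau>) x"
proof -
  have tau2: "Im (\<tau> / 2) > 0" using tau by simp
  have c: "isCont (\<lambda>x. f (x / c)) x" if "f holomorphic_on UNIV" for f :: "complex \<Rightarrow> complex" and c
  proof -
    have "isCont f (x / c)"
      using holomorphic_on_imp_continuous_on[OF that] by (simp add: continuous_on_eq_continuous_at)
    moreover have "isCont (\<lambda>x. x / c) x"
      unfolding divide_inverse by (intro continuous_intros)
    ultimately show ?thesis by (rule isCont_o2[rotated])
  qed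
  show "isCont (nu0 r \<tau>) x" "isCont (nu3 r \<tau>) x"
    using c[OF holomorphic_theta0[OF tau2], of "2 * r"] c[OF holomorphic_theta3[OF tau2], of "2 * r"]
    unfolding nu0_def[abs_def] nu3_def[abs_def] by auto
  show "isCont (bracket r \<tau>) x"
    unfolding bracket_def[abs_def] by (intro continuous_intros c[OF holomorphic_theta1[OF tau]])
qed

lemma face_weight_eq:
  assumes "theta_pair p q (bracket r \<tau>) \<kappa>"
  shows "face_weight r \<tau> a b d c u = R0 r \<tau> u * theta_pair.weight (bracket r \<tau>) 0 a b d c u"
  by (simp add: face_weight_def theta_pair.weight_def[OF assms])

lemma face_weight_k1_eq:
  assumes "theta_pair p q (bracket r \<tau>) \<kappa>"
  shows "face_weight_k1 r \<tau> k a b d c u = (\<Prod>i=1..k. R0 r \<tau> (u + of_nat k - of_nat i)) *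
    fuse (theta_pair.weight (bracket r \<tau>) 0) k a b d c u"
  unfolding face_weight_k1_def fuse_eq_sum Let_def
  by (simp add: face_weight_eq[OF assms] prod.distrib sum_distrib_left)

lemma face_weight_kl_eq:
  assumes "theta_pair p q (bracket r \<tau>) \<kappa>"
  shows "face_weight_kl r \<tau> k l a b d c u =
    (\<Prod>j=1..l. \<Prod>i=1..k. R0 r \<tau> (u - of_nat l + of_nat j + of_nat k - of_nat i)) *
    theta_pair.fweight (bracket r \<tau>) 0 k l a b d c u"
  unfolding face_weight_kl_def theta_pair.fweight_eq_sum[OF assms] Let_def
  by (simp add: face_weight_k1_eq[OF assms] prod.distrib sum_distrib_left)

lemma L_matrix_eq_lmat_k:
  assumes "theta_pair (nu0 r \<tau>) (nu3 r \<tau>) (bracket r \<tau>) \<kappa>"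
  shows "L_matrix r \<tau> k a b c d u =
    theta_pair.lmat_k (nu0 r \<tau>) (nu3 r \<tau>) (bracket r \<tau>) ((Cconst r \<tau>)\<^sup>2) 0 k a b c d u"
proof -
  interpret theta_pair "nu0 r \<tau>" "nu3 r \<tau>" "bracket r \<tau>" \<kappa> "(Cconst r \<tau>)\<^sup>2" by (rule assms)
  have i: "psi r \<tau> \<epsilon> u a b = ivec 0 \<epsilon> u a b" for \<epsilon> u a b
    by (simp add: psi_def ivec_def vcomp_def nu0_def nu3_def)
  have d: "psi_star r \<tau> \<epsilon> u a b = dvec 0 \<epsilon> u a b" for \<epsilon> u a b
    by (simp add: psi_star_def dvec_def i)
  show ?thesis
    by (simp add: L_matrix_def psi_k_def psi_star_k_def lmat_k_def i d Let_def)
qed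

text \<open>At the given heights only the denominators of \<open>L\<close> itself are known not to vanish, which is too little for the flips; hence the passage
to the limit.\<close>

lemma L_matrix_eq_fuse:
  assumes tp: "theta_pair (nu0 r \<tau>) (nu3 r \<tau>) (bracket r \<tau>) \<kappa>" and tau: "Im \<tau> > 0" and r: "r \<noteq> 0"
    and L: "L_generic r \<tau> k c d u" and ab: "a - b \<in> steps k"
  shows "L_matrix r \<tau> k a b c d u =
    fuse (theta_pair.lmat (nu0 r \<tau>) (nu3 r \<tau>) (bracket r \<tau>) ((Cconst r \<tau>)\<^sup>2) 0) k a b c d u"
proof -
  interpret theta_pair "nu0 r \<tau>" "nu3 r \<tau>" "bracket r \<tau>" \<kappa> "(Cconst r \<tau>)\<^sup>2" by (rule tp)
  note cont = isCont_bracket[OF tau] isCont_nu0[OF tau] isCont_nu3[OF tau]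
  have nz: "bracket r \<tau> (of_int (cs ! (i - 1))) \<noteq> 0 \<and> bracket r \<tau> (u + of_nat k - of_nat i) \<noteq> 0"
    if "cs \<in> height_paths k c d" "i \<in> {1..k}" for cs i
    using L that by (simp add: L_generic_def)
  have "lmat_k 0 k a b c d u = fuse (lmat 0) k a b c d u"
  proof (rule eq_at_0_of_countable_exceptions)
    show "isCont (\<lambda>t. lmat_k t k a b c d u) 0" by (rule isCont_lmat_k[OF cont nz])
    show "isCont (\<lambda>t. fuse (lmat t) k a b c d u) 0"
      by (rule isCont_fuse_lmat[OF cont, of "\<lambda>_. u"]) (use nz in auto)
    show "countable {t. \<not> generic t (u + 2 * t) 0}"
      by (rule countable_not_generic[OF countable_bracket_zeros[OF tau r]])
    fix t assume "t \<notin> {t. \<not> generic t (u + 2 * t) 0}"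
    then show "lmat_k t k a b c d u = fuse (lmat t) k a b c d u"
      by (intro lmat_k_eq_fuse ab) (simp add: generic_def)
  qed
  then show ?thesis by (simp add: L_matrix_eq_lmat_k[OF tp])
qed

theorem theorem3p9:
  fixes r \<tau> u v :: complex and k l :: nat and a b c e f g :: int
  assumes "Im \<tau> > 0" and "r \<noteq> 0" and "norm (xpow r \<tau> 1) < 1"
    and "k \<ge> 1" and "l \<ge> 1"
    and "a - b \<in> steps k" and "f - e \<in> steps k"
    and "b - c \<in> steps l" and "g - f \<in> steps l"
    and "\<And>d. a - d \<in> steps l \<Longrightarrow> d - c \<in> steps k \<Longrightarrow> face_kl_generic r \<tau> k l a b d c (u - v)"
    and "L_generic r \<tau> k f e u" and "L_generic r \<tau> l g f v"
    and "\<And>d. g - d \<in> steps k \<Longrightarrow> d - e \<in> steps l \<Longrightarrow>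
           L_generic r \<tau> k g d u \<and> L_generic r \<tau> l d e v \<and>
           face_kl_generic r \<tau> k l g d f e (u - v)"
  shows "(\<Sum>d | a - d \<in> steps l \<and> d - c \<in> steps k.
            face_weight_kl r \<tau> k l a b d c (u - v) *
            L_matrix r \<tau> k d c f e u * L_matrix r \<tau> l a d g f v)
       = (\<Sum>d | g - d \<in> steps k \<and> d - e \<in> steps l.
            L_matrix r \<tau> k a b g d u * L_matrix r \<tau> l b c d e v *
            face_weight_kl r \<tau> k l g d f e (u - v))"
proof -
  note tau = assms(1) and r = assms(2) and k = assms(4) and l = assms(5)
  obtain \<kappa> where tp: "theta_pair (nu0 r \<tau>) (nu3 r \<tau>) (bracket r \<tau>) \<kappa>"
    by (rule theta_pair_bracket[OF tau r])
  interpret theta_pair "nu0 r \<tau>" "nu3 r \<tau>" "bracket r \<tau>" \<kappa> "(Cconst r \<tau>)\<^sup>2" by (rule tp)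
  note cont = isCont_bracket[OF tau] isCont_nu0[OF tau] isCont_nu3[OF tau]
  define D where "D = {d. a - d \<in> steps l \<and> d - c \<in> steps k}"
  define D' where "D' = {d. g - d \<in> steps k \<and> d - e \<in> steps l}"
  have D: "D \<subseteq> reach l a" and D': "D' \<subseteq> reach k g" by (auto simp: D_def D'_def in_reach_iff)
  have "(\<Sum>d\<in>D. fweight 0 k l a b d c (u + 2 * 0 - v) * fuse (lmat 0) k d c f e (u + 2 * 0) * fuse (lmat 0) l a d g f v)
    = (\<Sum>d\<in>D'. fuse (lmat 0) k a b g d (u + 2 * 0) * fuse (lmat 0) l b c d e v * fweight 0 k l g d f e (u + 2 * 0 - v))"
  proof (rule eq_at_0_of_countable_exceptions)
    have W: "isCont (\<lambda>t. fweight t k l a b d c (u + 2 * t - v)) 0" if "face_kl_generic r \<tau> k l a b d c (u - v)" for a b d c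
    proof (rule isCont_fweight[OF cont(1) _ k l])
      fix as bs as' ds :: "int list" and i j
      assume "as \<in> height_paths l a d" "bs \<in> height_paths l b c" "\<forall>i\<le>l. as ! i - bs ! i \<in> steps k" "j \<in> {1..l}"
        "as' \<in> height_paths k (as ! (j - 1)) (bs ! (j - 1))" "ds \<in> height_paths k (as ! j) (bs ! j)"
        "\<forall>i\<le>k. \<bar>as' ! i - ds ! i\<bar> = 1" "i \<in> {1..k}"
        "face_adjacent (as' ! (i - 1)) (as' ! i) (ds ! (i - 1)) (ds ! i)" "ds ! i = as' ! (i - 1)"
      with that show "bracket r \<tau> (of_int (as' ! (i - 1))) \<noteq> 0 \<and>
          bracket r \<tau> (1 + (u + 2 * 0 - v - of_nat l + of_nat j + of_nat k - of_nat i)) \<noteq> 0"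
        unfolding face_kl_generic_def face_k1_generic_def face_generic_def by simp
    qed (intro continuous_intros)
    have M: "isCont (\<lambda>t. fuse (lmat t) k' a b c d (u' + m * t)) 0" if "L_generic r \<tau> k' c d u'" for k' a b c d u' m
      using that by (intro isCont_fuse_lmat[OF cont]) (auto intro!: continuous_intros simp: L_generic_def)
    have M': "isCont (\<lambda>t. fuse (lmat t) k' a b c d u') 0" if "L_generic r \<tau> k' c d u'" for k' a b c d u'
      using M[OF that, of a b 0] by simp
    show "isCont (\<lambda>t. \<Sum>d\<in>D. fweight t k l a b d c (u + 2 * t - v) * fuse (lmat t) k d c f e (u + 2 * t) * fuse (lmat t) l a d g f v) 0"
      using assms(10-12) by (intro continuous_intros W M M') (auto simp: D_def)
    show "isCont (\<lambda>t. \<Sum>d\<in>D'. fuse (lmat t) k a b g d (u + 2 * t) * fuse (lmat t) l b c d e v * fweight t k l g d f e (u + 2 * t - v)) 0"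
      using assms(13) by (intro continuous_intros W M M') (auto simp: D'_def)
    show "countable {t. \<not> generic t (u + 2 * t) v}"
      by (rule countable_not_generic[OF countable_bracket_zeros[OF tau r]])
    fix t assume "t \<notin> {t. \<not> generic t (u + 2 * t) v}"
    then have g: "generic t (u + 2 * t) v" by simp
    have "(\<Sum>d\<in>D. fweight t k l a b d c (u + 2 * t - v) * fuse (lmat t) k d c f e (u + 2 * t) * fuse (lmat t) l a d g f v)
      = (\<Sum>d\<in>reach l a. fweight t k l a b d c (u + 2 * t - v) * fuse (lmat t) k d c f e (u + 2 * t) * fuse (lmat t) l a d g f v)"
      using D by (intro sum.mono_neutral_left) (auto simp: D_def in_reach_iff fuse_top)
    also have "\<dots> = (\<Sum>d\<in>reach k g. fuse (lmat t) k a b g d (u + 2 * t) * fuse (lmat t) l b c d e v * fweight t k l g d f e (u + 2 * t - v))"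
      by (rule fused_exchange[OF g k])
    also have "\<dots> = (\<Sum>d\<in>D'. fuse (lmat t) k a b g d (u + 2 * t) * fuse (lmat t) l b c d e v * fweight t k l g d f e (u + 2 * t - v))"
      using D' by (intro sum.mono_neutral_right) (auto simp: D'_def in_reach_iff fuse_bottom)
    finally show "(\<Sum>d\<in>D. fweight t k l a b d c (u + 2 * t - v) * fuse (lmat t) k d c f e (u + 2 * t) * fuse (lmat t) l a d g f v)
      = (\<Sum>d\<in>D'. fuse (lmat t) k a b g d (u + 2 * t) * fuse (lmat t) l b c d e v * fweight t k l g d f e (u + 2 * t - v))" .
  qed
  then have main: "(\<Sum>d\<in>D. fweight 0 k l a b d c (u - v) * fuse (lmat 0) k d c f e u * fuse (lmat 0) l a d g f v)
    = (\<Sum>d\<in>D'. fuse (lmat 0) k a b g d u * fuse (lmat 0) l b c d e v * fweight 0 k l g d f e (u - v))"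
    by simp
  define \<rho> where "\<rho> = (\<Prod>j=1..l. \<Prod>i=1..k. R0 r \<tau> (u - v - of_nat l + of_nat j + of_nat k - of_nat i))"
  note w = face_weight_kl_eq[OF tp, of k l _ _ _ _ "u - v", folded \<rho>_def]
  note L = L_matrix_eq_fuse[OF tp tau r]
  have "(\<Sum>d\<in>D. face_weight_kl r \<tau> k l a b d c (u - v) * L_matrix r \<tau> k d c f e u * L_matrix r \<tau> l a d g f v)
    = \<rho> * (\<Sum>d\<in>D. fweight 0 k l a b d c (u - v) * fuse (lmat 0) k d c f e u * fuse (lmat 0) l a d g f v)"
    unfolding sum_distrib_left
    by (rule sum.cong[OF refl]) (simp add: D_def w L[OF assms(11)] L[OF assms(12)] mult_ac)
  also have "\<dots> = (\<Sum>d\<in>D'. L_matrix r \<tau> k a b g d u * L_matrix r \<tau> l b c d e v * face_weight_kl r \<tau> k l g d f e (u - v))"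
    unfolding main sum_distrib_left
    by (rule sum.cong[OF refl]) (use assms(13) in \<open>simp add: D'_def w L[OF _ assms(6)] L[OF _ assms(8)] mult_ac\<close>)
  finally show ?thesis unfolding D_def D'_def .
qed

end
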